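(* Let $\mathcal{N}_{A\to B}$ be a completely positive linear map (not necessarily trace preserving) and let $r\in[0,\infty)$ be a real number. Then $$E_{\mathrm{retro,C}}^{r}(\mathcal{N})=\max\left\{0,\ I_{\max}(\mathcal{N})+I_{\mathrm{doe}}^{\infty}(\mathcal{N})-r\right\},$$ $$S_{\mathrm{retro,C}}^{r}(\mathcal{N})=\max\left\{0,\ r-I_{\max}(\mathcal{N})-I_{\mathrm{doe}}^{\infty}(\mathcal{N})\right\}.$$
   Context: All quantum systems are finite-dimensional Hilbert spaces; $d_A$ denotes the dimension of system $A$, and $\mathbb{N}$ is the set of nonnegative integers. A state is a positive semidefinite unit-trace operator; $\mathcal{D}_B$ is the set of states of $B$ and $\mathrm{aff}(\mathcal{D}_B)$ is the set of unit-trace Hermitian operators on $B$. A channel is a completely positive trace-preserving linear map. Maps act as the identity on systems not listed in their subscript. Primed systems are isomorphic copies ($A'\cong A$). $\Phi_{AA'}=\frac{1}{d_A}\sum_{i,j}|i\rangle\langle j|_A\otimes|i\rangle\langle j|_{A'}$ is the standard maximally entangled state, and $\pi_A=\mathbb{1}_A/d_A$. For a linear map $\mathcal{N}_{A\to B}$ its Choi operator is $\Phi^{\mathcal{N}}_{A'B}=\mathcal{N}_{A\to B}[\Phi_{A'A}]$. Max-information and Doeblin information of a completely positive map (operator inequalities in the Loewner order, $\inf\emptyset=+\infty$): $$I_{\max}(\mathcal{N})=\inf_{\lambda\in\mathbb{R},\,\sigma_B\in\mathcal{D}_B}\{\log_2\lambda:\Phi^{\mathcal{N}}_{A'B}\leq\lambda\,\pi_{A'}\otimes\sigma_B\},\qquad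 I_{\mathrm{doe}}(\mathcal{N})=\inf_{\lambda\in\mathbb{R},\,\tau_B\in\mathrm{aff}(\mathcal{D}_B)}\{\log_2\lambda:\pi_{A'}\otimes\tau_B\leq\lambda\,\Phi^{\mathcal{N}}_{A'B}\}.$$ The regularized Doeblin information is $I_{\mathrm{doe}}^{\infty}(\mathcal{N})=\lim_{n\to\infty}\frac{1}{n}I_{\mathrm{doe}}(\mathcal{N}^{\otimes n})$ (the limit exists, by superadditivity of $I_{\mathrm{doe}}$ under tensor products). The Doeblin information may equal $+\infty$. Loop supermap: for a linear map $\mathcal{T}_{EA\to FA}$ and an operator $\rho_{RE}$ ($R$ any reference system, possibly trivial), $\Gamma_A\{\mathcal{T}_{EA\to FA}\}[\rho_{RE}]=\mathrm{Tr}_{AA'}\big[\Phi_{AA'}\,\mathcal{T}_{EA\to FA}[\rho_{RE}\otimes\Phi_{AA'}]\big]$. Retrocausal communication: a strategy for $\mathcal{N}_{A\to B}$ is a pair of channels $(\mathcal{E}_{ML\to A},\mathcal{D}_{B\to\widehat{M}L})$ with $\widehat{M}\cong M$ and $L$ an arbitrary system. Write $\mathcal{G}_{M\to\widehat{M}}=\Gamma_A\{\mathcal{E}_{ML\to A}\circ\mathcal{D}_{B\to\widehat{M}L}\circ\mathcal{N}_{A\to B}\}$, where the composition is viewed as a map from $MA$ to $\widehat{M}A$. With $\{|m\rangle\}_{m=0}^{d_M-1}$ an orthonormal basis of $M$ (and correspondingly of $\widehat{M}$), representing the symbols of an alphabet of size $d_M$, the worst-case classical error probability is $$p_{\mathrm{error}}((\mathcal{E},\mathcal{D}),\mathcal{N})=1-\min_{0\leq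 m\leq d_M-1}\frac{\mathrm{Tr}\big[|m\rangle\langle m|_{\widehat{M}}\,\mathcal{G}[|m\rangle\langle m|_M]\big]}{\mathrm{Tr}\big[\mathcal{G}[|m\rangle\langle m|_M]\big]}.$$ For a transmission rate $r\in[0,\infty)$, the error exponent and strong-converse exponent of retrocausal classical communication are $$E_{\mathrm{retro,C}}^{r}(\mathcal{N})=\liminf_{n\to\infty}\ \sup\left\{-\tfrac{1}{n}\log_2 p_{\mathrm{error}}\big((\mathcal{E}_{ML\to A^n},\mathcal{D}_{B^n\to\widehat{M}L}),\mathcal{N}^{\otimes n}\big): d_M\geq 2^{nr}\right\},$$ $$S_{\mathrm{retro,C}}^{r}(\mathcal{N})=\limsup_{n\to\infty}\ \inf\left\{-\tfrac{1}{n}\log_2\Big(1-p_{\mathrm{error}}\big((\mathcal{E}_{ML\to A^n},\mathcal{D}_{B^n\to\widehat{M}L}),\mathcal{N}^{\otimes n}\big)\Big): d_M\geq 2^{nr}\right\},$$ where the supremum and infimum are over all $d_M,d_L\in\mathbb{N}$ and all strategies $(\mathcal{E}_{ML\to A^n},\mathcal{D}_{B^n\to\widehat{M}L})$ for $\mathcal{N}^{\otimes n}$ (from $A^n$ to $B^n$).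
   Formalization: The map is assumed nonzero (for the zero map both sides are undefined), and the error exponent ranges only over alphabets with d_M ≥ 2; this matters only at r = 0, where a one-letter alphabet has error 0 and would make the exponent infinite, contradicting the formula. *)

theory Defs
  imports
    "Jordan_Normal_Form.Schur_Decomposition"
    "HOL-Library.Extended_Real"
begin

(* Conventions.  A system of dimension d is the space C^d with its standard basis, and operators
   on it are the elements of carrier_mat d d.  The composite of systems of dimensions d1 and d2
   (in this order) is C^(d1 * d2), the basis vector |a>|b> having index a * d2 + b; with this
   encoding composition of systems is strictly associative.  A linear map from operators on C^dA
   to operators on C^dB is a function N :: complex mat => complex mat which is only relevant on
   carrier_mat dA dA. *)

section \<open>Operators\<close>

definition mtrace :: "complex mat \<Rightarrow> complex" where
  "mtrace X = (\<Sum>i<dim_row X. X $$ (i, i))"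

definition hermitian_op :: "nat \<Rightarrow> complex mat \<Rightarrow> bool" where
  "hermitian_op d X \<longleftrightarrow> X \<in> carrier_mat d d \<and> mat_adjoint X = X"

(* The order on complex numbers: 0 \<le> z says that z is real and nonnegative. *)
definition psd :: "nat \<Rightarrow> complex mat \<Rightarrow> bool" where
  "psd d X \<longleftrightarrow> hermitian_op d X \<and> (\<forall>v\<in>carrier_vec d. 0 \<le> (X *\<^sub>v v) \<bullet>c v)"

definition loewner_le :: "nat \<Rightarrow> complex mat \<Rightarrow> complex mat \<Rightarrow> bool" where
  "loewner_le d X Y \<longleftrightarrow> psd d (Y - X)"

definition state :: "nat \<Rightarrow> complex mat \<Rightarrow> bool" where
  "state d \<rho> \<longleftrightarrow> psd d \<rho> \<and> mtrace \<rho> = 1"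

definition aff_state :: "nat \<Rightarrow> complex mat \<Rightarrow> bool" where
  "aff_state d \<tau> \<longleftrightarrow> hermitian_op d \<tau> \<and> mtrace \<tau> = 1"

(* |a><b| *)
definition ketbra :: "nat \<Rightarrow> nat \<Rightarrow> nat \<Rightarrow> complex mat" where
  "ketbra d a b = mat d d (\<lambda>(i, j). if i = a \<and> j = b then 1 else 0)"

definition kron :: "complex mat \<Rightarrow> complex mat \<Rightarrow> complex mat" where
  "kron X Y = mat (dim_row X * dim_row Y) (dim_col X * dim_col Y)
     (\<lambda>(i, j). X $$ (i div dim_row Y, j div dim_col Y) * Y $$ (i mod dim_row Y, j mod dim_col Y))"

(* Trace over the second factor of C^d1 \<otimes> C^d2. *)
definition ptrace2 :: "nat \<Rightarrow> nat \<Rightarrow> complex mat \<Rightarrow> complex mat" where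
  "ptrace2 d1 d2 X = mat d1 d1 (\<lambda>(i, j). \<Sum>k<d2. X $$ (i * d2 + k, j * d2 + k))"

definition max_mixed :: "nat \<Rightarrow> complex mat" where
  "max_mixed d = (1 / of_nat d) \<cdot>\<^sub>m 1\<^sub>m d"

(* (1/d) * sum_{a,b} |a><b| \<otimes> |a><b|, written entrywise. *)
definition max_entangled :: "nat \<Rightarrow> complex mat" where
  "max_entangled d = mat (d * d) (d * d)
     (\<lambda>(i, j). if i div d = i mod d \<and> j div d = j mod d then 1 / of_nat d else 0)"

section \<open>Linear maps between operator spaces\<close>

definition linear_op_map :: "nat \<Rightarrow> nat \<Rightarrow> (complex mat \<Rightarrow> complex mat) \<Rightarrow> bool" where
  "linear_op_map dA dB N \<longleftrightarrow>
     (\<forall>X\<in>carrier_mat dA dA. N X \<in> carrier_mat dB dB) \<and>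
     (\<forall>X\<in>carrier_mat dA dA. \<forall>Y\<in>carrier_mat dA dA. N (X + Y) = N X + N Y) \<and>
     (\<forall>c. \<forall>X\<in>carrier_mat dA dA. N (c \<cdot>\<^sub>m X) = c \<cdot>\<^sub>m N X)"

(* N \<otimes> P for N : A -> B and P : C -> D, obtained by expanding X in the product basis
   |a><a'| \<otimes> |c><c'|. *)
definition tensor_map ::
  "nat \<Rightarrow> nat \<Rightarrow> (complex mat \<Rightarrow> complex mat) \<Rightarrow> nat \<Rightarrow> nat \<Rightarrow> (complex mat \<Rightarrow> complex mat)
    \<Rightarrow> complex mat \<Rightarrow> complex mat" where
  "tensor_map dA dB N dC dD P X = mat (dB * dD) (dB * dD)
     (\<lambda>(i, j). \<Sum>a<dA. \<Sum>a'<dA. \<Sum>c<dC. \<Sum>c'<dC.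
        X $$ (a * dC + c, a' * dC + c') * kron (N (ketbra dA a a')) (P (ketbra dC c c')) $$ (i, j))"

fun tensor_power ::
  "nat \<Rightarrow> nat \<Rightarrow> (complex mat \<Rightarrow> complex mat) \<Rightarrow> nat \<Rightarrow> complex mat \<Rightarrow> complex mat" where
  "tensor_power dA dB N 0 = id"
| "tensor_power dA dB N (Suc n) =
     tensor_map dA dB N (dA ^ n) (dB ^ n) (tensor_power dA dB N n)"

(* The isomorphism from operators on C^d1 \<otimes> C^d2 to operators on C^d2 \<otimes> C^d1. *)
definition swap_map :: "nat \<Rightarrow> nat \<Rightarrow> complex mat \<Rightarrow> complex mat" where
  "swap_map d1 d2 X = mat (d2 * d1) (d2 * d1)
     (\<lambda>(i, j). X $$ ((i mod d1) * d2 + i div d1, (j mod d1) * d2 + j div d1))"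

definition cp_map :: "nat \<Rightarrow> nat \<Rightarrow> (complex mat \<Rightarrow> complex mat) \<Rightarrow> bool" where
  "cp_map dA dB N \<longleftrightarrow> linear_op_map dA dB N \<and>
     (\<forall>k X. psd (k * dA) X \<longrightarrow> psd (k * dB) (tensor_map k k id dA dB N X))"

definition channel :: "nat \<Rightarrow> nat \<Rightarrow> (complex mat \<Rightarrow> complex mat) \<Rightarrow> bool" where
  "channel dA dB N \<longleftrightarrow> cp_map dA dB N \<and> (\<forall>X\<in>carrier_mat dA dA. mtrace (N X) = mtrace X)"

(* The Choi operator on A' \<otimes> B. *)
definition choi :: "nat \<Rightarrow> nat \<Rightarrow> (complex mat \<Rightarrow> complex mat) \<Rightarrow> complex mat" where
  "choi dA dB N = tensor_map dA dA id dA dB N (max_entangled dA)"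

section \<open>Information quantities\<close>

(* Base-2 logarithm with value -\<infinity> at 0.  The value at negative arguments is immaterial: both
   infima below are over sets of \<lambda> > 0 when the map is completely positive and nonzero (take
   traces), and error probabilities are nonnegative. *)
definition elog2 :: "real \<Rightarrow> ereal" where
  "elog2 x = (if 0 < x then ereal (log 2 x) else -\<infinity>)"

definition I_max :: "nat \<Rightarrow> nat \<Rightarrow> (complex mat \<Rightarrow> complex mat) \<Rightarrow> ereal" where
  "I_max dA dB N = Inf {elog2 l | l \<sigma>. state dB \<sigma> \<and>
     loewner_le (dA * dB) (choi dA dB N) (of_real l \<cdot>\<^sub>m kron (max_mixed dA) \<sigma>)}"

definition I_doe :: "nat \<Rightarrow> nat \<Rightarrow> (complex mat \<Rightarrow> complex mat) \<Rightarrow> ereal" where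
  "I_doe dA dB N = Inf {elog2 l | l \<tau>. aff_state dB \<tau> \<and>
     loewner_le (dA * dB) (kron (max_mixed dA) \<tau>) (of_real l \<cdot>\<^sub>m choi dA dB N)}"

definition I_doe_reg :: "nat \<Rightarrow> nat \<Rightarrow> (complex mat \<Rightarrow> complex mat) \<Rightarrow> ereal" where
  "I_doe_reg dA dB N =
     lim (\<lambda>n. ereal (1 / real n) * I_doe (dA ^ n) (dB ^ n) (tensor_power dA dB N n))"

section \<open>Retrocausal communication\<close>

(* The loop supermap on A applied to T : E \<otimes> A -> F \<otimes> A; the factors are ordered E, A, A'
   before and F, A, A' after the application of T. *)
definition loop_map ::
  "nat \<Rightarrow> nat \<Rightarrow> nat \<Rightarrow> (complex mat \<Rightarrow> complex mat) \<Rightarrow> complex mat \<Rightarrow> complex mat" where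
  "loop_map dE dF dA T \<rho> = ptrace2 dF (dA * dA)
     (kron (1\<^sub>m dF) (max_entangled dA) *
      tensor_map (dE * dA) (dF * dA) T dA dA id (kron \<rho> (max_entangled dA)))"

(* The map M \<rightarrow> Mhat simulated by an encoder Enc : M \<otimes> L -> A and a decoder
   Dec : B -> Mhat \<otimes> L.  The systems run through
   M A, M B, M Mhat L, Mhat M L, Mhat A. *)
definition retro_map ::
  "nat \<Rightarrow> nat \<Rightarrow> (complex mat \<Rightarrow> complex mat) \<Rightarrow> nat \<Rightarrow> nat
    \<Rightarrow> (complex mat \<Rightarrow> complex mat) \<Rightarrow> (complex mat \<Rightarrow> complex mat) \<Rightarrow> complex mat \<Rightarrow> complex mat" where
  "retro_map dA dB N dM dL Enc Dec = loop_map dM dM dA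
     (tensor_map dM dM id (dM * dL) dA Enc \<circ>
      tensor_map (dM * dM) (dM * dM) (swap_map dM dM) dL dL id \<circ>
      tensor_map dM dM id dB (dM * dL) Dec \<circ>
      tensor_map dM dM id dA dB N)"

(* Postselection may fail with certainty, i.e. Tr[G[|m><m|]] may vanish; then G[|m><m|] = 0 and
   the quotient is 0 (division by zero), so such a strategy has error probability 1. *)
definition p_error ::
  "nat \<Rightarrow> nat \<Rightarrow> (complex mat \<Rightarrow> complex mat) \<Rightarrow> nat \<Rightarrow> nat
    \<Rightarrow> (complex mat \<Rightarrow> complex mat) \<Rightarrow> (complex mat \<Rightarrow> complex mat) \<Rightarrow> real" where
  "p_error dA dB N dM dL Enc Dec =
     1 - (MIN m\<in>{..<dM}.
       let Gm = retro_map dA dB N dM dL Enc Dec (ketbra dM m m)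
       in Re (mtrace (ketbra dM m m * Gm)) / Re (mtrace Gm))"

definition strategy ::
  "nat \<Rightarrow> nat \<Rightarrow> nat \<Rightarrow> nat \<Rightarrow> (complex mat \<Rightarrow> complex mat) \<Rightarrow> (complex mat \<Rightarrow> complex mat) \<Rightarrow> bool" where
  "strategy dA dB dM dL Enc Dec \<longleftrightarrow> channel (dM * dL) dA Enc \<and> channel dB (dM * dL) Dec"

(* The requirement 2 \<le> dM only has an effect for r = 0 (see E_retro_eq below).  It excludes
   one-letter alphabets, which transmit nothing, have error probability 0 and would make the
   exponent infinite at r = 0. *)
definition E_retro :: "nat \<Rightarrow> nat \<Rightarrow> (complex mat \<Rightarrow> complex mat) \<Rightarrow> real \<Rightarrow> ereal" where
  "E_retro dA dB N r = liminf (\<lambda>n. Sup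
     {- (ereal (1 / real n) *
         elog2 (p_error (dA ^ n) (dB ^ n) (tensor_power dA dB N n) dM dL Enc Dec)) | dM dL Enc Dec.
      2 \<le> dM \<and> 2 powr (real n * r) \<le> real dM \<and> strategy (dA ^ n) (dB ^ n) dM dL Enc Dec})"

definition S_retro :: "nat \<Rightarrow> nat \<Rightarrow> (complex mat \<Rightarrow> complex mat) \<Rightarrow> real \<Rightarrow> ereal" where
  "S_retro dA dB N r = limsup (\<lambda>n. Inf
     {- (ereal (1 / real n) *
         elog2 (1 - p_error (dA ^ n) (dB ^ n) (tensor_power dA dB N n) dM dL Enc Dec)) | dM dL Enc Dec.
      2 powr (real n * r) \<le> real dM \<and> strategy (dA ^ n) (dB ^ n) dM dL Enc Dec})"

lemma E_retro_eq:
  assumes "0 < r"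
  shows "E_retro dA dB N r = liminf (\<lambda>n. Sup
     {- (ereal (1 / real n) *
         elog2 (p_error (dA ^ n) (dB ^ n) (tensor_power dA dB N n) dM dL Enc Dec)) | dM dL Enc Dec.
      2 powr (real n * r) \<le> real dM \<and> strategy (dA ^ n) (dB ^ n) dM dL Enc Dec})"
proof -
  have "2 \<le> dM" if "0 < n" "2 powr (real n * r) \<le> real dM" for n dM :: nat
  proof -
    have "2 powr 0 < 2 powr (real n * r)"
      using assms that(1) by (intro powr_less_mono) auto
    then show ?thesis using that(2) by simp
  qed
  then have *: "(2 \<le> dM \<and> 2 powr (real n * r) \<le> real dM \<and> Q)
      \<longleftrightarrow> (2 powr (real n * r) \<le> real dM \<and> Q)" if "0 < n" for n dM :: nat and Q
    using that by blast
  show ?thesis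
    unfolding E_retro_def
    by (rule Liminf_eq, rule eventually_mono[OF eventually_gt_at_top[of 0]]) (simp only: *)
qed

end

theory Submission
  imports
    "HOL-Analysis.Topology_Euclidean_Space"
    "HOL-Analysis.Function_Topology"
    Defs
begin

text \<open>For a channel \<open>C\<close> from \<open>B\<close> to \<open>A\<close>, let \<open>f(C)\<close> be the (rescaled) probability that the loop closed by
  \<open>C\<close> after \<open>N\<close> is postselected.  It is a linear functional of \<open>C\<close>, so by semidefinite duality its maximum
  \<open>b\<close> and minimum \<open>a\<close> over all channels satisfy \<open>I_max = log b\<close> and \<open>I_doe = - log a\<close>.  The smallest error
  probability of a strategy with \<open>M\<close> messages is exactly \<open>(M - 1) a / (b + (M - 1) a)\<close>: it is attained by a
  decoder that guesses the message and an encoder that closes the loop with an optimal channel for \<open>b\<close> after a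
  correct guess and for \<open>a\<close> after a wrong one, and the dual optimisers yield the converse.  For tensor powers
  \<open>b\<close> is multiplicative and \<open>a\<close> is submultiplicative, so Fekete's lemma gives the limit.\<close>

section \<open>Positive semidefinite matrices\<close>

text \<open>Write J for the unnormalised Choi operator. The two duals read: b is the infimum of tr S
  subject to 1 (x) S - J being positive, and a is the supremum of tr Y over Hermitian Y with J - 1
  (x) Y positive. A channel sees only the trace of S or Y, and normalising that trace to one gives
  the feasible points of \<open>I_max\<close> and \<open>I_doe\<close>. Channels form a compact set,
  so the primal optima are attained, whereas the dual values are only approached; hence the slack
  \<delta> in all converse bounds. The two values behave differently under tensor products: S
  dominates J and is therefore positive, so products of such S are feasible again; Y may be
  indefinite, and products of such Y need not be feasible. This is why only the Doeblin information
  is regularised. For M close to 2^(n r) the least error is min(1, 2^(n r) a_n / b^n) up to a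
  constant factor, whose logarithm disappears after division by n; thus both exponents are limits.
  The value a = 0 is the case of infinite Doeblin information, where errorless strategies exist for
  every alphabet.\<close>

type_synonym opmap = "complex mat \<Rightarrow> complex mat"

abbreviation (input) ops :: "nat \<Rightarrow> complex mat set" where
  "ops d \<equiv> carrier_mat d d"

abbreviation (input) amp :: "nat \<Rightarrow> complex mat \<Rightarrow> complex mat" where
  "amp d X \<equiv> kron (1\<^sub>m d) X"

abbreviation (input) idx4 :: "nat \<Rightarrow> nat \<Rightarrow> nat \<Rightarrow> nat \<Rightarrow> nat \<Rightarrow> nat \<Rightarrow> nat \<Rightarrow> nat" where
  "idx4 dB dC dD a c b d \<equiv> (a * dC + c) * (dB * dD) + (b * dD + d)"

section \<open>Arithmetic of the index encoding of composite systems\<close>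

lemma idx_less: "a < m \<Longrightarrow> b < n \<Longrightarrow> a * n + b < m * (n::nat)"
proof -
  assume "a < m" "b < n"
  then have "a * n + b < Suc a * n" by simp
  also have "... \<le> m * n" using \<open>a < m\<close> by (intro mult_le_mono1) simp
  finally show ?thesis .
qed

lemma div_less_idx: "i < m * n \<Longrightarrow> i div n < (m::nat)"
  by (simp add: less_mult_imp_div_less)

lemma mod_less_idx: "i < m * n \<Longrightarrow> i mod n < (n::nat)"
  by (metis gr_implies_not_zero mod_less_divisor mult_is_0 neq0_conv)

lemma idx_eq_iff:
  assumes "b < n" "b' < n"
  shows "a * n + b = a' * n + b' \<longleftrightarrow> a = a' \<and> b = (b' :: nat)"
proof
  assume eq: "a * n + b = a' * n + b'"
  then have "(a * n + b) div n = (a' * n + b') div n" "(a * n + b) mod n = (a' * n + b') mod n"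
    by (simp_all only:)
  then show "a = a' \<and> b = b'" using assms by simp
qed simp

lemma sum_idx: "(\<Sum>i<m*n. f i) = (\<Sum>a<m. \<Sum>b<n. f (a * n + b :: nat))"
proof -
  have "(\<Sum>i<m*n. f i) = (\<Sum>(a,b)\<in>{..<m}\<times>{..<n}. f (a * n + b))"
    by (rule sum.reindex_bij_witness[of _ "\<lambda>(a,b). a * n + b" "\<lambda>i. (i div n, i mod n)"])
      (auto simp: idx_less div_less_idx mod_less_idx)
  then show ?thesis by (simp add: sum.cartesian_product)
qed

text \<open>Vectors are functions on all naturals of which only the first \<open>d\<close> values
  count (\<open>qform_cong\<close>), so test vectors can be written as case distinctions and
  extended by \<open>fun_upd\<close> without carrier obligations.\<close>

definition qform :: "nat \<Rightarrow> complex mat \<Rightarrow> (nat \<Rightarrow> complex) \<Rightarrow> complex" where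
  "qform d X v = (\<Sum>i<d. \<Sum>j<d. cnj (v i) * X $$ (i, j) * v j)"

lemma qform_cong: "(\<And>i. i < d \<Longrightarrow> v i = w i) \<Longrightarrow> qform d X v = qform d X w"
  by (simp add: qform_def)

lemma cscalar_qform:
  assumes "X \<in> ops d" "v \<in> carrier_vec d"
  shows "(X *\<^sub>v v) \<bullet>c v = qform d X (\<lambda>i. v $ i)"
proof -
  have "(X *\<^sub>v v) \<bullet>c v = (\<Sum>i<d. (\<Sum>j<d. X $$ (i,j) * v $ j) * cnj (v $ i))"
    using assms by (auto simp: scalar_prod_def lessThan_atLeast0 intro!: sum.cong)
  also have "... = qform d X (\<lambda>i. v $ i)"
    by (simp add: qform_def sum_distrib_left sum_distrib_right mult_ac)
  finally show ?thesis .
qed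

lemma adjoint_index:
  assumes "X \<in> ops d" "i < d" "j < d"
  shows "mat_adjoint X $$ (i, j) = cnj (X $$ (j, i))"
  using assms by (simp add: mat_adjoint_def mat_of_rows_def)

lemma hermitian_op_iff:
  "hermitian_op d X \<longleftrightarrow> X \<in> ops d \<and> (\<forall>i<d. \<forall>j<d. X $$ (j, i) = cnj (X $$ (i, j)))"
proof (cases "X \<in> ops d")
  case True
  have "mat_adjoint X = X \<longleftrightarrow> (\<forall>i<d. \<forall>j<d. mat_adjoint X $$ (i,j) = X $$ (i,j))"
    using True by (auto intro!: eq_matI simp: mat_adjoint_def)
  also have "... \<longleftrightarrow> (\<forall>i<d. \<forall>j<d. X $$ (j, i) = cnj (X $$ (i, j)))"
    using True by (simp add: adjoint_index) (metis complex_cnj_cnj)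
  finally show ?thesis using True by (simp add: hermitian_op_def)
qed (simp add: hermitian_op_def)

text \<open>Vectors supported on two coordinates probe a single 2 x 2 minor. They yield Hermiticity,
  the bound on off-diagonal entries, and the vanishing of a column whose diagonal entry is
  zero.\<close>

lemma qform_two:
  assumes "p < d" "q < d" "p \<noteq> q"
  shows "qform d X (\<lambda>i. if i = p then a else if i = q then b else 0) =
    cnj a * X $$ (p,p) * a + cnj a * X $$ (p,q) * b + cnj b * X $$ (q,p) * a + cnj b * X $$ (q,q) * b"
proof -
  let ?v = "\<lambda>i. if i = p then a else if i = q then b else 0"
  have *: "(\<Sum>j<d. f j * ?v j) = f p * a + f q * b" for f :: "nat \<Rightarrow> complex"
  proof -
    have "(\<Sum>j<d. f j * ?v j) = (\<Sum>j<d. (if j = p then f p * a else 0) + (if j = q then f q * b else 0))"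
      using assms by (intro sum.cong) auto
    then show ?thesis using assms by (simp add: sum.distrib)
  qed
  have **: "(\<Sum>i<d. cnj (?v i) * f i) = cnj a * f p + cnj b * f q" for f :: "nat \<Rightarrow> complex"
  proof -
    have "(\<Sum>i<d. cnj (?v i) * f i) = (\<Sum>j<d. (if j = p then cnj a * f p else 0) + (if j = q then cnj b * f q else 0))"
      using assms by (intro sum.cong) auto
    then show ?thesis using assms by (simp add: sum.distrib)
  qed
  have "qform d X ?v = (\<Sum>i<d. cnj (?v i) * (\<Sum>j<d. X $$ (i,j) * ?v j))"
    by (simp add: qform_def sum_distrib_left mult.assoc)
  also have "... = (\<Sum>i<d. cnj (?v i) * (X $$ (i,p) * a + X $$ (i,q) * b))"
    by (simp only: *)
  also have "... = cnj a * (X $$ (p,p) * a + X $$ (p,q) * b) + cnj b * (X $$ (q,p) * a + X $$ (q,q) * b)"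
    by (simp only: **)
  finally show ?thesis by (simp add: algebra_simps)
qed

lemma qform_one:
  assumes "p < d"
  shows "qform d X (\<lambda>i. if i = p then a else 0) = cnj a * X $$ (p,p) * a"
proof -
  have "qform d X (\<lambda>i. if i = p then a else 0) =
    (\<Sum>i<d. if i = p then \<Sum>j<d. if j = p then cnj a * X $$ (p,p) * a else 0 else 0)"
    unfolding qform_def by (intro sum.cong) (auto intro!: sum.cong simp: if_distrib cong: if_cong)
  then show ?thesis using assms by simp
qed

lemma complex_nonneg_iff: "0 \<le> z \<longleftrightarrow> 0 \<le> Re z \<and> Im z = (0::real)"
  by (auto simp: less_eq_complex_def)

text \<open>Hermiticity is implied by the reality of the quadratic form, by polarization.\<close>

lemma psd_iff:
  "psd d X \<longleftrightarrow> X \<in> ops d \<and> (\<forall>v. 0 \<le> qform d X v)"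
proof
  assume *: "psd d X"
  then have X: "X \<in> ops d" by (simp add: psd_def hermitian_op_def)
  moreover have "0 \<le> qform d X v" for v
  proof -
    have "0 \<le> (X *\<^sub>v vec d v) \<bullet>c vec d v" using * by (simp add: psd_def)
    also have "... = qform d X v"
      using X by (subst cscalar_qform) (auto intro: qform_cong)
    finally show ?thesis .
  qed
  ultimately show "X \<in> ops d \<and> (\<forall>v. 0 \<le> qform d X v)" by blast
next
  assume *: "X \<in> ops d \<and> (\<forall>v. 0 \<le> qform d X v)"
  then have X: "X \<in> ops d" and im: "Im (qform d X v) = 0" for v
    by (auto simp: complex_nonneg_iff)
  have diag: "Im (X $$ (p,p)) = 0" if "p < d" for p
    using im[of "\<lambda>i. if i = p then 1 else 0"] that by (simp add: qform_one)
  have "X $$ (q,p) = cnj (X $$ (p,q))" if "p < d" "q < d" for p q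
  proof (cases "p = q")
    case True
    then show ?thesis using diag that by (simp add: complex_eq_iff)
  next
    case False
    \<comment> \<open>The vector (1, 1) forces opposite imaginary parts of the two entries, the
      vector (1, \<i>) equal real parts.\<close>
    then show ?thesis
      using im[of "\<lambda>i. if i = p then 1 else if i = q then 1 else 0"]
        im[of "\<lambda>i. if i = p then 1 else if i = q then \<i> else 0"] diag that
      by (simp add: qform_two complex_eq_iff)
  qed
  then have "hermitian_op d X" using X unfolding hermitian_op_iff by blast
  then show "psd d X" using * by (auto simp: psd_def cscalar_qform)
qed

lemma psd_carrier: "psd d X \<Longrightarrow> X \<in> ops d"
  by (simp add: psd_iff)

lemma psd_cnj: "psd d X \<Longrightarrow> i < d \<Longrightarrow> j < d \<Longrightarrow> X $$ (j, i) = cnj (X $$ (i, j))"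
  unfolding psd_def hermitian_op_iff by blast

lemma psd_add:
  assumes "psd d X" "psd d Y"
  shows "psd d (X + Y)"
proof -
  have "qform d (X + Y) v = qform d X v + qform d Y v" for v
    using assms[THEN psd_carrier] by (simp add: qform_def algebra_simps sum.distrib)
  then show ?thesis using assms by (simp add: psd_iff complex_nonneg_iff)
qed

lemma psd_smult:
  assumes "psd d X" "0 \<le> (c::real)"
  shows "psd d (of_real c \<cdot>\<^sub>m X)"
proof -
  have "qform d (of_real c \<cdot>\<^sub>m X) v = of_real c * qform d X v" for v
    using assms(1)[THEN psd_carrier] by (simp add: qform_def sum_distrib_left mult_ac)
  then show ?thesis using assms by (simp add: psd_iff complex_nonneg_iff)
qed

lemma psd_sum:
  assumes "finite I" "\<And>k. k \<in> I \<Longrightarrow> psd d (mat d d (f k))"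
  shows "psd d (mat d d (\<lambda>ij. \<Sum>k\<in>I. f k ij))"
  using assms
proof (induction I rule: finite_induct)
  case empty
  then show ?case by (simp add: psd_iff qform_def)
next
  case (insert k I)
  have "mat d d (\<lambda>ij. \<Sum>k\<in>insert k I. f k ij) = mat d d (f k) + mat d d (\<lambda>ij. \<Sum>k\<in>I. f k ij)"
    using insert by (intro eq_matI) auto
  then show ?case using insert by (simp add: psd_add)
qed

text \<open>The transformation \<open>X \<mapsto> V\<^sup>* X V\<close> for a 0-1 matrix \<open>V\<close>, in entrywise form; it covers
  relabelling, restriction and partial contraction of indices.\<close>

lemma psd_contract:
  assumes "psd m X" "\<And>i c. i < d \<Longrightarrow> c < n \<Longrightarrow> p i c < m"
  shows "psd d (mat d d (\<lambda>(i, j). \<Sum>c<n. \<Sum>c'<n. X $$ (p i c, p j c')))" (is "psd d ?M")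
proof -
  have "0 \<le> qform d ?M v" for v
  proof -
    \<comment> \<open>\<open>w\<close> is V v: it collects at each index \<open>k\<close> the values
      \<open>v i\<close> over all pairs (i, c) sent to \<open>k\<close>.\<close>
    define w where "w k = (\<Sum>i<d. \<Sum>c<n. if p i c = k then v i else 0)" for k
    have *: "(\<Sum>k<m. f k * w k) = (\<Sum>i<d. \<Sum>c<n. f (p i c) * v i)" for f :: "nat \<Rightarrow> complex"
    proof -
      have "(\<Sum>k<m. f k * w k) = (\<Sum>k<m. \<Sum>i<d. \<Sum>c<n. if p i c = k then f k * v i else 0)"
        unfolding w_def sum_distrib_left by (intro sum.cong refl) simp
      also have "... = (\<Sum>i<d. \<Sum>k<m. \<Sum>c<n. if p i c = k then f k * v i else 0)"
        by (rule sum.swap)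
      also have "... = (\<Sum>i<d. \<Sum>c<n. \<Sum>k<m. if p i c = k then f k * v i else 0)"
        by (intro sum.cong refl sum.swap)
      also have "... = (\<Sum>i<d. \<Sum>c<n. f (p i c) * v i)"
        by (intro sum.cong refl) (use assms(2) in simp)
      finally show ?thesis .
    qed
    have **: "(\<Sum>k<m. cnj (w k) * f k) = (\<Sum>i<d. \<Sum>c<n. cnj (v i) * f (p i c))" for f :: "nat \<Rightarrow> complex"
    proof -
      have "(\<Sum>k<m. cnj (w k) * f k) = cnj (\<Sum>k<m. cnj (f k) * w k)" by (simp add: mult.commute)
      also have "... = (\<Sum>i<d. \<Sum>c<n. cnj (v i) * f (p i c))"
        by (subst *) (simp add: mult.commute)
      finally show ?thesis .
    qed
    have "qform m X w = (\<Sum>k<m. cnj (w k) * (\<Sum>l<m. X $$ (k,l) * w l))"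
      by (simp add: qform_def sum_distrib_left mult.assoc)
    also have "... = (\<Sum>i<d. \<Sum>c<n. cnj (v i) * (\<Sum>j<d. \<Sum>c'<n. X $$ (p i c, p j c') * v j))"
      by (simp only: * **)
    also have "... = (\<Sum>i<d. \<Sum>c<n. \<Sum>j<d. \<Sum>c'<n. cnj (v i) * X $$ (p i c, p j c') * v j)"
      by (simp add: sum_distrib_left mult.assoc)
    also have "... = (\<Sum>i<d. \<Sum>j<d. \<Sum>c<n. \<Sum>c'<n. cnj (v i) * X $$ (p i c, p j c') * v j)"
      by (intro sum.cong refl sum.swap)
    also have "... = qform d ?M v"
      by (simp add: qform_def sum_distrib_left sum_distrib_right)
    finally show ?thesis using assms(1) by (metis psd_iff)
  qed
  then show ?thesis by (simp add: psd_iff)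
qed

lemma psd_reindex:
  assumes "psd m X" "\<And>i. i < d \<Longrightarrow> p i < m"
  shows "psd d (mat d d (\<lambda>(i, j). X $$ (p i, p j)))"
proof -
  have "psd d (mat d d (\<lambda>(i, j). \<Sum>c<Suc 0. \<Sum>c'<Suc 0. X $$ (p i, p j)))"
    by (rule psd_contract) (use assms in auto)
  then show ?thesis
    by (simp only: lessThan_Suc lessThan_0 sum.insert sum.empty finite.emptyI empty_iff
        not_False_eq_True add_0_right)
qed

lemma psd_rank_one: "psd d (mat d d (\<lambda>(i, j). u i * cnj (u j)))" (is "psd d ?M")
proof -
  have "0 \<le> qform d ?M v" for v
  proof -
    define s where "s = (\<Sum>i<d. cnj (v i) * u i)"
    have "qform d ?M v = (\<Sum>i<d. cnj (v i) * u i) * (\<Sum>j<d. cnj (u j) * v j)"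
      by (simp add: qform_def sum_product mult_ac)
    also have "(\<Sum>j<d. cnj (u j) * v j) = cnj s" by (simp add: s_def mult.commute)
    finally have "qform d ?M v = of_real ((cmod s)\<^sup>2)"
      by (simp add: complex_norm_square s_def del: of_real_power)
    then show ?thesis by (simp add: complex_nonneg_iff)
  qed
  then show ?thesis by (simp add: psd_iff)
qed

lemma psd_diag:
  assumes "psd d X" "i < d"
  shows "Im (X $$ (i,i)) = 0" "0 \<le> Re (X $$ (i,i))"
proof -
  have "0 \<le> qform d X (\<lambda>k. if k = i then 1 else 0)" using assms by (simp add: psd_iff)
  then show "Im (X $$ (i,i)) = 0" "0 \<le> Re (X $$ (i,i))"
    using assms by (auto simp: qform_one complex_nonneg_iff)
qed

lemma psd_entry_bound:
  assumes "psd d X" "i < d" "j < d"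
  shows "2 * cmod (X $$ (i,j)) \<le> Re (X $$ (i,i)) + Re (X $$ (j,j))"
proof (cases "i = j")
  case True
  then show ?thesis using psd_diag[OF assms(1,2)] by (simp add: cmod_def)
next
  case False
  define z where "z = X $$ (i,j)"
  \<comment> \<open>The phase of the entry, so that the test vector (u, -1) turns the cross terms
    into -2 |z|. For z = 0 any number of modulus one serves.\<close>
  define u where "u = (if z = 0 then 1 else z / of_real (cmod z))"
  have u: "cmod u = 1" by (simp add: u_def norm_divide)
  have zu: "cnj u * z = of_real (cmod z)"
    using complex_norm_square[of z] by (auto simp: u_def field_simps power2_eq_square)
  have "0 \<le> qform d X (\<lambda>k. if k = i then u else if k = j then - 1 else 0)"
    using assms by (simp add: psd_iff)
  also have "... = cnj u * u * X $$ (i,i) - cnj u * z - cnj (cnj u * z) + X $$ (j,j)"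
    using assms False psd_cnj[OF assms] by (simp add: qform_two z_def mult_ac)
  also have "cnj u * u = 1" using complex_norm_square[of u] u by (simp add: mult.commute)
  finally show ?thesis unfolding zu by (simp add: complex_nonneg_iff z_def)
qed

text \<open>The trace controls every entry: trace-bounded positive operators lie in a compact box,
  and a positive operator of trace zero vanishes.\<close>

lemma psd_entry_le_trace:
  assumes "psd d X" "i < d" "j < d"
  shows "cmod (X $$ (i,j)) \<le> Re (mtrace X)"
proof -
  have d: "dim_row X = d" by (rule carrier_matD(1)[OF psd_carrier[OF assms(1)]])
  have nn: "0 \<le> Re (X $$ (k,k))" if "k < d" for k
    using psd_diag(2)[OF assms(1) that] .
  have le: "Re (X $$ (k,k)) \<le> Re (mtrace X)" if "k < d" for k
    unfolding mtrace_def d Re_sum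
    by (rule member_le_sum) (use that nn in auto)
  from psd_entry_bound[OF assms] le[OF assms(2)] le[OF assms(3)] show ?thesis by linarith
qed

text \<open>Cholesky factorisation by induction on the dimension: the last column divided by the
  root of the corner gives one rank one term, and what is left is the Schur complement, which is
  positive in one dimension less.\<close>

lemma psd_gram:
  assumes "psd d X"
  shows "\<exists>w. \<forall>i<d. \<forall>j<d. X $$ (i,j) = (\<Sum>k<d. w k i * cnj (w k j))"
  using assms
proof (induction d arbitrary: X)
  case 0
  then show ?case by simp
next
  case (Suc d)
  define e where "e = Re (X $$ (d,d))"
  \<comment> \<open>For e = 0, division by zero makes \<open>u\<close> vanish, in agreement with
    \<open>zero\<close> below.\<close>
  define u where "u i = X $$ (i,d) / of_real (sqrt e)" for i
  have dd: "X $$ (d,d) = of_real e" and e0: "0 \<le> e"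
    using psd_diag[OF Suc.prems, of d] by (auto simp: e_def complex_eq_iff)
  have her: "X $$ (j,i) = cnj (X $$ (i,j))" if "i \<le> d" "j \<le> d" for i j
    using psd_cnj[OF Suc.prems, of i j] that by simp
  \<comment> \<open>If the corner vanished but the column did not, a large last coordinate would
    make the form negative; \<open>t\<close> is tuned so that its value is -X_ii - 2.\<close>
  have zero: "X $$ (i,d) = 0" if "e = 0" "i \<le> d" for i
  proof (rule ccontr)
    assume nz: "X $$ (i,d) \<noteq> 0"
    then have id: "i \<noteq> d" using that dd by auto
    define t where "t = (Re (X $$ (i,i)) + 1) / (cmod (X $$ (i,d)))\<^sup>2"
    have "0 \<le> qform (Suc d) X (\<lambda>k. if k = i then 1 else if k = d then - of_real t * cnj (X $$ (i,d)) else 0)"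
      using Suc.prems by (simp add: psd_iff)
    also have "... = X $$ (i,i) - 2 * of_real t * (X $$ (i,d) * cnj (X $$ (i,d)))"
      using that dd id her[of i d] by (subst qform_two) (auto simp: algebra_simps)
    also have "... = X $$ (i,i) - of_real (2 * t * (cmod (X $$ (i,d)))\<^sup>2)"
      by (simp only: complex_norm_square[symmetric] of_real_mult of_real_numeral mult.assoc)
    also have "2 * t * (cmod (X $$ (i,d)))\<^sup>2 = 2 * (Re (X $$ (i,i)) + 1)"
      using nz by (simp add: t_def)
    finally have "Re (X $$ (i,i)) + 2 \<le> 0" by (simp add: complex_nonneg_iff)
    then show False using psd_diag[OF Suc.prems, of i] that by simp
  qed
  have last: "u i * cnj (u d) = X $$ (i,d)" if "i \<le> d" for i
  proof (cases "e = 0")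
    case True
    then show ?thesis using zero that by (simp add: u_def)
  next
    case False
    have "complex_of_real (sqrt e) * complex_of_real (sqrt e) = of_real e"
      using e0 by (metis of_real_mult real_sqrt_mult_self abs_of_nonneg)
    then show ?thesis using False by (simp add: u_def dd field_simps)
  qed
  define Y where "Y = mat d d (\<lambda>(i,j). X $$ (i,j) - u i * cnj (u j))"
  have "psd d Y"
  proof -
    have "0 \<le> qform d Y v" for v
    proof -
      define s where "s = (\<Sum>i<d. cnj (u i) * v i)"
      \<comment> \<open>The last coordinate that minimises the form of \<open>X\<close> with the
        others fixed; with it the form of \<open>X\<close> at v' equals the form of the Schur
        complement \<open>Y\<close> at \<open>v\<close>.\<close>
      define x where "x = (if e = 0 then 0 else - s / of_real (sqrt e))"
      define v' where "v' = v(d := x)"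
      have sx: "of_real (sqrt e) * x = - s"
      proof (cases "e = 0")
        case True
        then have "u i = 0" if "i < d" for i using that by (simp add: u_def)
        then show ?thesis using True by (simp add: s_def x_def)
      qed (simp add: x_def)
      have ud: "u d = of_real (sqrt e)"
        using e0 by (cases "e = 0") (auto simp: u_def dd field_simps power2_eq_square
            simp flip: of_real_mult)
      have "qform (Suc d) X v' = (\<Sum>i<d. \<Sum>j<d. cnj (v i) * X $$ (i,j) * v j) +
          (\<Sum>i<d. cnj (v i) * X $$ (i,d) * x) + (\<Sum>j<d. cnj x * X $$ (d,j) * v j) + cnj x * X $$ (d,d) * x"
        by (simp add: qform_def v'_def sum.distrib)
      also have "(\<Sum>i<d. cnj (v i) * X $$ (i,d) * x) = cnj s * of_real (sqrt e) * x"
      proof -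
        have "(\<Sum>i<d. cnj (v i) * X $$ (i,d) * x) = (\<Sum>i<d. cnj (v i) * u i * cnj (u d) * x)"
          by (intro sum.cong refl) (simp add: last[symmetric])
        also have "... = cnj s * of_real (sqrt e) * x"
          by (simp add: s_def sum_distrib_left sum_distrib_right mult_ac ud)
        finally show ?thesis .
      qed
      also have "(\<Sum>j<d. cnj x * X $$ (d,j) * v j) = cnj x * of_real (sqrt e) * s"
      proof -
        have "(\<Sum>i<d. cnj x * X $$ (d,i) * v i) = (\<Sum>i<d. cnj x * (u d * cnj (u i)) * v i)"
          by (intro sum.cong refl) (simp add: last[symmetric] her[of _ d])
        also have "... = cnj x * of_real (sqrt e) * s"
          by (simp add: s_def sum_distrib_left sum_distrib_right mult_ac ud)
        finally show ?thesis .
      qed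
      also have "X $$ (d,d) = of_real (sqrt e) * of_real (sqrt e)"
        using e0 by (simp add: dd flip: of_real_mult)
      also have "(\<Sum>i<d. \<Sum>j<d. cnj (v i) * X $$ (i,j) * v j) + cnj s * of_real (sqrt e) * x
          + cnj x * of_real (sqrt e) * s + cnj x * (of_real (sqrt e) * of_real (sqrt e)) * x
        = (\<Sum>i<d. \<Sum>j<d. cnj (v i) * X $$ (i,j) * v j) + cnj s * (of_real (sqrt e) * x)
          + cnj (of_real (sqrt e) * x) * s + cnj (of_real (sqrt e) * x) * (of_real (sqrt e) * x)"
        by (simp add: algebra_simps)
      also have "... = (\<Sum>i<d. \<Sum>j<d. cnj (v i) * X $$ (i,j) * v j) - cnj s * s"
        unfolding sx by simp
      also have "cnj s * s = (\<Sum>i<d. \<Sum>j<d. cnj (v i) * (u i * cnj (u j)) * v j)"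
        by (simp add: s_def sum_product mult_ac)
      also have "(\<Sum>i<d. \<Sum>j<d. cnj (v i) * X $$ (i,j) * v j) - ... = qform d Y v"
        by (simp add: qform_def Y_def sum_subtractf[symmetric] algebra_simps)
      finally show ?thesis using Suc.prems by (metis psd_iff)
    qed
    then show ?thesis by (simp add: psd_iff Y_def)
  qed
  from Suc.IH[OF this] obtain w where
    w: "\<And>i j. i < d \<Longrightarrow> j < d \<Longrightarrow> Y $$ (i,j) = (\<Sum>k<d. w k i * cnj (w k j))" by blast
  define w' where "w' k = (if k < d then (w k)(d := 0) else u)" for k
  have "X $$ (i,j) = (\<Sum>k<Suc d. w' k i * cnj (w' k j))" if "i \<le> d" "j \<le> d" for i j
  proof -
    have s: "(\<Sum>k<Suc d. w' k i * cnj (w' k j)) =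
        (\<Sum>k<d. ((w k)(d := 0)) i * cnj (((w k)(d := 0)) j)) + u i * cnj (u j)"
      by (simp add: w'_def)
    consider "j = d" | "i = d" "j \<noteq> d" | "i < d" "j < d" using \<open>i \<le> d\<close> \<open>j \<le> d\<close> by linarith
    then show ?thesis
    proof cases
      case 1
      then show ?thesis unfolding s using last that by simp
    next
      case 2
      have "X $$ (d,j) = cnj (u j * cnj (u d))" using her[of j d] last[of j] that by simp
      then show ?thesis unfolding s using 2 by (simp add: mult.commute)
    next
      case 3
      then show ?thesis unfolding s using w[OF 3] by (simp add: Y_def diff_eq_eq)
    qed
  qed
  then show ?case by (auto simp: less_Suc_eq_le)
qed

section \<open>Kronecker products\<close>

lemma kron_carrier: "X \<in> ops m \<Longrightarrow> Y \<in> ops n \<Longrightarrow> kron X Y \<in> ops (m * n)"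
  by (auto simp: kron_def)

lemma kron_index:
  assumes "X \<in> ops m" "Y \<in> ops n" "a < m" "a' < m" "b < n" "b' < n"
  shows "kron X Y $$ (a * n + b, a' * n + b') = X $$ (a, a') * Y $$ (b, b')"
  using assms idx_less[of a m b n] idx_less[of a' m b' n] by (auto simp: kron_def)

text \<open>Products of Gram vectors of the two factors are Gram vectors of the Kronecker product,
  which is thus a sum of rank one operators.\<close>

lemma psd_kron:
  assumes "psd m X" "psd n Y"
  shows "psd (m * n) (kron X Y)"
proof -
  note C = assms[THEN psd_carrier]
  obtain w where w: "\<And>i j. i < m \<Longrightarrow> j < m \<Longrightarrow> X $$ (i,j) = (\<Sum>k<m. w k i * cnj (w k j))"
    using psd_gram[OF assms(1)] by blast
  obtain z where z: "\<And>i j. i < n \<Longrightarrow> j < n \<Longrightarrow> Y $$ (i,j) = (\<Sum>k<n. z k i * cnj (z k j))"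
    using psd_gram[OF assms(2)] by blast
  define u where "u k l i = w k (i div n) * z l (i mod n)" for k l i
  have "kron X Y = mat (m * n) (m * n)
    (\<lambda>ij. \<Sum>kl\<in>{..<m}\<times>{..<n}. (\<lambda>(i,j). u (fst kl) (snd kl) i * cnj (u (fst kl) (snd kl) j)) ij)"
  proof (intro eq_matI; clarsimp)
    fix i j assume ij: "i < m * n" "j < m * n"
    have "kron X Y $$ (i,j) = X $$ (i div n, j div n) * Y $$ (i mod n, j mod n)"
      using ij C by (simp add: kron_def)
    also have "... = (\<Sum>k<m. \<Sum>l<n. u k l i * cnj (u k l j))"
      using ij by (simp only: w z div_less_idx mod_less_idx sum_product) (simp add: u_def mult_ac)
    finally show "kron X Y $$ (i,j) = (\<Sum>kl\<in>{..<m}\<times>{..<n}. u (fst kl) (snd kl) i * cnj (u (fst kl) (snd kl) j))"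
      by (simp add: sum.cartesian_product split_def)
  qed (use C in \<open>auto simp: kron_def\<close>)
  moreover have "psd (m * n) (mat (m * n) (m * n)
    (\<lambda>ij. \<Sum>kl\<in>{..<m}\<times>{..<n}. (\<lambda>(i,j). u (fst kl) (snd kl) i * cnj (u (fst kl) (snd kl) j)) ij))"
    by (intro psd_sum psd_rank_one) simp
  ultimately show ?thesis by simp
qed

section \<open>Completely positive maps\<close>

lemma eq_mat_idx:
  assumes "X \<in> ops (m * n)" "Y \<in> ops (m * n)"
    "\<And>a a' b b'. a < m \<Longrightarrow> a' < m \<Longrightarrow> b < n \<Longrightarrow> b' < n \<Longrightarrow>
       X $$ (a * n + b, a' * n + b') = Y $$ (a * n + b, a' * n + b')"
  shows "X = Y"
proof (rule eq_matI)
  fix i j assume "i < dim_row Y" "j < dim_col Y"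
  then have "i < m * n" "j < m * n" using assms(2) by auto
  then show "X $$ (i,j) = Y $$ (i,j)"
    using assms(3)[of "i div n" "j div n" "i mod n" "j mod n"] by (simp add: div_less_idx mod_less_idx)
qed (use assms in auto)

lemma ketbra_carrier [simp]: "ketbra d a b \<in> ops d"
  by (simp add: ketbra_def)

lemma ketbra_index [simp]: "i < d \<Longrightarrow> j < d \<Longrightarrow> ketbra d a b $$ (i, j) = (if i = a \<and> j = b then 1 else 0)"
  by (simp add: ketbra_def)

lemma linear_carrier: "linear_op_map dA dB N \<Longrightarrow> X \<in> ops dA \<Longrightarrow> N X \<in> ops dB"
  by (simp add: linear_op_map_def)

text \<open>Additivity is given for two summands, so the expansion into matrix units is an induction
  over the set of positions whose entries are kept; zero is mapped to zero by homogeneity with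
  factor 0.\<close>

lemma linear_expand:
  assumes "linear_op_map dA dB N" "X \<in> ops dA" "i < dB" "j < dB"
  shows "N X $$ (i, j) = (\<Sum>a<dA. \<Sum>a'<dA. X $$ (a, a') * N (ketbra dA a a') $$ (i, j))"
proof -
  note [simp] = linear_carrier[OF assms(1)]
  have add: "N (X + Y) = N X + N Y" if "X \<in> ops dA" "Y \<in> ops dA" for X Y
    using assms(1) that by (simp add: linear_op_map_def)
  have sc: "N (c \<cdot>\<^sub>m X) = c \<cdot>\<^sub>m N X" if "X \<in> ops dA" for c X
    using assms(1) that by (simp add: linear_op_map_def)
  have "N (mat dA dA (\<lambda>p. if p \<in> I then X $$ p else 0)) $$ (i,j)
      = (\<Sum>p\<in>I. X $$ p * N (ketbra dA (fst p) (snd p)) $$ (i,j))" if "finite I" "I \<subseteq> {..<dA} \<times> {..<dA}" for I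
    using that
  proof (induction I rule: finite_induct)
    case empty
    let ?Z = "mat dA dA (\<lambda>p. 0 :: complex)"
    have "0 \<cdot>\<^sub>m ?Z = ?Z" by (intro eq_matI) auto
    then have "N ?Z $$ (i,j) = (0 \<cdot>\<^sub>m N ?Z) $$ (i,j)" using sc[of ?Z 0] by simp
    also have "... = 0" using carrier_matD[OF linear_carrier[OF assms(1), of ?Z]] assms(3,4) by simp
    finally have "N ?Z $$ (i,j) = 0" .
    then show ?case by simp
  next
    case (insert p I)
    let ?M = "mat dA dA (\<lambda>q. if q \<in> I then X $$ q else 0)"
    have "mat dA dA (\<lambda>q. if q \<in> insert p I then X $$ q else 0) = X $$ p \<cdot>\<^sub>m ketbra dA (fst p) (snd p) + ?M"
      using insert by (intro eq_matI) (auto simp: ketbra_def)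
    then have "N (mat dA dA (\<lambda>q. if q \<in> insert p I then X $$ q else 0))
        = X $$ p \<cdot>\<^sub>m N (ketbra dA (fst p) (snd p)) + N ?M"
      by (simp add: add sc)
    moreover have "dim_row (N ?M) = dB" "dim_col (N ?M) = dB"
      "dim_row (N (ketbra dA (fst p) (snd p))) = dB" "dim_col (N (ketbra dA (fst p) (snd p))) = dB"
      using carrier_matD[OF linear_carrier[OF assms(1), of ?M]]
        carrier_matD[OF linear_carrier[OF assms(1), of "ketbra dA (fst p) (snd p)"]] by simp_all
    ultimately show ?case using insert assms(3,4) by simp
  qed
  from this[of "{..<dA} \<times> {..<dA}"]
  have "N (mat dA dA (\<lambda>p. if p \<in> {..<dA} \<times> {..<dA} then X $$ p else 0)) $$ (i,j)
      = (\<Sum>p\<in>{..<dA} \<times> {..<dA}. X $$ p * N (ketbra dA (fst p) (snd p)) $$ (i,j))" by simp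
  moreover have "mat dA dA (\<lambda>p. if p \<in> {..<dA} \<times> {..<dA} then X $$ p else 0) = X"
    using assms(2) by (intro eq_matI) auto
  ultimately show ?thesis by (simp add: sum.cartesian_product split_def)
qed

lemma linear_op_mapI:
  assumes "\<And>X. X \<in> ops dA \<Longrightarrow>
    N X = mat dB dB (\<lambda>(i, j). \<Sum>a<dA. \<Sum>a'<dA. X $$ (a, a') * G a a' i j)"
  shows "linear_op_map dA dB N"
  unfolding linear_op_map_def
proof (intro conjI ballI allI)
  fix X Y :: "complex mat" and c assume X: "X \<in> ops dA" and Y: "Y \<in> ops dA"
  then have XY: "X + Y \<in> ops dA" by simp
  show "N (X + Y) = N X + N Y"
    unfolding assms[OF X] assms[OF Y] assms[OF XY]
    using X Y by (intro eq_matI) (auto simp: algebra_simps sum.distrib)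
next
  fix X :: "complex mat" and c assume X: "X \<in> ops dA"
  then have cX: "c \<cdot>\<^sub>m X \<in> ops dA" by simp
  show "N (c \<cdot>\<^sub>m X) = c \<cdot>\<^sub>m N X"
    unfolding assms[OF X] assms[OF cX]
    using X by (intro eq_matI) (auto simp: sum_distrib_left mult.assoc)
qed (use assms in simp)

lemma linear_comp:
  assumes "linear_op_map dA dB N" "linear_op_map dB dC P"
  shows "linear_op_map dA dC (\<lambda>X. P (N X))"
  using assms unfolding linear_op_map_def by auto

lemma tensor_map_carrier [simp]: "tensor_map dA dB N dC dD P X \<in> ops (dB * dD)"
  by (simp add: tensor_map_def)

lemma tensor_map_index:
  assumes "linear_op_map dA dB N" "linear_op_map dC dD P" "i < dB" "j < dB" "k < dD" "l < dD"
  shows "tensor_map dA dB N dC dD P X $$ (i * dD + k, j * dD + l) =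
    (\<Sum>a<dA. \<Sum>a'<dA. \<Sum>c<dC. \<Sum>c'<dC. X $$ (a * dC + c, a' * dC + c') *
      (N (ketbra dA a a') $$ (i, j) * P (ketbra dC c c') $$ (k, l)))"
proof -
  have *: "kron (N (ketbra dA a a')) (P (ketbra dC c c')) $$ (i * dD + k, j * dD + l)
      = N (ketbra dA a a') $$ (i, j) * P (ketbra dC c c') $$ (k, l)" for a a' c c'
    by (rule kron_index[OF linear_carrier[OF assms(1) ketbra_carrier] linear_carrier[OF assms(2) ketbra_carrier]])
      fact+
  show ?thesis
    using idx_less[OF assms(3,5)] idx_less[OF assms(4,6)] by (simp add: tensor_map_def *)
qed

lemma linear_id: "linear_op_map d d id"
  by (simp add: linear_op_map_def)

text \<open>The operator <a| X |a'> on the second factor.\<close>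

definition blk :: "nat \<Rightarrow> nat \<Rightarrow> nat \<Rightarrow> complex mat \<Rightarrow> complex mat" where
  "blk d a a' X = mat d d (\<lambda>(i, j). X $$ (a * d + i, a' * d + j))"

lemma blk_carrier [simp]: "blk d a a' X \<in> ops d"
  by (simp add: blk_def)

lemma blk_dim [simp]: "dim_row (blk d a a' X) = d" "dim_col (blk d a a' X) = d"
  by (simp_all add: blk_def)

lemma blk_index [simp]: "i < d \<Longrightarrow> j < d \<Longrightarrow> blk d a a' X $$ (i, j) = X $$ (a * d + i, a' * d + j)"
  by (simp add: blk_def)

text \<open>The first factor only labels blocks, so a map on the second factor acts block by
  block.\<close>

lemma tensor_id_left:
  assumes "linear_op_map dA dB N" "a < k" "a' < k" "i < dB" "j < dB"
  shows "tensor_map k k id dA dB N X $$ (a * dB + i, a' * dB + j) = N (blk dA a a' X) $$ (i, j)"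
proof -
  have "tensor_map k k id dA dB N X $$ (a * dB + i, a' * dB + j) =
    (\<Sum>b<k. \<Sum>b'<k. \<Sum>c<dA. \<Sum>c'<dA. X $$ (b * dA + c, b' * dA + c') *
      (ketbra k b b' $$ (a, a') * N (ketbra dA c c') $$ (i, j)))"
    using assms by (simp add: tensor_map_index linear_id)
  also have "... = (\<Sum>b<k. \<Sum>b'<k. if b' = a' then if b = a then
      \<Sum>c<dA. \<Sum>c'<dA. X $$ (a * dA + c, a' * dA + c') * N (ketbra dA c c') $$ (i, j) else 0 else 0)"
    using assms by (intro sum.cong refl) auto
  also have "... = (\<Sum>c<dA. \<Sum>c'<dA. X $$ (a * dA + c, a' * dA + c') * N (ketbra dA c c') $$ (i, j))"
    using assms by simp
  also have "... = N (blk dA a a' X) $$ (i, j)"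
    using assms by (simp add: linear_expand[of dA dB N "blk dA a a' X"])
  finally show ?thesis .
qed

lemma tensor_id_right:
  assumes "linear_op_map dA dB N" "c < k" "c' < k" "i < dB" "j < dB"
  shows "tensor_map dA dB N k k id X $$ (i * k + c, j * k + c') =
    (\<Sum>a<dA. \<Sum>a'<dA. X $$ (a * k + c, a' * k + c') * N (ketbra dA a a') $$ (i, j))"
proof -
  have "tensor_map dA dB N k k id X $$ (i * k + c, j * k + c') =
    (\<Sum>a<dA. \<Sum>a'<dA. \<Sum>b<k. \<Sum>b'<k. X $$ (a * k + b, a' * k + b') *
      (N (ketbra dA a a') $$ (i, j) * ketbra k b b' $$ (c, c')))"
    using assms by (simp add: tensor_map_index linear_id)
  also have "... = (\<Sum>a<dA. \<Sum>a'<dA. \<Sum>b<k. \<Sum>b'<k. if b' = c' then if b = c then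
      X $$ (a * k + c, a' * k + c') * N (ketbra dA a a') $$ (i, j) else 0 else 0)"
    using assms by (intro sum.cong refl) auto
  finally show ?thesis using assms by simp
qed

lemma tensor_id_left_kron:
  assumes "linear_op_map dA dB N" "X \<in> ops k" "Y \<in> ops dA"
  shows "tensor_map k k id dA dB N (kron X Y) = kron X (N Y)"
proof (rule eq_mat_idx)
  note NY = linear_carrier[OF assms(1,3)]
  then show "kron X (N Y) \<in> ops (k * dB)" using assms(2) by (rule kron_carrier[rotated])
  fix a a' b b' assume *: "a < k" "a' < k" "b < dB" "b' < dB"
  have "blk dA a a' (kron X Y) = X $$ (a, a') \<cdot>\<^sub>m Y"
    using assms * by (intro eq_matI) (auto simp: kron_index)
  moreover have "N (X $$ (a, a') \<cdot>\<^sub>m Y) = X $$ (a, a') \<cdot>\<^sub>m N Y"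
    using assms by (simp add: linear_op_map_def)
  ultimately show "tensor_map k k id dA dB N (kron X Y) $$ (a * dB + b, a' * dB + b')
      = kron X (N Y) $$ (a * dB + b, a' * dB + b')"
    using * NY assms by (simp add: tensor_id_left kron_index)
qed simp

text \<open>The Choi operator without the normalisation by the dimension.\<close>

definition choiU :: "nat \<Rightarrow> nat \<Rightarrow> opmap \<Rightarrow> complex mat" where
  "choiU dA dB N = mat (dA * dB) (dA * dB)
     (\<lambda>(p, q). N (ketbra dA (p div dB) (q div dB)) $$ (p mod dB, q mod dB))"

lemma choiU_carrier [simp]: "choiU dA dB N \<in> ops (dA * dB)"
  by (simp add: choiU_def)

lemma choiU_dim [simp]: "dim_row (choiU dA dB N) = dA * dB" "dim_col (choiU dA dB N) = dA * dB"
  by (simp_all add: choiU_def)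

lemma choiU_index:
  assumes "a < dA" "a' < dA" "b < dB" "b' < dB"
  shows "choiU dA dB N $$ (a * dB + b, a' * dB + b') = N (ketbra dA a a') $$ (b, b')"
  using assms by (simp add: choiU_def idx_less)

text \<open>The unnormalised maximally entangled operator is written as u_i times the conjugate of
  u_j to fit \<open>psd_rank_one\<close>; complete positivity with k = d_A then makes the Choi
  operator positive.\<close>

lemma choiU_eq_tensor:
  assumes "linear_op_map dA dB N"
  shows "choiU dA dB N = tensor_map dA dA id dA dB N (mat (dA * dA) (dA * dA)
    (\<lambda>(i, j). (if i div dA = i mod dA then 1 else 0) * cnj (if j div dA = j mod dA then 1 else 0)))"
    (is "_ = tensor_map _ _ _ _ _ _ ?W")
proof (rule eq_mat_idx)
  fix a a' b b' assume *: "a < dA" "a' < dA" "b < dB" "b' < dB"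
  have "blk dA a a' ?W = ketbra dA a a'"
    using * by (intro eq_matI) (auto simp: ketbra_def idx_less)
  then show "choiU dA dB N $$ (a * dB + b, a' * dB + b') =
      tensor_map dA dA id dA dB N ?W $$ (a * dB + b, a' * dB + b')"
    using * assms by (simp add: tensor_id_left choiU_index)
qed simp_all

lemma choi_eq:
  assumes "linear_op_map dA dB N"
  shows "choi dA dB N = of_real (1 / real dA) \<cdot>\<^sub>m choiU dA dB N"
proof (rule eq_mat_idx)
  fix a a' b b' assume *: "a < dA" "a' < dA" "b < dB" "b' < dB"
  have "blk dA a a' (max_entangled dA) = of_real (1 / real dA) \<cdot>\<^sub>m ketbra dA a a'"
    using * by (intro eq_matI) (auto simp: ketbra_def idx_less max_entangled_def)
  moreover have "N (c \<cdot>\<^sub>m ketbra dA a a') = c \<cdot>\<^sub>m N (ketbra dA a a')" for c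
    using assms by (simp add: linear_op_map_def)
  moreover have "N (ketbra dA a a') \<in> ops dB" using assms by (simp add: linear_carrier)
  ultimately show "choi dA dB N $$ (a * dB + b, a' * dB + b') =
      (of_real (1 / real dA) \<cdot>\<^sub>m choiU dA dB N) $$ (a * dB + b, a' * dB + b')"
    using * assms idx_less[of a dA b dB] idx_less[of a' dA b' dB]
      carrier_matD[OF choiU_carrier[of dA dB N]]
    by (simp add: choi_def tensor_id_left choiU_index)
qed (simp_all add: choi_def)

lemma cp_choiU:
  assumes "cp_map dA dB N"
  shows "psd (dA * dB) (choiU dA dB N)"
proof -
  have lin: "linear_op_map dA dB N" and
    pos: "\<And>k X. psd (k * dA) X \<Longrightarrow> psd (k * dB) (tensor_map k k id dA dB N X)"
    using assms by (auto simp: cp_map_def)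
  show ?thesis unfolding choiU_eq_tensor[OF lin] by (rule pos[OF psd_rank_one])
qed

lemma cp_linear: "cp_map dA dB N \<Longrightarrow> linear_op_map dA dB N"
  by (simp add: cp_map_def)

text \<open>Choi's theorem: the image of a positive operator is a contraction of its Kronecker product
  with the Choi operator.\<close>

lemma cp_mapI:
  assumes lin: "linear_op_map dA dB N" and psd: "psd (dA * dB) (choiU dA dB N)"
  shows "cp_map dA dB N"
  unfolding cp_map_def
proof (intro conjI allI impI lin)
  fix k X assume X: "psd (k * dA) X"
  let ?Z = "kron X (choiU dA dB N)"
  \<comment> \<open>Here the second index of \<open>X\<close> and the input index of the Choi
    operator both equal \<open>c\<close>, and the sum over \<open>c\<close> contracts them.\<close>
  let ?p = "\<lambda>i c. ((i div dB) * dA + c) * (dA * dB) + (c * dB + i mod dB)"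
  have Z: "psd (k * dA * (dA * dB)) ?Z" using X psd by (rule psd_kron)
  have "tensor_map k k id dA dB N X
      = mat (k * dB) (k * dB) (\<lambda>(i, j). \<Sum>c<dA. \<Sum>c'<dA. ?Z $$ (?p i c, ?p j c'))"
  proof (rule eq_mat_idx)
    fix a a' b b' assume *: "a < k" "a' < k" "b < dB" "b' < dB"
    have "tensor_map k k id dA dB N X $$ (a * dB + b, a' * dB + b')
      = (\<Sum>c<dA. \<Sum>c'<dA. X $$ (a * dA + c, a' * dA + c') * N (ketbra dA c c') $$ (b, b'))"
      using * lin by (simp add: tensor_id_left linear_expand[of dA dB N "blk dA a a' X"])
    also have "... = (\<Sum>c<dA. \<Sum>c'<dA.
        ?Z $$ ((a * dA + c) * (dA * dB) + (c * dB + b), (a' * dA + c') * (dA * dB) + (c' * dB + b')))"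
      using * by (intro sum.cong refl)
        (simp add: kron_index[OF psd_carrier[OF X] choiU_carrier] idx_less choiU_index)
    finally show "tensor_map k k id dA dB N X $$ (a * dB + b, a' * dB + b')
      = mat (k * dB) (k * dB) (\<lambda>(i, j). \<Sum>c<dA. \<Sum>c'<dA. ?Z $$ (?p i c, ?p j c')) $$ (a * dB + b, a' * dB + b')"
      using * by (simp add: idx_less)
  qed simp_all
  moreover have "psd (k * dB) (mat (k * dB) (k * dB) (\<lambda>(i, j). \<Sum>c<dA. \<Sum>c'<dA. ?Z $$ (?p i c, ?p j c')))"
    by (rule psd_contract[OF Z]) (simp add: idx_less div_less_idx mod_less_idx)
  ultimately show "psd (k * dB) (tensor_map k k id dA dB N X)" by simp
qed

lemma cp_comp:
  assumes N: "cp_map dA dB N" and P: "cp_map dB dC P"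
  shows "cp_map dA dC (\<lambda>X. P (N X))"
  unfolding cp_map_def
proof (intro conjI allI impI)
  note lin = N[THEN cp_linear] P[THEN cp_linear]
  show L: "linear_op_map dA dC (\<lambda>X. P (N X))" using lin by (rule linear_comp)
  fix k X assume X: "psd (k * dA) X"
  have "tensor_map k k id dA dC (\<lambda>X. P (N X)) X
      = tensor_map k k id dB dC P (tensor_map k k id dA dB N X)"
  proof (rule eq_mat_idx)
    fix a a' b b' assume *: "a < k" "a' < k" "b < dC" "b' < dC"
    have "blk dB a a' (tensor_map k k id dA dB N X) = N (blk dA a a' X)"
      using * linear_carrier[OF lin(1), of "blk dA a a' X"]
      by (intro eq_matI) (auto simp: tensor_id_left[OF lin(1)])
    then show "tensor_map k k id dA dC (\<lambda>X. P (N X)) X $$ (a * dC + b, a' * dC + b')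
      = tensor_map k k id dB dC P (tensor_map k k id dA dB N X) $$ (a * dC + b, a' * dC + b')"
      using * by (simp add: tensor_id_left[OF lin(2)] tensor_id_left[OF L])
  qed simp_all
  then show "psd (k * dC) (tensor_map k k id dA dC (\<lambda>X. P (N X)) X)"
    using N P X by (simp add: cp_map_def)
qed

lemma cp_sum:
  assumes "finite I" "\<And>k. k \<in> I \<Longrightarrow> cp_map dA dB (N k)"
  shows "cp_map dA dB (\<lambda>X. mat dB dB (\<lambda>ij. \<Sum>k\<in>I. N k X $$ ij))"
proof (rule cp_mapI)
  have E: "(\<Sum>k\<in>I. N k X $$ (i,j)) = (\<Sum>a<dA. \<Sum>a'<dA. X $$ (a, a') * (\<Sum>k\<in>I. N k (ketbra dA a a') $$ (i,j)))"
    if "X \<in> ops dA" "i < dB" "j < dB" for X i j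
  proof -
    have "(\<Sum>k\<in>I. N k X $$ (i,j)) = (\<Sum>k\<in>I. \<Sum>a<dA. \<Sum>a'<dA. X $$ (a, a') * N k (ketbra dA a a') $$ (i,j))"
      by (intro sum.cong refl, rule linear_expand[OF cp_linear[OF assms(2)]]) (use that in auto)
    also have "... = (\<Sum>a<dA. \<Sum>k\<in>I. \<Sum>a'<dA. X $$ (a, a') * N k (ketbra dA a a') $$ (i,j))"
      by (rule sum.swap)
    also have "... = (\<Sum>a<dA. \<Sum>a'<dA. \<Sum>k\<in>I. X $$ (a, a') * N k (ketbra dA a a') $$ (i,j))"
      by (intro sum.cong refl sum.swap)
    finally show ?thesis by (simp add: sum_distrib_left)
  qed
  show "linear_op_map dA dB (\<lambda>X. mat dB dB (\<lambda>ij. \<Sum>k\<in>I. N k X $$ ij))"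
    by (rule linear_op_mapI[where G = "\<lambda>a a' i j. \<Sum>k\<in>I. N k (ketbra dA a a') $$ (i,j)"],
        rule cong_mat[OF refl refl], simp only: split_conv, rule E)
  have c: "choiU dA dB (N k) = mat (dA * dB) (dA * dB) (\<lambda>ij. choiU dA dB (N k) $$ ij)" for k
    by (intro eq_matI) (auto simp: choiU_def)
  have "choiU dA dB (\<lambda>X. mat dB dB (\<lambda>ij. \<Sum>k\<in>I. N k X $$ ij))
      = mat (dA * dB) (dA * dB) (\<lambda>ij. \<Sum>k\<in>I. choiU dA dB (N k) $$ ij)"
    by (intro eq_matI) (auto simp: choiU_def mod_less_idx)
  moreover have "psd (dA * dB) ..."
    using assms c by (intro psd_sum) (auto dest: cp_choiU)
  ultimately show "psd (dA * dB) (choiU dA dB (\<lambda>X. mat dB dB (\<lambda>ij. \<Sum>k\<in>I. N k X $$ ij)))"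
    by simp
qed

lemma cp_smult:
  assumes "cp_map dA dB N" "0 \<le> (c::real)"
  shows "cp_map dA dB (\<lambda>X. of_real c \<cdot>\<^sub>m N X)"
proof (rule cp_mapI)
  note lin = cp_linear[OF assms(1)]
  have "of_real c \<cdot>\<^sub>m N X = mat dB dB (\<lambda>(i,j). \<Sum>a<dA. \<Sum>a'<dA.
      X $$ (a, a') * (of_real c * N (ketbra dA a a') $$ (i,j)))" if "X \<in> ops dA" for X
  proof (rule eq_matI; clarsimp)
    note d = carrier_matD[OF linear_carrier[OF lin that]]
    fix i j assume "i < dB" "j < dB"
    then have "(of_real c \<cdot>\<^sub>m N X) $$ (i, j) = of_real c * N X $$ (i, j)"
      using d by simp
    also have "N X $$ (i, j) = (\<Sum>a<dA. \<Sum>a'<dA. X $$ (a, a') * N (ketbra dA a a') $$ (i, j))"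
      by (rule linear_expand[OF lin that]) fact+
    finally show "(of_real c \<cdot>\<^sub>m N X) $$ (i, j) =
        (\<Sum>a<dA. \<Sum>a'<dA. X $$ (a, a') * (of_real c * N (ketbra dA a a') $$ (i,j)))"
      by (simp only: sum_distrib_left mult.left_commute[of "of_real c"])
  qed (use carrier_matD[OF linear_carrier[OF lin that]] in simp_all)
  then show "linear_op_map dA dB (\<lambda>X. of_real c \<cdot>\<^sub>m N X)"
    by (rule linear_op_mapI)
  have N: "N (ketbra dA a a') \<in> ops dB" for a a'
    using lin by (simp add: linear_carrier)
  have "choiU dA dB (\<lambda>X. of_real c \<cdot>\<^sub>m N X) = of_real c \<cdot>\<^sub>m choiU dA dB N"
    using carrier_matD[OF N] by (intro eq_matI) (auto simp: choiU_def mod_less_idx)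
  then show "psd (dA * dB) (choiU dA dB (\<lambda>X. of_real c \<cdot>\<^sub>m N X))"
    using assms by (simp add: psd_smult cp_choiU)
qed

text \<open>The map with the single Kraus operator \<open>V\<close>, output index first. Its Choi
  operator has rank one, whence complete positivity.\<close>

definition conj_map :: "nat \<Rightarrow> nat \<Rightarrow> (nat \<Rightarrow> nat \<Rightarrow> complex) \<Rightarrow> complex mat \<Rightarrow> complex mat" where
  "conj_map dA dB V X = mat dB dB (\<lambda>(i, j). \<Sum>a<dA. \<Sum>a'<dA. X $$ (a, a') * (V i a * cnj (V j a')))"

lemma conj_map_ketbra:
  assumes "a < dA" "a' < dA" "i < dB" "j < dB"
  shows "conj_map dA dB V (ketbra dA a a') $$ (i, j) = V i a * cnj (V j a')"
proof -
  have "conj_map dA dB V (ketbra dA a a') $$ (i, j) =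
    (\<Sum>b<dA. \<Sum>b'<dA. ketbra dA a a' $$ (b, b') * (V i b * cnj (V j b')))"
    by (simp only: conj_map_def index_mat(1)[OF assms(3,4)] split_conv)
  also have "... = (\<Sum>b<dA. \<Sum>b'<dA. if b' = a' then if b = a then V i a * cnj (V j a') else 0 else 0)"
    by (intro sum.cong refl) auto
  finally show ?thesis using assms by simp
qed

lemma cp_conj_map: "cp_map dA dB (conj_map dA dB V)"
proof (rule cp_mapI)
  show "linear_op_map dA dB (conj_map dA dB V)"
    by (rule linear_op_mapI) (simp add: conj_map_def)
  have "choiU dA dB (conj_map dA dB V) = mat (dA * dB) (dA * dB)
      (\<lambda>(p, q). V (p mod dB) (p div dB) * cnj (V (q mod dB) (q div dB)))"
    by (intro eq_matI) (auto simp: choiU_def mod_less_idx div_less_idx conj_map_ketbra)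
  then show "psd (dA * dB) (choiU dA dB (conj_map dA dB V))"
    by (simp add: psd_rank_one[where u = "\<lambda>p. V (p mod dB) (p div dB)"])
qed

lemma mtrace_expand:
  assumes "linear_op_map dA dB N" "X \<in> ops dA"
  shows "mtrace (N X) = (\<Sum>a<dA. \<Sum>a'<dA. X $$ (a, a') * mtrace (N (ketbra dA a a')))"
proof -
  have "mtrace (N X) = (\<Sum>i<dB. \<Sum>a<dA. \<Sum>a'<dA. X $$ (a, a') * N (ketbra dA a a') $$ (i, i))"
    using carrier_matD[OF linear_carrier[OF assms]] by (simp add: mtrace_def linear_expand[OF assms])
  also have "... = (\<Sum>a<dA. \<Sum>i<dB. \<Sum>a'<dA. X $$ (a, a') * N (ketbra dA a a') $$ (i, i))"
    by (rule sum.swap)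
  also have "... = (\<Sum>a<dA. \<Sum>a'<dA. \<Sum>i<dB. X $$ (a, a') * N (ketbra dA a a') $$ (i, i))"
    by (intro sum.cong refl sum.swap)
  also have "... = (\<Sum>a<dA. \<Sum>a'<dA. X $$ (a, a') * mtrace (N (ketbra dA a a')))"
    using carrier_matD[OF linear_carrier[OF assms(1) ketbra_carrier]]
    by (simp add: mtrace_def sum_distrib_left)
  finally show ?thesis .
qed

lemma mtrace_ketbra:
  assumes "a < d" shows "mtrace (ketbra d a b) = (if a = b then 1 else 0)"
proof -
  have "mtrace (ketbra d a b) = (\<Sum>i<d. if i = a then if a = b then 1 else 0 else 0)"
    using carrier_matD[OF ketbra_carrier[of d a b]] by (auto simp: mtrace_def intro!: sum.cong)
  then show ?thesis using assms by simp
qed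

lemma channelI:
  assumes "cp_map dA dB N"
    "\<And>a a'. a < dA \<Longrightarrow> a' < dA \<Longrightarrow> mtrace (N (ketbra dA a a')) = (if a = a' then 1 else 0)"
  shows "channel dA dB N"
  unfolding channel_def
proof (intro conjI ballI assms(1))
  fix X :: "complex mat" assume X: "X \<in> ops dA"
  have "mtrace (N X) = (\<Sum>a<dA. \<Sum>a'<dA. if a = a' then X $$ (a, a) else 0)"
    unfolding mtrace_expand[OF cp_linear[OF assms(1)] X] using assms(2)
    by (intro sum.cong refl) auto
  then show "mtrace (N X) = mtrace X" using X by (simp add: mtrace_def)
qed

lemma channel_cp: "channel dA dB N \<Longrightarrow> cp_map dA dB N"
  by (simp add: channel_def)

lemma channel_linear: "channel dA dB N \<Longrightarrow> linear_op_map dA dB N"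
  by (simp add: channel_def cp_map_def)

lemma channel_mtrace: "channel dA dB N \<Longrightarrow> X \<in> ops dA \<Longrightarrow> mtrace (N X) = mtrace X"
  by (simp add: channel_def)

section \<open>Tensor products of maps and their Choi operators\<close>

lemma tensor_map_ketbra:
  assumes lin: "linear_op_map dA dB N" "linear_op_map dC dD P"
    and "a < dA" "a' < dA" "c < dC" "c' < dC"
  shows "tensor_map dA dB N dC dD P (ketbra (dA * dC) (a * dC + c) (a' * dC + c'))
    = kron (N (ketbra dA a a')) (P (ketbra dC c c'))"
proof (rule eq_mat_idx)
  note N = linear_carrier[OF lin(1) ketbra_carrier] and P = linear_carrier[OF lin(2) ketbra_carrier]
  show "kron (N (ketbra dA a a')) (P (ketbra dC c c')) \<in> ops (dB * dD)"
    by (rule kron_carrier[OF N P])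
  fix i j k l assume *: "i < dB" "j < dB" "k < dD" "l < dD"
  have "tensor_map dA dB N dC dD P (ketbra (dA * dC) (a * dC + c) (a' * dC + c')) $$ (i * dD + k, j * dD + l)
    = (\<Sum>a1<dA. \<Sum>a2<dA. \<Sum>c1<dC. \<Sum>c2<dC. ketbra (dA * dC) (a * dC + c) (a' * dC + c') $$ (a1 * dC + c1, a2 * dC + c2) *
      (N (ketbra dA a1 a2) $$ (i, j) * P (ketbra dC c1 c2) $$ (k, l)))"
    using * by (rule tensor_map_index[OF lin])
  also have "... = (\<Sum>a1<dA. \<Sum>a2<dA. \<Sum>c1<dC. \<Sum>c2<dC. if c2 = c' then if c1 = c then if a2 = a' then if a1 = a then
      N (ketbra dA a a') $$ (i, j) * P (ketbra dC c c') $$ (k, l) else 0 else 0 else 0 else 0)"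
    using assms by (intro sum.cong refl) (auto simp: idx_less idx_eq_iff)
  also have "... = kron (N (ketbra dA a a')) (P (ketbra dC c c')) $$ (i * dD + k, j * dD + l)"
    using assms * by (simp add: kron_index[OF N P])
  finally show "tensor_map dA dB N dC dD P (ketbra (dA * dC) (a * dC + c) (a' * dC + c')) $$ (i * dD + k, j * dD + l) = ..." .
qed simp

text \<open>\<open>tensor_map\<close> evaluates its two arguments on matrix units and extends
  linearly, so the result is linear by construction.\<close>

lemma linear_tensor:
  "linear_op_map (dA * dC) (dB * dD) (tensor_map dA dB N dC dD P)"
proof (rule linear_op_mapI)
  fix X :: "complex mat"
  show "tensor_map dA dB N dC dD P X = mat (dB * dD) (dB * dD) (\<lambda>(i, j).
    \<Sum>p<dA * dC. \<Sum>q<dA * dC. X $$ (p, q) *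
      kron (N (ketbra dA (p div dC) (q div dC))) (P (ketbra dC (p mod dC) (q mod dC))) $$ (i, j))"
    unfolding tensor_map_def
  proof (intro cong_mat refl, clarify)
    fix i j
    let ?f = "\<lambda>a c a' c'. X $$ (a * dC + c, a' * dC + c') * kron (N (ketbra dA a a')) (P (ketbra dC c c')) $$ (i, j)"
    have "(\<Sum>a<dA. \<Sum>a'<dA. \<Sum>c<dC. \<Sum>c'<dC. ?f a c a' c') = (\<Sum>a<dA. \<Sum>c<dC. \<Sum>a'<dA. \<Sum>c'<dC. ?f a c a' c')"
      by (intro sum.cong refl sum.swap)
    then show "(\<Sum>a<dA. \<Sum>a'<dA. \<Sum>c<dC. \<Sum>c'<dC. ?f a c a' c') = (\<Sum>p<dA * dC. \<Sum>q<dA * dC. X $$ (p, q) *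
      kron (N (ketbra dA (p div dC) (q div dC))) (P (ketbra dC (p mod dC) (q mod dC))) $$ (i, j))"
      by (simp add: sum_idx)
  qed
qed

lemma choiU_tensor:
  assumes lin: "linear_op_map dA dB N" "linear_op_map dC dD P"
    and "a < dA" "a' < dA" "c < dC" "c' < dC" "b < dB" "b' < dB" "d < dD" "d' < dD"
  shows "choiU (dA * dC) (dB * dD) (tensor_map dA dB N dC dD P)
      $$ (idx4 dB dC dD a c b d, idx4 dB dC dD a' c' b' d')
    = choiU dA dB N $$ (a * dB + b, a' * dB + b') * choiU dC dD P $$ (c * dD + d, c' * dD + d')"
  using assms
  by (simp add: choiU_index idx_less tensor_map_ketbra
      kron_index[OF linear_carrier[OF lin(1) ketbra_carrier] linear_carrier[OF lin(2) ketbra_carrier]])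

text \<open>Takes the position of (a, c, b, d) in (A C)(B D) to the position of (a, b, c, d) in (A
  B)(C D).\<close>

definition exch :: "nat \<Rightarrow> nat \<Rightarrow> nat \<Rightarrow> nat \<Rightarrow> nat" where
  "exch dB dC dD p = (let x = p div (dB * dD); y = p mod (dB * dD) in
     ((x div dC) * dB + y div dD) * (dC * dD) + ((x mod dC) * dD + y mod dD))"

lemma exch_idx:
  assumes "c < dC" "b < dB" "d < dD"
  shows "exch dB dC dD (idx4 dB dC dD a c b d) = (a * dB + b) * (dC * dD) + (c * dD + d)"
  using assms by (simp add: exch_def Let_def idx_less)

lemma exch_less:
  assumes "p < dA * dC * (dB * dD)"
  shows "exch dB dC dD p < dA * dB * (dC * dD)"
proof -
  have *: "p div (dB * dD) < dA * dC" "p mod (dB * dD) < dB * dD"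
    using div_less_idx[OF assms] mod_less_idx[OF assms] .
  show ?thesis unfolding exch_def Let_def
    by (intro idx_less div_less_idx[OF *(1)] div_less_idx[OF *(2)] mod_less_idx[OF *(1)] mod_less_idx[OF *(2)])
qed

text \<open>Exchanging the two middle factors turns a Kronecker product of operators on \<open>A \<otimes> B\<close>
  and \<open>C \<otimes> D\<close> into an operator on \<open>(A \<otimes> C) \<otimes> (B \<otimes> D)\<close>.\<close>

definition kron_exch :: "nat \<Rightarrow> nat \<Rightarrow> nat \<Rightarrow> nat \<Rightarrow> complex mat \<Rightarrow> complex mat \<Rightarrow> complex mat" where
  "kron_exch dA dB dC dD X Y = mat (dA * dC * (dB * dD)) (dA * dC * (dB * dD))
     (\<lambda>(p, q). kron X Y $$ (exch dB dC dD p, exch dB dC dD q))"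

lemma kron_exch_carrier [simp]:
  "kron_exch dA dB dC dD X Y \<in> ops (dA * dC * (dB * dD))"
  by (simp add: kron_exch_def)

lemma kron_exch_index:
  assumes "X \<in> ops (dA * dB)" "Y \<in> ops (dC * dD)"
    "a < dA" "a' < dA" "c < dC" "c' < dC" "b < dB" "b' < dB" "d < dD" "d' < dD"
  shows "kron_exch dA dB dC dD X Y
      $$ (idx4 dB dC dD a c b d, idx4 dB dC dD a' c' b' d')
    = X $$ (a * dB + b, a' * dB + b') * Y $$ (c * dD + d, c' * dD + d')"
  using assms by (simp add: kron_exch_def idx_less exch_idx kron_index)

lemma psd_kron_exch:
  assumes "psd (dA * dB) X" "psd (dC * dD) Y"
  shows "psd (dA * dC * (dB * dD)) (kron_exch dA dB dC dD X Y)"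
  unfolding kron_exch_def by (rule psd_reindex[OF psd_kron[OF assms] exch_less])

lemma eq_mat_idx4:
  assumes "X \<in> ops (dA * dC * (dB * dD))"
    "Y \<in> ops (dA * dC * (dB * dD))"
    "\<And>a a' c c' b b' d d'. a < dA \<Longrightarrow> a' < dA \<Longrightarrow> c < dC \<Longrightarrow> c' < dC \<Longrightarrow> b < dB \<Longrightarrow> b' < dB \<Longrightarrow> d < dD \<Longrightarrow> d' < dD
      \<Longrightarrow> X $$ (idx4 dB dC dD a c b d, idx4 dB dC dD a' c' b' d')
        = Y $$ (idx4 dB dC dD a c b d, idx4 dB dC dD a' c' b' d')"
  shows "X = Y"
proof (rule eq_mat_idx[OF assms(1,2)])
  fix x x' y y' assume *: "x < dA * dC" "x' < dA * dC" "y < dB * dD" "y' < dB * dD"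
  show "X $$ (x * (dB * dD) + y, x' * (dB * dD) + y') = Y $$ (x * (dB * dD) + y, x' * (dB * dD) + y')"
    using assms(3)[of "x div dC" "x' div dC" "x mod dC" "x' mod dC" "y div dD" "y' div dD" "y mod dD" "y' mod dD"] *
    by (simp add: div_less_idx mod_less_idx)
qed

text \<open>The Choi operator of a product lists both inputs before both outputs, the product of the
  Choi operators alternates them; \<open>kron_exch\<close> is the relabelling in between and
  preserves positivity.\<close>

lemma choiU_tensor_eq:
  assumes "linear_op_map dA dB N" "linear_op_map dC dD P"
  shows "choiU (dA * dC) (dB * dD) (tensor_map dA dB N dC dD P)
    = kron_exch dA dB dC dD (choiU dA dB N) (choiU dC dD P)"
  by (rule eq_mat_idx4[where dA = dA and dB = dB and dC = dC and dD = dD]) (simp_all add: choiU_tensor[OF assms] kron_exch_index)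

lemma cp_tensor:
  assumes "cp_map dA dB N" "cp_map dC dD P"
  shows "cp_map (dA * dC) (dB * dD) (tensor_map dA dB N dC dD P)"
  using assms by (intro cp_mapI linear_tensor)
    (simp add: choiU_tensor_eq[OF assms[THEN cp_linear]] psd_kron_exch cp_choiU)

lemma mtrace_kron:
  assumes "X \<in> ops m" "Y \<in> ops n"
  shows "mtrace (kron X Y) = mtrace X * mtrace Y"
  using assms carrier_matD[OF kron_carrier[OF assms]]
  by (simp add: mtrace_def sum_idx kron_index sum_product)

lemma channel_tensor:
  assumes "channel dA dB N" "channel dC dD P"
  shows "channel (dA * dC) (dB * dD) (tensor_map dA dB N dC dD P)"
proof (rule channelI)
  note lin = assms[THEN channel_linear]
  show "cp_map (dA * dC) (dB * dD) (tensor_map dA dB N dC dD P)"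
    using assms by (simp add: cp_tensor channel_cp)
  fix p q assume *: "p < dA * dC" "q < dA * dC"
  have "mtrace (tensor_map dA dB N dC dD P (ketbra (dA * dC) p q))
    = mtrace (kron (N (ketbra dA (p div dC) (q div dC))) (P (ketbra dC (p mod dC) (q mod dC))))"
    using tensor_map_ketbra[OF lin, of "p div dC" "q div dC" "p mod dC" "q mod dC"] *
    by (simp add: div_less_idx mod_less_idx)
  also have "... = mtrace (ketbra dA (p div dC) (q div dC)) * mtrace (ketbra dC (p mod dC) (q mod dC))"
    by (simp only: mtrace_kron[OF linear_carrier[OF lin(1) ketbra_carrier] linear_carrier[OF lin(2) ketbra_carrier]]
        channel_mtrace[OF assms(1) ketbra_carrier] channel_mtrace[OF assms(2) ketbra_carrier])
  also have "... = (if p = q then 1 else 0)"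
    using * by (simp add: mtrace_ketbra div_less_idx mod_less_idx) (metis div_mult_mod_eq)
  finally show "mtrace (tensor_map dA dB N dC dD P (ketbra (dA * dC) p q)) = (if p = q then 1 else 0)" .
qed

lemma cp_tensor_power: "cp_map dA dB N \<Longrightarrow> cp_map (dA ^ n) (dB ^ n) (tensor_power dA dB N n)"
proof (induction n)
  case 0
  have "tensor_map k k id 1 1 id X = X" if "X \<in> ops (k * 1)" for k X
  proof (rule eq_mat_idx[OF tensor_map_carrier that])
    fix a a' b b' :: nat assume "a < k" "a' < k" "b < 1" "b' < 1"
    then show "tensor_map k k id 1 1 id X $$ (a * 1 + b, a' * 1 + b') = X $$ (a * 1 + b, a' * 1 + b')"
      by (subst tensor_id_left[OF linear_id]) simp_all
  qed
  then have "cp_map 1 1 id" by (simp add: cp_map_def linear_id psd_carrier)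
  then show ?case by (simp only: power_0 tensor_power.simps)
next
  case (Suc n)
  then show ?case by (simp add: cp_tensor)
qed

section \<open>Branches of a retrocausal strategy\<close>

lemma kron_ketbra:
  assumes "c < n" "d < n"
  shows "kron (ketbra m a b) (ketbra n c d) = ketbra (m * n) (a * n + c) (b * n + d)"
proof (rule eq_mat_idx)
  fix x x' y y' assume *: "x < m" "x' < m" "y < n" "y' < n"
  show "kron (ketbra m a b) (ketbra n c d) $$ (x * n + y, x' * n + y')
    = ketbra (m * n) (a * n + c) (b * n + d) $$ (x * n + y, x' * n + y')"
    unfolding kron_index[OF ketbra_carrier ketbra_carrier *]
    using * assms by (simp add: idx_less idx_eq_iff)
qed (auto intro: kron_carrier)

lemma max_entangled_carrier [simp]: "max_entangled d \<in> ops (d * d)"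
  by (simp add: max_entangled_def)

lemma max_entangled_index:
  assumes "a < d" "b < d" "a' < d" "b' < d"
  shows "max_entangled d $$ (a * d + b, a' * d + b') = (if a = b \<and> a' = b' then 1 / of_nat d else 0)"
  using assms by (simp add: max_entangled_def idx_less)

lemma sum_max_entangled:
  assumes "i < d" "j < d"
  shows "(\<Sum>a<d. \<Sum>a'<d. max_entangled d $$ (a * d + i, a' * d + j) * f a a') = f i j / of_nat d"
proof -
  have "(\<Sum>a<d. \<Sum>a'<d. max_entangled d $$ (a * d + i, a' * d + j) * f a a')
    = (\<Sum>a<d. \<Sum>a'<d. if a' = j then if a = i then f i j / of_nat d else 0 else 0)"
    using assms by (intro sum.cong refl) (auto simp: max_entangled_index)
  then show ?thesis using assms by simp
qed

lemma sum2_max_entangled: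
  "(\<Sum>k<d * d. \<Sum>s<d * d. max_entangled d $$ (k, s) * f k s)
    = (\<Sum>i<d. \<Sum>j<d. f (i * d + i) (j * d + j)) / of_nat d"
proof -
  have "(\<Sum>k<d * d. \<Sum>s<d * d. max_entangled d $$ (k, s) * f k s)
    = (\<Sum>a<d. \<Sum>b<d. \<Sum>a'<d. \<Sum>b'<d. max_entangled d $$ (a * d + b, a' * d + b') * f (a * d + b) (a' * d + b'))"
    by (simp only: sum_idx)
  also have "... = (\<Sum>a<d. \<Sum>b<d. if b = a then \<Sum>a'<d. \<Sum>b'<d.
      if b' = a' then f (a * d + a) (a' * d + a') / of_nat d else 0 else 0)"
  proof (intro sum.cong refl)
    fix a b assume *: "a \<in> {..<d}" "b \<in> {..<d}"
    show "(\<Sum>a'<d. \<Sum>b'<d. max_entangled d $$ (a * d + b, a' * d + b') * f (a * d + b) (a' * d + b'))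
      = (if b = a then \<Sum>a'<d. \<Sum>b'<d. if b' = a' then f (a * d + a) (a' * d + a') / of_nat d else 0 else 0)"
    proof (cases "b = a")
      case True
      show ?thesis unfolding if_P[OF True] using * True
        by (intro sum.cong refl) (auto simp: max_entangled_index)
    qed (use * in \<open>simp add: max_entangled_index\<close>)
  qed
  also have "... = (\<Sum>i<d. \<Sum>j<d. f (i * d + i) (j * d + j) / of_nat d)"
    by (rule sum.cong[OF refl]) simp
  finally show ?thesis by (simp add: sum_divide_distrib)
qed

lemma kron_one_mult_index:
  assumes X: "X \<in> ops n" and Y: "Y \<in> ops (m * n)"
    and "x < m" "y < m" "k < n" "l < n"
  shows "(amp m X * Y) $$ (x * n + k, y * n + l) = (\<Sum>s<n. X $$ (k, s) * Y $$ (x * n + s, y * n + l))"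
proof -
  have K: "amp m X \<in> ops (m * n)"
    by (rule kron_carrier[OF one_carrier_mat X])
  have i: "x * n + k < m * n" "y * n + l < m * n" using assms by (simp_all add: idx_less)
  have "(amp m X * Y) $$ (x * n + k, y * n + l)
    = (\<Sum>t<m * n. amp m X $$ (x * n + k, t) * Y $$ (t, y * n + l))"
    using K Y i by (simp add: times_mat_def scalar_prod_def lessThan_atLeast0)
  also have "... = (\<Sum>f<m. \<Sum>s<n. (1\<^sub>m m $$ (x, f) * X $$ (k, s)) * Y $$ (f * n + s, y * n + l))"
    unfolding sum_idx using assms
    by (intro sum.cong refl) (simp add: kron_index[OF one_carrier_mat X])
  also have "... = (\<Sum>f<m. if f = x then \<Sum>s<n. X $$ (k, s) * Y $$ (x * n + s, y * n + l) else 0)"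
    using assms by (intro sum.cong refl) auto
  finally show ?thesis using assms by simp
qed

text \<open>Each of the two maximally entangled states identifies a pair of copies of A and
  contributes a factor 1/d_A: the preparation feeds |i><j| into the loop, the projection reads off
  the matrix element (i, j). What remains is the trace of \<open>T\<close> as a superoperator on
  A.\<close>

lemma loop_map_index:
  assumes T: "linear_op_map (dE * dA) (dF * dA) T" and "m < dE" "x < dF" "y < dF"
  shows "loop_map dE dF dA T (ketbra dE m m) $$ (x, y) =
    (\<Sum>i<dA. \<Sum>j<dA. T (kron (ketbra dE m m) (ketbra dA i j)) $$ (x * dA + i, y * dA + j)) / of_nat (dA * dA)"
proof -
  let ?R = "kron (ketbra dE m m) (max_entangled dA)"
  let ?Y = "tensor_map (dE * dA) (dF * dA) T dA dA id ?R"
  have Y: "?Y \<in> ops (dF * (dA * dA))"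
    using tensor_map_carrier[of "dE * dA" "dF * dA" T dA dA id ?R] by (simp only: mult.assoc)
  have Yij: "?Y $$ (x * (dA * dA) + (j * dA + j), y * (dA * dA) + (i * dA + i))
      = T (kron (ketbra dE m m) (ketbra dA j i)) $$ (x * dA + j, y * dA + i) / of_nat dA"
    if "i < dA" "j < dA" for i j
  proof -
    have e: "x * (dA * dA) + (j * dA + j) = (x * dA + j) * dA + j" "y * (dA * dA) + (i * dA + i) = (y * dA + i) * dA + i"
      by (simp_all add: algebra_simps)
    let ?t = "\<lambda>p q. T (ketbra (dE * dA) p q) $$ (x * dA + j, y * dA + i)"
    have R: "?R $$ ((e * dA + a) * dA + j, (e' * dA + a') * dA + i)
        = (if e = m \<and> e' = m then max_entangled dA $$ (a * dA + j, a' * dA + i) else 0)"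
      if "e < dE" "e' < dE" "a < dA" "a' < dA" for e e' a a'
    proof -
      have "(e * dA + a) * dA + j = e * (dA * dA) + (a * dA + j)" "(e' * dA + a') * dA + i = e' * (dA * dA) + (a' * dA + i)"
        by (simp_all add: algebra_simps)
      then show ?thesis
        using that \<open>i < dA\<close> \<open>j < dA\<close>
        by (simp only:) (simp add: kron_index[OF ketbra_carrier max_entangled_carrier] idx_less)
    qed
    have "?Y $$ (x * (dA * dA) + (j * dA + j), y * (dA * dA) + (i * dA + i))
      = (\<Sum>p<dE * dA. \<Sum>q<dE * dA. ?R $$ (p * dA + j, q * dA + i) * ?t p q)"
      unfolding e using that assms by (intro tensor_id_right[OF T] idx_less)
    also have "... = (\<Sum>e<dE. \<Sum>a<dA. \<Sum>e'<dE. \<Sum>a'<dA.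
        ?R $$ ((e * dA + a) * dA + j, (e' * dA + a') * dA + i) * ?t (e * dA + a) (e' * dA + a'))"
      by (simp only: sum_idx)
    also have "... = (\<Sum>e<dE. \<Sum>a<dA. \<Sum>e'<dE. if e' = m then \<Sum>a'<dA.
        if e = m then max_entangled dA $$ (a * dA + j, a' * dA + i) * ?t (m * dA + a) (m * dA + a') else 0 else 0)"
      by (intro sum.cong refl) (auto simp: R intro!: sum.cong)
    also have "... = (\<Sum>e<dE. if e = m then \<Sum>a<dA. \<Sum>a'<dA.
        max_entangled dA $$ (a * dA + j, a' * dA + i) * ?t (m * dA + a) (m * dA + a') else 0)"
      using assms(2) by (intro sum.cong refl) auto
    also have "... = (\<Sum>a<dA. \<Sum>a'<dA. max_entangled dA $$ (a * dA + j, a' * dA + i) * ?t (m * dA + a) (m * dA + a'))"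
      using assms(2) by simp
    also have "... = ?t (m * dA + j) (m * dA + i) / of_nat dA"
      by (rule sum_max_entangled) fact+
    finally show ?thesis using that by (simp only: kron_ketbra)
  qed
  have "loop_map dE dF dA T (ketbra dE m m) $$ (x, y)
    = (\<Sum>k<dA * dA. (amp dF (max_entangled dA) * ?Y) $$ (x * (dA * dA) + k, y * (dA * dA) + k))"
    using assms by (simp add: loop_map_def ptrace2_def)
  also have "... = (\<Sum>k<dA * dA. \<Sum>s<dA * dA. max_entangled dA $$ (k, s) * ?Y $$ (x * (dA * dA) + s, y * (dA * dA) + k))"
    using assms by (intro sum.cong refl kron_one_mult_index[OF max_entangled_carrier Y]) auto
  also have "... = (\<Sum>i<dA. \<Sum>j<dA. ?Y $$ (x * (dA * dA) + (j * dA + j), y * (dA * dA) + (i * dA + i))) / of_nat dA"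
    by (rule sum2_max_entangled)
  also have "... = (\<Sum>i<dA. \<Sum>j<dA. T (kron (ketbra dE m m) (ketbra dA j i)) $$ (x * dA + j, y * dA + i) / of_nat dA) / of_nat dA"
    by (simp add: Yij)
  also have "... = (\<Sum>j<dA. \<Sum>i<dA. T (kron (ketbra dE m m) (ketbra dA j i)) $$ (x * dA + j, y * dA + i)) / of_nat (dA * dA)"
    by (subst sum.swap) (simp add: sum_divide_distrib[symmetric])
  finally show ?thesis .
qed

lemma linear_swap: "linear_op_map (d1 * d2) (d2 * d1) (swap_map d1 d2)"
proof -
  have b: "(i mod d1) * d2 + i div d1 < d1 * d2" if "i < d2 * d1" for i
    by (intro idx_less mod_less_idx[OF that] div_less_idx[OF that])
  show ?thesis unfolding linear_op_map_def swap_map_def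
    by (intro conjI ballI allI) (auto intro!: eq_matI simp: b)
qed

lemma swap_map_index:
  assumes "x < d2" "y < d2" "z < d1" "z' < d1"
  shows "swap_map d1 d2 X $$ (x * d1 + z, y * d1 + z') = X $$ (z * d2 + x, z' * d2 + y)"
  using assms by (simp add: swap_map_def idx_less)

lemma tensor_swap_index:
  assumes W: "W \<in> ops (d * (d * k))"
    and *: "x < d" "y < d" "z < d" "z' < d" "l < k" "l' < k"
  shows "tensor_map (d * d) (d * d) (swap_map d d) k k id W $$ (x * (d * k) + (z * k + l), y * (d * k) + (z' * k + l'))
    = W $$ (z * (d * k) + (x * k + l), z' * (d * k) + (y * k + l'))"
proof -
  have e: "a * (d * k) + (b * k + c) = (a * d + b) * k + c" for a b c :: nat
    by (simp add: algebra_simps)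
  have "tensor_map (d * d) (d * d) (swap_map d d) k k id W $$ ((x * d + z) * k + l, (y * d + z') * k + l')
    = (\<Sum>p<d * d. \<Sum>q<d * d. W $$ (p * k + l, q * k + l') * swap_map d d (ketbra (d * d) p q) $$ (x * d + z, y * d + z'))"
    using * by (intro tensor_id_right[OF linear_swap] idx_less)
  also have "... = (\<Sum>p<d * d. \<Sum>q<d * d. if q = z' * d + y then if p = z * d + x then
      W $$ ((z * d + x) * k + l, (z' * d + y) * k + l') else 0 else 0)"
    using * by (intro sum.cong refl) (auto simp: swap_map_index idx_less)
  also have "... = W $$ ((z * d + x) * k + l, (z' * d + y) * k + l')"
    using * by (simp add: idx_less)
  finally show ?thesis unfolding e .
qed

text \<open>The expectation of (id (x) C)(K) in the vector sum_i |i>|i>. For K =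
  \<open>choiU dA dB N\<close> this is d_A^2 times the entanglement fidelity of \<open>C\<close>
  after \<open>N\<close>.\<close>

definition pairing :: "nat \<Rightarrow> nat \<Rightarrow> opmap \<Rightarrow> complex mat \<Rightarrow> complex" where
  "pairing dA dB C K = (\<Sum>i<dA. \<Sum>j<dA. C (blk dB i j K) $$ (i, j))"

lemma blk_choiU:
  assumes "linear_op_map dA dB N" "i < dA" "j < dA"
  shows "blk dB i j (choiU dA dB N) = N (ketbra dA i j)"
  using assms carrier_matD[OF linear_carrier[OF assms(1) ketbra_carrier]]
  by (intro eq_matI) (auto simp: choiU_index)

text \<open>The operation on \<open>B \<rightarrow> A\<close> induced by the strategy for input \<open>m\<close> and output \<open>x\<close>.\<close>

definition branch :: "nat \<Rightarrow> nat \<Rightarrow> opmap \<Rightarrow> opmap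
    \<Rightarrow> nat \<Rightarrow> nat \<Rightarrow> complex mat \<Rightarrow> complex mat" where
  "branch dM dL Enc Dec m x Y = Enc (kron (ketbra dM m m) (blk dL x x (Dec Y)))"

text \<open>A diagonal element of the output selects the diagonal block of the decoder output with
  guess \<open>x\<close>, and |m><m| passes unchanged to the encoder; the loop pairs the resulting
  map from B to A with \<open>N\<close>.\<close>

lemma retro_map_index:
  assumes N: "linear_op_map dA dB N" and E: "linear_op_map (dM * dL) dA Enc"
    and D: "linear_op_map dB (dM * dL) Dec" and "m < dM" "x < dM"
  shows "retro_map dA dB N dM dL Enc Dec (ketbra dM m m) $$ (x, x)
    = pairing dA dB (branch dM dL Enc Dec m x) (choiU dA dB N) / of_nat (dA * dA)"
proof -
  let ?TE = "tensor_map dM dM id (dM * dL) dA Enc"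
  let ?TS = "tensor_map (dM * dM) (dM * dM) (swap_map dM dM) dL dL id"
  let ?TD = "tensor_map dM dM id dB (dM * dL) Dec"
  let ?TN = "tensor_map dM dM id dA dB N"
  let ?kb = "ketbra dM m m"
  have lS: "linear_op_map (dM * (dM * dL)) (dM * (dM * dL)) ?TS"
    using linear_tensor[of "dM * dM" dL "dM * dM" dL "swap_map dM dM" id] by (simp only: mult.assoc)
  have lin: "linear_op_map (dM * dA) (dM * dA) (\<lambda>X. ?TE (?TS (?TD (?TN X))))"
    by (rule linear_comp[OF _ linear_tensor], rule linear_comp[OF _ lS], rule linear_comp[OF _ linear_tensor], rule linear_tensor)
  have T: "?TE (?TS (?TD (?TN (kron ?kb (ketbra dA i j))))) $$ (x * dA + i, x * dA + j)
      = branch dM dL Enc Dec m x (N (ketbra dA i j)) $$ (i, j)" if "i < dA" "j < dA" for i j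
  proof -
    let ?Z = "Dec (N (ketbra dA i j))"
    let ?W = "kron ?kb ?Z"
    have Z: "?Z \<in> ops (dM * dL)"
      by (rule linear_carrier[OF D linear_carrier[OF N ketbra_carrier]])
    have W: "?W \<in> ops (dM * (dM * dL))"
      by (rule kron_carrier[OF ketbra_carrier Z])
    have "?TN (kron ?kb (ketbra dA i j)) = kron ?kb (N (ketbra dA i j))"
      by (rule tensor_id_left_kron[OF N ketbra_carrier ketbra_carrier])
    moreover have "?TD (kron ?kb (N (ketbra dA i j))) = ?W"
      by (rule tensor_id_left_kron[OF D ketbra_carrier linear_carrier[OF N ketbra_carrier]])
    moreover have "?TE (?TS ?W) $$ (x * dA + i, x * dA + j) = Enc (blk (dM * dL) x x (?TS ?W)) $$ (i, j)"
      using that assms by (intro tensor_id_left[OF E])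
    moreover have "blk (dM * dL) x x (?TS ?W) = kron ?kb (blk dL x x ?Z)"
    proof (rule eq_mat_idx)
      show "kron ?kb (blk dL x x ?Z) \<in> ops (dM * dL)"
        by (rule kron_carrier[OF ketbra_carrier blk_carrier])
      fix z z' l l' assume *: "z < dM" "z' < dM" "l < dL" "l' < dL"
      have "blk (dM * dL) x x (?TS ?W) $$ (z * dL + l, z' * dL + l')
        = ?TS ?W $$ (x * (dM * dL) + (z * dL + l), x * (dM * dL) + (z' * dL + l'))"
        using * by (simp add: idx_less)
      also have "... = ?W $$ (z * (dM * dL) + (x * dL + l), z' * (dM * dL) + (x * dL + l'))"
        using * assms by (intro tensor_swap_index[OF W])
      also have "... = ?kb $$ (z, z') * ?Z $$ (x * dL + l, x * dL + l')"
        using * assms by (intro kron_index[OF ketbra_carrier Z] idx_less)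
      also have "... = kron ?kb (blk dL x x ?Z) $$ (z * dL + l, z' * dL + l')"
        unfolding kron_index[OF ketbra_carrier blk_carrier *] using * by simp
      finally show "blk (dM * dL) x x (?TS ?W) $$ (z * dL + l, z' * dL + l')
        = kron ?kb (blk dL x x ?Z) $$ (z * dL + l, z' * dL + l')" .
    qed simp
    ultimately show ?thesis by (simp only: branch_def)
  qed
  have "retro_map dA dB N dM dL Enc Dec ?kb $$ (x, x)
    = (\<Sum>i<dA. \<Sum>j<dA. ?TE (?TS (?TD (?TN (kron ?kb (ketbra dA i j))))) $$ (x * dA + i, x * dA + j)) / of_nat (dA * dA)"
    unfolding retro_map_def comp_def using assms by (intro loop_map_index[OF lin])
  also have "... = pairing dA dB (branch dM dL Enc Dec m x) (choiU dA dB N) / of_nat (dA * dA)"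
    by (simp add: T pairing_def blk_choiU[OF N])
  finally show ?thesis .
qed

text \<open>The pairing is the quadratic form of the positive operator (id (x) C)(K) at the
  unnormalised maximally entangled vector \<open>v\<close>.\<close>

lemma pairing_nonneg:
  assumes C: "cp_map dB dA C" and K: "psd (dA * dB) K"
  shows "0 \<le> pairing dA dB C K"
proof -
  let ?M = "tensor_map dA dA id dB dA C K"
  define v where "v p = (if p mod dA = p div dA then 1 else 0 :: complex)" for p
  have M: "psd (dA * dA) ?M" using C K by (simp add: cp_map_def)
  have "qform (dA * dA) ?M v = (\<Sum>i<dA. \<Sum>a<dA. \<Sum>j<dA. \<Sum>b<dA.
      if b = j then if a = i then C (blk dB i j K) $$ (i, j) else 0 else 0)"
    unfolding qform_def sum_idx
    by (intro sum.cong refl) (auto simp: v_def tensor_id_left[OF cp_linear[OF C]])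
  also have "... = (\<Sum>i<dA. \<Sum>a<dA. if a = i then \<Sum>j<dA. C (blk dB i j K) $$ (i, j) else 0)"
    by (intro sum.cong refl) auto
  also have "... = pairing dA dB C K" by (simp add: pairing_def)
  finally show ?thesis using M by (metis psd_iff)
qed

lemma pairing_diff:
  assumes C: "linear_op_map dB dA C" and "K \<in> ops (dA * dB)" "L \<in> ops (dA * dB)"
  shows "pairing dA dB C (K - L) = pairing dA dB C K - pairing dA dB C L"
proof -
  have "C (blk dB i j (K - L)) $$ (i, j) = C (blk dB i j K) $$ (i, j) - C (blk dB i j L) $$ (i, j)"
    if "i < dA" "j < dA" for i j
  proof -
    have "blk dB i j (K - L) + blk dB i j L = blk dB i j K"
      using assms that by (intro eq_matI) (auto simp: idx_less)
    then have "C (blk dB i j K) = C (blk dB i j (K - L)) + C (blk dB i j L)"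
      using C by (metis blk_carrier linear_op_map_def)
    then show ?thesis using that
        carrier_matD[OF linear_carrier[OF C blk_carrier[of dB i j "K - L"]]]
        carrier_matD[OF linear_carrier[OF C blk_carrier[of dB i j L]]] by simp
  qed
  then show ?thesis by (simp add: pairing_def sum_subtractf)
qed

text \<open>The off-diagonal blocks of 1 (x) Y vanish. If \<open>C\<close> is a channel, the value
  is tr Y whatever the channel, which is why these operators serve as dual variables.\<close>

lemma pairing_kron_one:
  assumes C: "linear_op_map dB dA C" and Y: "Y \<in> ops dB"
  shows "pairing dA dB C (amp dA Y) = mtrace (C Y)"
proof -
  have "C (blk dB i j (amp dA Y)) $$ (i, j) = (if j = i then C Y $$ (i, i) else 0)"
    if "i < dA" "j < dA" for i j
  proof -
    have b: "blk dB i j (amp dA Y) = (if j = i then 1 else 0) \<cdot>\<^sub>m Y"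
      using that Y by (intro eq_matI) (auto simp: kron_index[OF one_carrier_mat Y])
    have "C ((if j = i then 1 else 0) \<cdot>\<^sub>m Y) = (if j = i then 1 else 0) \<cdot>\<^sub>m C Y"
      using C Y by (simp add: linear_op_map_def)
    then show ?thesis unfolding b using that carrier_matD[OF linear_carrier[OF C Y]] by simp
  qed
  then have "pairing dA dB C (amp dA Y) = (\<Sum>i<dA. \<Sum>j<dA. if j = i then C Y $$ (i, i) else 0)"
    by (simp add: pairing_def)
  then show ?thesis using carrier_matD[OF linear_carrier[OF C Y]] by (simp add: mtrace_def)
qed

text \<open>The Kraus operator is |m><x| (x) 1 on M and L: keep the branch with guess
  \<open>x\<close>, then replace the guess by the message.\<close>

lemma kron_ketbra_blk_conj:
  assumes "x < dM"
  shows "(\<lambda>Z. kron (ketbra dM m m) (blk dL x x Z)) = conj_map (dM * dL) (dM * dL)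
    (\<lambda>r p. if r div dL = m \<and> p div dL = x \<and> p mod dL = r mod dL then 1 else 0)" (is "_ = conj_map _ _ ?V")
proof (rule ext, rule eq_mat_idx)
  fix Z :: "complex mat"
  show "kron (ketbra dM m m) (blk dL x x Z) \<in> ops (dM * dL)"
    by (rule kron_carrier[OF ketbra_carrier blk_carrier])
  fix a a' b b' assume *: "a < dM" "a' < dM" "b < dL" "b' < dL"
  have "conj_map (dM * dL) (dM * dL) ?V Z $$ (a * dL + b, a' * dL + b')
    = (\<Sum>y<dM. \<Sum>l<dL. \<Sum>y'<dM. \<Sum>l'<dL. Z $$ (y * dL + l, y' * dL + l') *
        (?V (a * dL + b) (y * dL + l) * cnj (?V (a' * dL + b') (y' * dL + l'))))"
    using * by (simp only: conj_map_def index_mat(1)[OF idx_less[OF *(1,3)] idx_less[OF *(2,4)]] split_conv sum_idx)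
  also have "... = (\<Sum>y<dM. \<Sum>l<dL. \<Sum>y'<dM. \<Sum>l'<dL. if l' = b' then if y' = x then if l = b then if y = x then
      if a = m \<and> a' = m then Z $$ (x * dL + b, x * dL + b') else 0 else 0 else 0 else 0 else 0)"
    using * by (intro sum.cong refl) auto
  also have "... = (if a = m \<and> a' = m then Z $$ (x * dL + b, x * dL + b') else 0)"
    using * assms by simp
  also have "... = kron (ketbra dM m m) (blk dL x x Z) $$ (a * dL + b, a' * dL + b')"
    unfolding kron_index[OF ketbra_carrier blk_carrier *] using * by simp
  finally show "kron (ketbra dM m m) (blk dL x x Z) $$ (a * dL + b, a' * dL + b')
    = conj_map (dM * dL) (dM * dL) ?V Z $$ (a * dL + b, a' * dL + b')" by (rule sym)
qed (simp add: conj_map_def)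

lemma cp_branch:
  assumes E: "cp_map (dM * dL) dA Enc" and D: "cp_map dB (dM * dL) Dec" and "x < dM"
  shows "cp_map dB dA (branch dM dL Enc Dec m x)"
proof -
  have F: "cp_map (dM * dL) (dM * dL) (\<lambda>Z. kron (ketbra dM m m) (blk dL x x Z))"
    unfolding kron_ketbra_blk_conj[OF assms(3)] by (rule cp_conj_map)
  have "cp_map dB dA (\<lambda>Y. Enc (kron (ketbra dM m m) (blk dL x x (Dec Y))))"
    by (rule cp_comp[OF cp_comp[OF D F] E])
  then show ?thesis by (simp only: branch_def[abs_def])
qed

text \<open>The encoder preserves the trace and |m><m| has trace one, so the weight that a dual
  operator assigns to outcome \<open>x\<close> is fixed by the decoder alone.\<close>

lemma mtrace_branch:
  assumes "channel (dM * dL) dA Enc" and "m < dM"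
  shows "mtrace (branch dM dL Enc Dec m x Y) = mtrace (blk dL x x (Dec Y))"
  unfolding branch_def channel_mtrace[OF assms(1) kron_carrier[OF ketbra_carrier blk_carrier]]
    mtrace_kron[OF ketbra_carrier blk_carrier] mtrace_ketbra[OF assms(2)] by simp

lemma sum_mtrace_blk:
  assumes "Z \<in> ops (k * d)"
  shows "(\<Sum>x<k. mtrace (blk d x x Z)) = mtrace Z"
  using assms by (simp add: mtrace_def sum_idx)

section \<open>Duality for optimisation over channels\<close>

text \<open>\<open>W\<close> acts as a Choi operator with the output factor A first. In this order
  it lives on the same space as the Choi operator of a map from A to B, and
  \<open>pairing_omap\<close> is an entrywise sum without conjugation.\<close>

definition omap :: "nat \<Rightarrow> nat \<Rightarrow> complex mat \<Rightarrow> complex mat \<Rightarrow> complex mat" where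
  "omap dA dB W Y = mat dA dA (\<lambda>(i, j). \<Sum>b<dB. \<Sum>b'<dB. Y $$ (b, b') * W $$ (i * dB + b, j * dB + b'))"

lemma linear_omap: "linear_op_map dB dA (omap dA dB W)"
  by (rule linear_op_mapI) (simp add: omap_def)

lemma omap_ketbra:
  assumes "b < dB" "b' < dB" "i < dA" "j < dA"
  shows "omap dA dB W (ketbra dB b b') $$ (i, j) = W $$ (i * dB + b, j * dB + b')"
proof -
  have "omap dA dB W (ketbra dB b b') $$ (i, j) =
    (\<Sum>c<dB. \<Sum>c'<dB. ketbra dB b b' $$ (c, c') * W $$ (i * dB + c, j * dB + c'))"
    by (simp only: omap_def index_mat(1)[OF assms(3,4)] split_conv)
  also have "... = (\<Sum>c<dB. \<Sum>c'<dB. if c' = b' then if c = b then W $$ (i * dB + b, j * dB + b') else 0 else 0)"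
    by (intro sum.cong refl) auto
  finally show ?thesis using assms by simp
qed

lemma cp_omap:
  assumes "psd (dA * dB) W"
  shows "cp_map dB dA (omap dA dB W)"
proof (rule cp_mapI[OF linear_omap])
  have "choiU dB dA (omap dA dB W) = mat (dB * dA) (dB * dA)
      (\<lambda>(p, q). W $$ (p mod dA * dB + p div dA, q mod dA * dB + q div dA))"
    by (rule eq_mat_idx[where m = dB and n = dA]) (simp_all add: choiU_index omap_ketbra idx_less)
  moreover have "psd (dB * dA) ..."
    by (rule psd_reindex[OF assms]) (intro idx_less mod_less_idx div_less_idx)
  ultimately show "psd (dB * dA) (choiU dB dA (omap dA dB W))" by simp
qed

text \<open>Trace preservation is the affine constraint that the partial trace of \<open>W\<close>
  over A is the identity.\<close>

lemma channel_omap: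
  assumes "psd (dA * dB) W"
    "\<And>b b'. b < dB \<Longrightarrow> b' < dB \<Longrightarrow> (\<Sum>i<dA. W $$ (i * dB + b, i * dB + b')) = (if b = b' then 1 else 0)"
  shows "channel dB dA (omap dA dB W)"
proof (rule channelI[OF cp_omap[OF assms(1)]])
  fix b b' assume *: "b < dB" "b' < dB"
  have "dim_row (omap dA dB W (ketbra dB b b')) = dA" by (simp add: omap_def)
  then show "mtrace (omap dA dB W (ketbra dB b b')) = (if b = b' then 1 else 0)"
    using * assms(2)[OF *] by (simp add: mtrace_def omap_ketbra)
qed

lemma pairing_omap:
  "pairing dA dB (omap dA dB W) K = (\<Sum>p<dA * dB. \<Sum>q<dA * dB. K $$ (p, q) * W $$ (p, q))"
proof -
  have "pairing dA dB (omap dA dB W) K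
    = (\<Sum>i<dA. \<Sum>j<dA. \<Sum>b<dB. \<Sum>b'<dB. K $$ (i * dB + b, j * dB + b') * W $$ (i * dB + b, j * dB + b'))"
    by (simp add: pairing_def omap_def)
  also have "... = (\<Sum>i<dA. \<Sum>b<dB. \<Sum>j<dA. \<Sum>b'<dB. K $$ (i * dB + b, j * dB + b') * W $$ (i * dB + b, j * dB + b'))"
    by (intro sum.cong refl sum.swap)
  finally show ?thesis by (simp add: sum_idx)
qed

lemma sum_kron_one:
  assumes "Y \<in> ops dB"
  shows "(\<Sum>p<dA * dB. \<Sum>q<dA * dB. amp dA Y $$ (p, q) * (f p q :: complex))
    = (\<Sum>b<dB. \<Sum>b'<dB. Y $$ (b, b') * (\<Sum>i<dA. f (i * dB + b) (i * dB + b')))"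
proof -
  have "(\<Sum>p<dA * dB. \<Sum>q<dA * dB. amp dA Y $$ (p, q) * f p q)
    = (\<Sum>i<dA. \<Sum>b<dB. \<Sum>j<dA. if j = i then \<Sum>b'<dB. Y $$ (b, b') * f (i * dB + b) (i * dB + b') else 0)"
    unfolding sum_idx
    by (intro sum.cong refl) (auto simp: kron_index[OF one_carrier_mat assms] intro!: sum.cong)
  also have "... = (\<Sum>i<dA. \<Sum>b<dB. \<Sum>b'<dB. Y $$ (b, b') * f (i * dB + b) (i * dB + b'))"
    by (rule sum.cong[OF refl], rule sum.cong[OF refl]) simp
  also have "... = (\<Sum>b<dB. \<Sum>i<dA. \<Sum>b'<dB. Y $$ (b, b') * f (i * dB + b) (i * dB + b'))"
    by (rule sum.swap)
  also have "... = (\<Sum>b<dB. \<Sum>b'<dB. \<Sum>i<dA. Y $$ (b, b') * f (i * dB + b) (i * dB + b'))"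
    by (intro sum.cong refl sum.swap)
  finally show ?thesis by (simp add: sum_distrib_left)
qed

lemma qform_hermitian_real:
  assumes "hermitian_op d X"
  shows "Im (qform d X v) = 0"
proof -
  have her: "\<And>i j. i < d \<Longrightarrow> j < d \<Longrightarrow> cnj (X $$ (i, j)) = X $$ (j, i)"
    using assms unfolding hermitian_op_iff by metis
  have "cnj (qform d X v) = (\<Sum>i<d. \<Sum>j<d. cnj (v j) * X $$ (j, i) * v i)"
    by (simp add: qform_def her mult_ac)
  also have "... = qform d X v" unfolding qform_def by (rule sum.swap)
  finally show ?thesis by (simp add: complex_eq_iff)
qed

lemma hermitian_kron_one:
  assumes "hermitian_op dB Y"
  shows "hermitian_op (dA * dB) (amp dA Y)"
proof -
  have Y: "Y \<in> ops dB" and her: "\<And>i j. i < dB \<Longrightarrow> j < dB \<Longrightarrow> Y $$ (j, i) = cnj (Y $$ (i, j))"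
    using assms unfolding hermitian_op_iff by blast+
  have C: "amp dA Y \<in> ops (dA * dB)"
    by (rule kron_carrier[OF one_carrier_mat Y])
  have "amp dA Y $$ (q, p) = cnj (amp dA Y $$ (p, q))" if "p < dA * dB" "q < dA * dB" for p q
    using that Y her[OF mod_less_idx[OF that(1)] mod_less_idx[OF that(2)]]
    by (simp add: kron_def div_less_idx mod_less_idx)
  then show ?thesis using C unfolding hermitian_op_iff by blast
qed

lemma hermitian_diff:
  assumes "hermitian_op d X" "hermitian_op d Y"
  shows "hermitian_op d (X - Y)"
proof -
  have X: "X \<in> ops d" and Y: "Y \<in> ops d" using assms by (auto simp: hermitian_op_def)
  have "(X - Y) $$ (j, i) = cnj ((X - Y) $$ (i, j))" if "i < d" "j < d" for i j
  proof -
    have "X $$ (j, i) = cnj (X $$ (i, j))" "Y $$ (j, i) = cnj (Y $$ (i, j))"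
      using assms that unfolding hermitian_op_iff by blast+
    then show ?thesis using X Y that by simp
  qed
  then show ?thesis using X Y unfolding hermitian_op_iff by auto
qed

lemma psd_hermitian: "psd d X \<Longrightarrow> hermitian_op d X"
  by (simp add: psd_def)

lemma psd_scaled_one:
  assumes "0 \<le> (c::real)"
  shows "psd d (mat d d (\<lambda>(p, q). if p = q then of_real c else 0))"
proof -
  have "qform d (mat d d (\<lambda>(p, q). if p = q then of_real c else 0)) v = of_real (\<Sum>i<d. c * (cmod (v i))\<^sup>2)" for v
  proof -
    have "qform d (mat d d (\<lambda>(p, q). if p = q then of_real c else 0)) v
      = (\<Sum>i<d. \<Sum>j<d. if j = i then of_real c * (v i * cnj (v i)) else 0)"
      unfolding qform_def by (intro sum.cong refl) auto
    also have "... = (\<Sum>i<d. of_real c * (v i * cnj (v i)))"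
      by (intro sum.cong refl) auto
    finally show ?thesis by (simp only: complex_norm_square[symmetric] of_real_sum of_real_mult)
  qed
  moreover have "0 \<le> (\<Sum>i<d. c * (cmod (v i))\<^sup>2)" for v :: "nat \<Rightarrow> complex"
    using assms by (intro sum_nonneg) simp
  ultimately show ?thesis by (simp add: psd_iff complex_nonneg_iff)
qed

text \<open>Matrices become functions on pairs of naturals with the product topology, so compactness
  is Tychonoff's theorem.\<close>

lemma compact_box: "compact {f :: 'a \<Rightarrow> complex. \<forall>p. f p \<in> cball 0 T}"
proof -
  have "compactin (product_topology (\<lambda>_. euclidean) UNIV) (PiE UNIV (\<lambda>_::'a. cball 0 T :: complex set))"
    by (simp add: compactin_PiE)
  then have "compact (PiE UNIV (\<lambda>_::'a. cball 0 T :: complex set))"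
    by (simp add: euclidean_product_topology)
  also have "PiE UNIV (\<lambda>_::'a. cball 0 T :: complex set) = {f. \<forall>p. f p \<in> cball 0 T}"
    by (auto simp: PiE_def Pi_def)
  finally show ?thesis .
qed

text \<open>Coordinates outside the n x n corner are confined to the disc as well, since compactness
  requires a bound on each of them. Inside the corner the trace bound implies it, by
  \<open>psd_entry_le_trace\<close>.\<close>

definition psd_ball :: "nat \<Rightarrow> real \<Rightarrow> (nat \<times> nat \<Rightarrow> complex) set" where
  "psd_ball n T = {f. (\<forall>p. f p \<in> cball 0 T) \<and> psd n (mat n n f) \<and> Re (\<Sum>i<n. f (i, i)) \<le> T}"

lemma mtrace_mat: "mtrace (mat n n f) = (\<Sum>i<n. f (i, i))"
  by (simp add: mtrace_def)

lemma qform_mat: "qform n (mat n n f) v = (\<Sum>i<n. \<Sum>j<n. cnj (v i) * f (i, j) * v j)"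
  by (simp add: qform_def)

lemma continuous_on_coord: "continuous_on S (\<lambda>f :: 'a \<Rightarrow> complex. f p)"
  by (rule continuous_on_subset[OF continuous_on_product_coordinates]) simp

lemma compact_psd_ball: "compact (psd_ball n T)"
proof -
  let ?D = "(\<Inter>v. {f. 0 \<le> Re (\<Sum>i<n. \<Sum>j<n. cnj (v i) * f (i, j) * v j)} \<inter>
        {f. Im (\<Sum>i<n. \<Sum>j<n. cnj (v i) * f (i, j) * v j) = 0}) \<inter> {f. Re (\<Sum>i<n. f (i, i)) \<le> T}"
  have eq: "psd_ball n T = {f. \<forall>p. f p \<in> cball 0 T} \<inter> ?D"
    unfolding psd_ball_def psd_iff qform_mat complex_nonneg_iff by auto
  have "closed ?D"
    by (intro closed_Int closed_INT ballI closed_Collect_le closed_Collect_eq continuous_intros continuous_on_coord)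
  then show ?thesis unfolding eq by (rule compact_Int_closed[OF compact_box])
qed

lemma cmod_add_scaled:
  "(cmod (x + of_real s * y))\<^sup>2 = (cmod x)\<^sup>2 + s * (2 * Re (cnj x * y)) + s\<^sup>2 * (cmod y)\<^sup>2"
  unfolding cmod_power2 by (simp add: power2_eq_square algebra_simps)

text \<open>First-order condition at the endpoint of an interval: if A were negative, a step with t
  (|B| + 1) at most -A/2 would let the linear term win.\<close>

lemma first_order_nonneg:
  fixes A B t0 :: real
  assumes "0 < t0" "\<And>t. 0 < t \<Longrightarrow> t \<le> t0 \<Longrightarrow> 0 \<le> t * A + t\<^sup>2 * B"
  shows "0 \<le> A"
proof (rule ccontr)
  assume "\<not> 0 \<le> A"
  define t where "t = min t0 (- A / (2 * (\<bar>B\<bar> + 1)))"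
  have t: "0 < t" "t \<le> t0" using assms(1) \<open>\<not> 0 \<le> A\<close> by (auto simp: t_def field_simps)
  have "t * (\<bar>B\<bar> + 1) \<le> - A / (2 * (\<bar>B\<bar> + 1)) * (\<bar>B\<bar> + 1)"
    by (intro mult_right_mono) (auto simp: t_def)
  also have "... = - A / 2" by (simp add: field_simps)
  finally have 1: "t * (\<bar>B\<bar> + 1) \<le> - A / 2" .
  have "t * B \<le> t * (\<bar>B\<bar> + 1)" using t by (intro mult_left_mono) auto
  then have "A + t * B < 0" using 1 \<open>\<not> 0 \<le> A\<close> by linarith
  then have "t * (A + t * B) < 0" using t by (simp add: mult_pos_neg)
  then show False using assms(2)[OF t] by (simp add: power2_eq_square algebra_simps)
qed

text \<open>The dual operator is the gradient of a quadratic penalty for the trace condition, taken at a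
  minimiser of the penalised functional over positive operators; a compactness argument controls the
  size of the violation of the trace condition.\<close>

theorem channel_strong_duality:
  assumes K: "hermitian_op (dA * dB) K" and dA: "0 < dA"
  shows "\<exists>C. channel dB dA C \<and> (\<forall>\<delta>>0. \<exists>Y. hermitian_op dB Y \<and> psd (dA * dB) (K - amp dA Y) \<and>
    Re (pairing dA dB C K) - \<delta> \<le> Re (mtrace Y))"
proof -
  define n where "n = dA * dB"
  \<comment> \<open>The operator of a channel has trace d_B. The extra 1 leaves room for positive
    perturbations of the later minimiser \<open>h\<close>, whose trace stays below d_B +
    1/2.\<close>
  define T where "T = real dB + 1"
  define S where "S = psd_ball n T"
  define e where "e b b' = (if b = b' then 1 else 0 :: complex)" for b b' :: nat
  \<comment> \<open>\<open>R\<close> is the partial trace over A, so \<open>G\<close> below measures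
    the violation of the trace condition, and \<open>L\<close> is the functional to be minimised
    subject to G = 0.\<close>
  define R where "R f b b' = (\<Sum>i<dA. f (i * dB + b, i * dB + b'))" for f :: "nat \<times> nat \<Rightarrow> complex" and b b'
  define G where "G f = (\<Sum>b<dB. \<Sum>b'<dB. (cmod (R f b b' - e b b'))\<^sup>2)" for f
  define L where "L f = Re (\<Sum>p<n. \<Sum>q<n. K $$ (p, q) * f (p, q))" for f
  have contL: "continuous_on X L" for X
    unfolding L_def by (intro continuous_intros continuous_on_coord)
  have contG: "continuous_on X G" for X
    unfolding G_def R_def by (intro continuous_intros continuous_on_coord)
  have contT: "continuous_on X (\<lambda>f. Re (\<Sum>i<n. f (i, i)))" for X
    by (intro continuous_intros continuous_on_coord)
  have compS: "compact S" unfolding S_def by (rule compact_psd_ball)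
  have G0: "0 \<le> G f" for f unfolding G_def by (intro sum_nonneg) simp
  have Gz: "R f b b' = e b b'" if "G f = 0" "b < dB" "b' < dB" for f b b'
  proof -
    have "(\<Sum>b'<dB. (cmod (R f b b' - e b b'))\<^sup>2) = 0"
      using that sum_nonneg_eq_0_iff[of "{..<dB}" "\<lambda>b. \<Sum>b'<dB. (cmod (R f b b' - e b b'))\<^sup>2"]
      by (simp add: G_def sum_nonneg)
    then have "(cmod (R f b b' - e b b'))\<^sup>2 = 0"
      using that sum_nonneg_eq_0_iff[of "{..<dB}" "\<lambda>b'. (cmod (R f b b' - e b b'))\<^sup>2"] by simp
    then show ?thesis by simp
  qed
  have trR: "(\<Sum>i<n. f (i, i)) = (\<Sum>b<dB. R f b b)" for f
    unfolding n_def sum_idx R_def by (rule sum.swap)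
  \<comment> \<open>The completely depolarising channel, showing that the constraints can be
    met.\<close>
  define f0 where "f0 = (\<lambda>(p, q). if p = q \<and> p < n then of_real (1 / real dA) else 0 :: complex)"
  have R0: "R f0 b b' = e b b'" if "b < dB" "b' < dB" for b b'
    using that dA by (simp add: R_def f0_def e_def n_def idx_less)
  have f0S: "f0 \<in> S"
  proof -
    have "mat n n f0 = mat n n (\<lambda>(p, q). if p = q then of_real (1 / real dA) else 0)"
      by (intro cong_mat) (auto simp: f0_def)
    then have "psd n (mat n n f0)" using psd_scaled_one[of "1 / real dA" n] by simp
    moreover have "Re (\<Sum>i<n. f0 (i, i)) \<le> T"
      unfolding trR by (simp add: R0 e_def T_def)
    moreover have "f0 p \<in> cball 0 T" for p
    proof -
      have "1 / real dA \<le> 1" using dA by simp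
      then have "1 / real dA \<le> T" by (simp add: T_def)
      moreover have "0 \<le> T" by (simp add: T_def)
      ultimately show ?thesis by (auto simp: f0_def norm_divide split: prod.splits)
    qed
    ultimately show ?thesis by (simp add: S_def psd_ball_def)
  qed
  have "compact (S \<inter> {f. G f = 0})"
    by (intro compact_Int_closed[OF compS] closed_Collect_eq contG continuous_on_const)
  moreover have "f0 \<in> S \<inter> {f. G f = 0}" using f0S by (simp add: G_def R0)
  ultimately obtain f1 where f1: "f1 \<in> S" "G f1 = 0" and min1: "\<And>f. f \<in> S \<Longrightarrow> G f = 0 \<Longrightarrow> L f1 \<le> L f"
    using continuous_attains_inf[of "S \<inter> {f. G f = 0}" L] contL by blast
  define C where "C = omap dA dB (mat n n f1)"
  have psdS: "psd n (mat n n f)" if "f \<in> S" for f using that by (simp add: S_def psd_ball_def)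
  have "channel dB dA C"
    unfolding C_def
  proof (rule channel_omap)
    show "psd (dA * dB) (mat n n f1)" using psdS[OF f1(1)] by (simp add: n_def)
    show "(\<Sum>i<dA. mat n n f1 $$ (i * dB + b, i * dB + b')) = (if b = b' then 1 else 0)" if "b < dB" "b' < dB" for b b'
      using Gz[OF f1(2) that] that by (simp add: n_def idx_less R_def e_def)
  qed
  moreover have CL: "Re (pairing dA dB C K) = L f1"
    unfolding C_def pairing_omap by (simp add: L_def n_def)
  moreover have "\<exists>Y. hermitian_op dB Y \<and> psd (dA * dB) (K - amp dA Y) \<and> L f1 - \<delta> \<le> Re (mtrace Y)"
    if \<delta>: "0 < \<delta>" for \<delta>
  proof -
    \<comment> \<open>Points whose value is too low by \<delta> or whose trace is close to the
      limit. None of them satisfies the trace condition, so compactness keeps \<open>G\<close> above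
      some g > 0 on this set.\<close>
    define Bad where "Bad = S \<inter> ({f. L f \<le> L f1 - \<delta>} \<union> {f. real dB + 1/2 \<le> Re (\<Sum>i<n. f (i, i))})"
    have "compact Bad" unfolding Bad_def
      by (intro compact_Int_closed[OF compS] closed_Un closed_Collect_le contL contT continuous_on_const)
    moreover have posB: "0 < G f" if "f \<in> Bad" for f
    proof (rule ccontr)
      assume "\<not> 0 < G f"
      then have "G f = 0" using G0[of f] by simp
      from this have "(\<Sum>i<n. f (i, i)) = of_nat dB" by (simp add: trR Gz e_def)
      then have "Re (\<Sum>i<n. f (i, i)) = real dB" by (simp only: complex_Re_of_nat)
      then show False using \<open>G f = 0\<close> that min1[of f] \<delta> by (auto simp: Bad_def simp del: Re_sum)
    qed
    ultimately have "\<exists>g>0. \<forall>f\<in>Bad. g \<le> G f"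
    proof (cases "Bad = {}")
      case False
      then obtain f where "f \<in> Bad" "\<forall>h\<in>Bad. G f \<le> G h"
        using continuous_attains_inf[OF \<open>compact Bad\<close>, of G] contG by blast
      then show ?thesis using posB by blast
    qed (auto intro: exI[of _ 1])
    then obtain g where g: "0 < g" "\<And>f. f \<in> Bad \<Longrightarrow> g \<le> G f" by blast
    obtain f2 where f2: "f2 \<in> S" "\<And>f. f \<in> S \<Longrightarrow> L f2 \<le> L f"
      using continuous_attains_inf[OF compS, of L] contL f0S by blast
    \<comment> \<open>With this weight the penalised value on \<open>Bad\<close> is at least L f2 +
      k g = L f1 + 1, which exceeds its value at \<open>f1\<close>; hence no minimiser lies in
      \<open>Bad\<close>.\<close>
    define k where "k = (L f1 - L f2 + 1) / g"
    have k: "0 < k" "k * g = L f1 - L f2 + 1" using g(1) f2(2)[OF f1(1)] by (auto simp: k_def)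
    define F where "F f = L f + k * G f" for f
    have "continuous_on S F" unfolding F_def by (intro continuous_intros contL contG)
    then obtain h where h: "h \<in> S" and minh: "\<And>f. f \<in> S \<Longrightarrow> F h \<le> F f"
      using continuous_attains_inf[OF compS, of F] f0S by blast
    have Fh: "F h \<le> L f1" using minh[OF f1(1)] f1(2) by (simp add: F_def)
    have "h \<notin> Bad"
    proof
      assume "h \<in> Bad"
      then have "k * g \<le> k * G h" using k g by (intro mult_left_mono) auto
      then show False using Fh k f2(2)[OF h] by (simp add: F_def)
    qed
    then have Lh: "L f1 - \<delta> < L h" and trh: "Re (\<Sum>i<n. h (i, i)) < real dB + 1/2"
      using h by (auto simp: Bad_def)
    \<comment> \<open>Minus the gradient of k G at \<open>h\<close>; the conjugate appears because
      the pairings are bilinear.\<close>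
    define Y where "Y = mat dB dB (\<lambda>(b, b'). of_real (2 * k) * (e b b' - cnj (R h b b')))"
    have Yc: "Y \<in> ops dB" by (simp add: Y_def)
    have hher: "h (q, p) = cnj (h (p, q))" if "p < n" "q < n" for p q
      using psd_cnj[OF psdS[OF h] that] that by simp
    have Rher: "R h b' b = cnj (R h b b')" if "b < dB" "b' < dB" for b b'
      unfolding R_def cnj_sum using that by (intro sum.cong refl hher) (simp_all add: n_def idx_less)
    have Yher: "hermitian_op dB Y"
      unfolding hermitian_op_iff
    proof (intro conjI allI impI Yc)
      fix b b' assume "b < dB" "b' < dB"
      then show "Y $$ (b', b) = cnj (Y $$ (b, b'))"
        using Rher[of b b'] by (simp add: Y_def e_def)
    qed
    \<comment> \<open>The derivative of \<open>F\<close> at \<open>h\<close> in direction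
      \<open>u\<close>. As \<open>F\<close> is quadratic, k times \<open>G2\<close> is the exact
      second-order term.\<close>
    define A where "A u = Re (\<Sum>p<n. \<Sum>q<n. K $$ (p, q) * u (p, q)) - Re (\<Sum>b<dB. \<Sum>b'<dB. Y $$ (b, b') * R u b b')" for u
    define G2 where "G2 u = (\<Sum>b<dB. \<Sum>b'<dB. (cmod (R u b b'))\<^sup>2)" for u
    have expand: "F (\<lambda>p. h p + of_real s * u p) = F h + s * A u + s\<^sup>2 * (k * G2 u)" for s u
    proof -
      have Rs: "R (\<lambda>p. h p + of_real s * u p) b b' = R h b b' + of_real s * R u b b'" for b b'
        by (simp add: R_def sum.distrib sum_distrib_left)
      have Ls: "L (\<lambda>p. h p + of_real s * u p) = L h + s * Re (\<Sum>p<n. \<Sum>q<n. K $$ (p, q) * u (p, q))"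
      proof -
        have "(\<Sum>p<n. \<Sum>q<n. K $$ (p, q) * (h (p, q) + of_real s * u (p, q)))
          = (\<Sum>p<n. \<Sum>q<n. K $$ (p, q) * h (p, q)) + of_real s * (\<Sum>p<n. \<Sum>q<n. K $$ (p, q) * u (p, q))"
          by (simp add: algebra_simps sum.distrib sum_distrib_left)
        then show ?thesis by (simp only: L_def plus_complex.simps Re_complex_of_real times_complex.simps Im_complex_of_real)
      qed
      have "G (\<lambda>p. h p + of_real s * u p) = (\<Sum>b<dB. \<Sum>b'<dB. (cmod ((R h b b' - e b b') + of_real s * R u b b'))\<^sup>2)"
        unfolding G_def Rs by (simp add: algebra_simps)
      also have "... = G h + s * (\<Sum>b<dB. \<Sum>b'<dB. 2 * Re (cnj (R h b b' - e b b') * R u b b')) + s\<^sup>2 * G2 u"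
        unfolding cmod_add_scaled G_def G2_def by (simp only: sum.distrib sum_distrib_left)
      finally have Gs: "G (\<lambda>p. h p + of_real s * u p)
        = G h + s * (\<Sum>b<dB. \<Sum>b'<dB. 2 * Re (cnj (R h b b' - e b b') * R u b b')) + s\<^sup>2 * G2 u" .
      have "Re (\<Sum>b<dB. \<Sum>b'<dB. Y $$ (b, b') * R u b b')
        = (\<Sum>b<dB. \<Sum>b'<dB. - (k * (2 * Re (cnj (R h b b' - e b b') * R u b b'))))"
        unfolding Re_sum by (intro sum.cong refl) (simp add: Y_def e_def algebra_simps)
      also have "... = - (k * (\<Sum>b<dB. \<Sum>b'<dB. 2 * Re (cnj (R h b b' - e b b') * R u b b')))"
        by (simp only: sum_negf sum_distrib_left)
      finally show ?thesis unfolding F_def Ls Gs A_def by (simp add: algebra_simps)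
    qed
    \<comment> \<open>Positive directions are admissible for steps up to \<open>t0\<close>, which
      raise the trace by at most 1/2.\<close>
    have A_nonneg: "0 \<le> A (\<lambda>pq. W $$ pq)" if W: "psd n W" for W
    proof -
      define u where "u = (\<lambda>(p, q). if p < n \<and> q < n then W $$ (p, q) else 0)"
      have Wc: "W \<in> ops n" by (rule psd_carrier[OF W])
      have trW: "0 \<le> Re (mtrace W)"
        using psd_diag(2)[OF W] carrier_matD[OF Wc] by (auto simp: mtrace_def intro!: sum_nonneg)
      define t0 where "t0 = 1 / (2 * (Re (mtrace W) + 1))"
      have "0 \<le> A u"
      proof (rule first_order_nonneg[of t0 _ "k * G2 u"])
        show "0 < t0" using trW by (simp add: t0_def)
        fix t assume t: "0 < t" "t \<le> t0"
        let ?h = "\<lambda>p. h p + of_real t * u p"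
        have m: "mat n n ?h = mat n n h + of_real t \<cdot>\<^sub>m W"
          using Wc by (intro eq_matI) (auto simp: u_def)
        have P: "psd n (mat n n ?h)" unfolding m using t W psdS[OF h] by (intro psd_add psd_smult) auto
        have "t * Re (mtrace W) \<le> t0 * (Re (mtrace W) + 1)" using t trW by (intro mult_mono) auto
        also have "... = 1 / 2" using trW by (simp add: t0_def field_simps)
        finally have "t * Re (mtrace W) \<le> 1/2" .
        moreover have "Re (\<Sum>i<n. ?h (i, i)) = Re (\<Sum>i<n. h (i, i)) + t * Re (mtrace W)"
          using carrier_matD[OF Wc] by (simp add: mtrace_def u_def sum.distrib sum_distrib_left)
        ultimately have tr: "Re (\<Sum>i<n. ?h (i, i)) \<le> T" using trh by (simp add: T_def)
        have "?h p \<in> cball 0 T" for p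
        proof (cases "fst p < n \<and> snd p < n")
          case True
          have "cmod (mat n n ?h $$ (fst p, snd p)) \<le> Re (mtrace (mat n n ?h))"
            using True by (intro psd_entry_le_trace[OF P]) auto
          then show ?thesis using tr True by (cases p) (simp add: mtrace_mat)
        next
          case False
          then have "u p = 0" by (auto simp: u_def split: prod.splits)
          then show ?thesis using h by (cases p) (simp add: S_def psd_ball_def)
        qed
        then have "?h \<in> S" using P tr by (simp add: S_def psd_ball_def)
        from minh[OF this] show "0 \<le> t * A u + t\<^sup>2 * (k * G2 u)" unfolding expand by simp
      qed
      also have "A u = A (\<lambda>pq. W $$ pq)"
        unfolding A_def R_def u_def by (simp add: n_def idx_less)
      finally show ?thesis .
    qed
    \<comment> \<open>Shrinking \<open>h\<close> towards zero stays in \<open>S\<close>, which gives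
      the opposite sign in the direction of \<open>h\<close> itself, as in complementary
      slackness.\<close>
    have A_h: "A h \<le> 0"
    proof -
      have "0 \<le> - A h"
      proof (rule first_order_nonneg[of 1 _ "k * G2 h"])
        fix t :: real assume t: "0 < t" "t \<le> 1"
        let ?h = "\<lambda>p. h p + of_real (- t) * h p"
        have e1: "?h p = of_real (1 - t) * h p" for p by (simp add: algebra_simps)
        have m: "mat n n ?h = of_real (1 - t) \<cdot>\<^sub>m mat n n h"
          by (intro eq_matI) (auto simp: algebra_simps)
        have P: "psd n (mat n n ?h)" unfolding m using t psdS[OF h] by (intro psd_smult) auto
        have "Re (\<Sum>i<n. ?h (i, i)) = (1 - t) * Re (\<Sum>i<n. h (i, i))"
          unfolding e1 sum_distrib_left[symmetric] by simp
        also have "... \<le> 1 * T"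
          using t h psd_diag(2)[OF psdS[OF h]] by (intro mult_mono) (auto simp: S_def psd_ball_def T_def intro!: sum_nonneg)
        finally have tr: "Re (\<Sum>i<n. ?h (i, i)) \<le> T" by simp
        have "?h p \<in> cball 0 T" for p
        proof -
          have "cmod (h p) \<le> T" using h by (cases p) (simp add: S_def psd_ball_def)
          then have "(1 - t) * cmod (h p) \<le> 1 * T" using t by (intro mult_mono) auto
          moreover have "cmod (of_real (1 - t) * h p) = (1 - t) * cmod (h p)"
            using t by (simp only: norm_mult norm_of_real)
          ultimately show ?thesis unfolding e1 mem_cball_0 by simp
        qed
        then have "?h \<in> S" using P tr by (simp add: S_def psd_ball_def)
        from minh[OF this] show "0 \<le> t * - A h + t\<^sup>2 * (k * G2 h)" unfolding expand by simp
      qed simp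
      then show ?thesis by simp
    qed
    let ?Z = "K - amp dA Y"
    have Kc: "K \<in> ops n" using K by (simp add: hermitian_op_def n_def)
    have kc: "amp dA Y \<in> ops n"
      unfolding n_def by (rule kron_carrier[OF one_carrier_mat Yc])
    have Zher: "hermitian_op n ?Z"
      using hermitian_diff[OF K hermitian_kron_one[OF Yher]] by (simp add: n_def)
    have AZ: "A u = Re (\<Sum>p<n. \<Sum>q<n. ?Z $$ (p, q) * u (p, q))" for u
    proof -
      have "(\<Sum>p<n. \<Sum>q<n. ?Z $$ (p, q) * u (p, q))
        = (\<Sum>p<n. \<Sum>q<n. K $$ (p, q) * u (p, q)) - (\<Sum>p<n. \<Sum>q<n. amp dA Y $$ (p, q) * u (p, q))"
        using Kc kc by (simp add: algebra_simps sum_subtractf)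
      also have "(\<Sum>p<n. \<Sum>q<n. amp dA Y $$ (p, q) * u (p, q)) = (\<Sum>b<dB. \<Sum>b'<dB. Y $$ (b, b') * R u b b')"
        unfolding n_def R_def using sum_kron_one[OF Yc, of dA "\<lambda>p q. u (p, q)"] by simp
      finally show ?thesis by (simp add: A_def)
    qed
    have "0 \<le> qform n ?Z v" for v
    proof -
      \<comment> \<open>\<open>AZ\<close> is bilinear, so the conjugate of |v><v| is the direction
        that produces the quadratic form at \<open>v\<close>.\<close>
      have "psd n (mat n n (\<lambda>(p, q). cnj (v p) * cnj (cnj (v q))))"
        by (rule psd_rank_one)
      from A_nonneg[OF this] have "0 \<le> Re (\<Sum>p<n. \<Sum>q<n. ?Z $$ (p, q) * (cnj (v p) * v q))"
        unfolding AZ by simp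
      also have "(\<Sum>p<n. \<Sum>q<n. ?Z $$ (p, q) * (cnj (v p) * v q)) = qform n ?Z v"
        unfolding qform_def by (intro sum.cong refl) (simp only: mult_ac)
      finally show ?thesis using qform_hermitian_real[OF Zher] by (simp add: complex_nonneg_iff)
    qed
    then have "psd (dA * dB) ?Z" using minus_carrier_mat[OF kc, of K] by (simp add: psd_iff n_def)
    moreover have "L h \<le> Re (mtrace Y)"
    proof -
      \<comment> \<open>The difference is twice the penalty k G at \<open>h\<close>, hence
        nonnegative; together with A h \<le> 0 it bounds L h by tr Y.\<close>
      have "Re (mtrace Y) - Re (\<Sum>b<dB. \<Sum>b'<dB. Y $$ (b, b') * R h b b')
        = Re (\<Sum>b<dB. \<Sum>b'<dB. Y $$ (b, b') * (e b b' - R h b b'))"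
      proof -
        have "mtrace Y = (\<Sum>b<dB. \<Sum>b'<dB. Y $$ (b, b') * e b b')"
        proof -
          have "(\<Sum>b<dB. \<Sum>b'<dB. Y $$ (b, b') * e b b') = (\<Sum>b<dB. \<Sum>b'<dB. if b' = b then Y $$ (b, b) else 0)"
            by (intro sum.cong refl) (auto simp: e_def)
          then show ?thesis using carrier_matD[OF Yc] by (simp add: mtrace_def)
        qed
        then show ?thesis by (simp add: algebra_simps sum_subtractf)
      qed
      also have "... = (\<Sum>b<dB. \<Sum>b'<dB. 2 * k * (cmod (e b b' - R h b b'))\<^sup>2)"
        unfolding Re_sum
      proof (intro sum.cong refl)
        fix b b' assume "b \<in> {..<dB}" "b' \<in> {..<dB}"
        then have "Y $$ (b, b') * (e b b' - R h b b') = of_real (2 * k) * ((e b b' - R h b b') * cnj (e b b' - R h b b'))"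
          by (simp add: Y_def e_def)
        then show "Re (Y $$ (b, b') * (e b b' - R h b b')) = 2 * k * (cmod (e b b' - R h b b'))\<^sup>2"
          by (simp only: complex_norm_square[symmetric] of_real_mult[symmetric] Re_complex_of_real)
      qed
      also have "... \<ge> 0" using k by (intro sum_nonneg) simp
      finally show ?thesis using A_h by (simp add: A_def L_def)
    qed
    ultimately show ?thesis using Yher Lh by (intro exI[of _ Y]) auto
  qed
  ultimately show ?thesis by (intro exI[of _ C]) (simp only: CL, blast)
qed

section \<open>The optimal error probability\<close>

definition fid :: "nat \<Rightarrow> nat \<Rightarrow> opmap \<Rightarrow> opmap \<Rightarrow> real" where
  "fid dA dB N C = Re (pairing dA dB C (choiU dA dB N))"

text \<open>Up to the factor \<open>d\<^sub>A\<^sup>2\<close>, the extreme postselection probabilities of a loop closed by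
  a channel.\<close>

definition fid_min :: "nat \<Rightarrow> nat \<Rightarrow> opmap \<Rightarrow> real" where
  "fid_min dA dB N = (INF C\<in>{C. channel dB dA C}. fid dA dB N C)"

definition fid_max :: "nat \<Rightarrow> nat \<Rightarrow> opmap \<Rightarrow> real" where
  "fid_max dA dB N = (SUP C\<in>{C. channel dB dA C}. fid dA dB N C)"

lemma fid_nonneg: "cp_map dA dB N \<Longrightarrow> cp_map dB dA C \<Longrightarrow> 0 \<le> fid dA dB N C"
  using pairing_nonneg[OF _ cp_choiU] by (simp add: fid_def complex_nonneg_iff)

text \<open>Weak duality: a completely positive map pairs nonnegatively with a positive difference,
  and 1 (x) Y contributes the trace of C Y.\<close>

lemma psd_kron_one_diff_pairing:
  assumes C: "cp_map dB dA C" and K: "K \<in> ops (dA * dB)" and Y: "Y \<in> ops dB"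
  shows "psd (dA * dB) (K - amp dA Y) \<Longrightarrow> Re (mtrace (C Y)) \<le> Re (pairing dA dB C K)"
    and "psd (dA * dB) (amp dA Y - K) \<Longrightarrow> Re (pairing dA dB C K) \<le> Re (mtrace (C Y))"
proof -
  note k = kron_carrier[OF one_carrier_mat[of dA] Y] and lin = cp_linear[OF C]
  show "Re (mtrace (C Y)) \<le> Re (pairing dA dB C K)" if "psd (dA * dB) (K - amp dA Y)"
    using pairing_nonneg[OF C that] pairing_diff[OF lin K k] pairing_kron_one[OF lin Y]
    by (simp add: complex_nonneg_iff)
  show "Re (pairing dA dB C K) \<le> Re (mtrace (C Y))" if "psd (dA * dB) (amp dA Y - K)"
    using pairing_nonneg[OF C that] pairing_diff[OF lin k K] pairing_kron_one[OF lin Y]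
    by (simp add: complex_nonneg_iff)
qed

lemma hermitian_carrier: "hermitian_op d X \<Longrightarrow> X \<in> ops d"
  by (simp add: hermitian_op_def)

text \<open>The minimum is attained by the channel that strong duality provides; its optimality
  among all channels follows from weak duality by letting \<delta> tend to 0.\<close>

lemma fid_min_duality:
  assumes N: "cp_map dA dB N" and dA: "0 < dA"
  shows "\<exists>C. channel dB dA C \<and> fid dA dB N C = fid_min dA dB N"
    and "\<And>C. channel dB dA C \<Longrightarrow> fid_min dA dB N \<le> fid dA dB N C"
    and "\<And>\<delta>. 0 < \<delta> \<Longrightarrow> \<exists>Y. hermitian_op dB Y \<and> psd (dA * dB) (choiU dA dB N - amp dA Y) \<and>
      fid_min dA dB N - \<delta> \<le> Re (mtrace Y)"
proof -
  let ?J = "choiU dA dB N"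
  obtain C where C: "channel dB dA C" and Y: "\<And>\<delta>. 0 < \<delta> \<Longrightarrow> \<exists>Y. hermitian_op dB Y \<and> psd (dA * dB) (?J - amp dA Y) \<and>
      fid dA dB N C - \<delta> \<le> Re (mtrace Y)"
    unfolding fid_def using channel_strong_duality[OF psd_hermitian[OF cp_choiU[OF N]] dA] by blast
  have le: "fid dA dB N C \<le> fid dA dB N C'" if C': "channel dB dA C'" for C'
  proof (rule field_le_epsilon)
    fix \<delta> :: real assume "0 < \<delta>"
    then obtain Y where "hermitian_op dB Y" "psd (dA * dB) (?J - amp dA Y)"
      "fid dA dB N C - \<delta> \<le> Re (mtrace Y)" using Y by blast
    moreover from this have "Re (mtrace (C' Y)) \<le> fid dA dB N C'"
      unfolding fid_def
      by (intro psd_kron_one_diff_pairing(1)[OF channel_cp[OF C'] choiU_carrier]) (auto simp: hermitian_carrier)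
    ultimately show "fid dA dB N C \<le> fid dA dB N C' + \<delta>"
      using channel_mtrace[OF C'] by (simp add: hermitian_carrier)
  qed
  have eq: "fid_min dA dB N = fid dA dB N C"
    unfolding fid_min_def using C le by (intro cInf_eq_minimum) auto
  show "\<exists>C. channel dB dA C \<and> fid dA dB N C = fid_min dA dB N" using C eq by auto
  show "\<And>C. channel dB dA C \<Longrightarrow> fid_min dA dB N \<le> fid dA dB N C" using le eq by simp
  show "\<And>\<delta>. 0 < \<delta> \<Longrightarrow> \<exists>Y. hermitian_op dB Y \<and> psd (dA * dB) (?J - amp dA Y) \<and>
      fid_min dA dB N - \<delta> \<le> Re (mtrace Y)" using Y eq by simp
qed

text \<open>Duality for the minimum is applied to -J, where J is the Choi operator, with S =
  -Y.\<close>

lemma fid_max_duality: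
  assumes N: "cp_map dA dB N" and dA: "0 < dA"
  shows "\<exists>C. channel dB dA C \<and> fid dA dB N C = fid_max dA dB N"
    and "\<And>C. channel dB dA C \<Longrightarrow> fid dA dB N C \<le> fid_max dA dB N"
    and "\<And>\<delta>. 0 < \<delta> \<Longrightarrow> \<exists>S. psd dB S \<and> psd (dA * dB) (amp dA S - choiU dA dB N) \<and>
      Re (mtrace S) \<le> fid_max dA dB N + \<delta>"
proof -
  let ?J = "choiU dA dB N"
  let ?Z = "0\<^sub>m (dA * dB) (dA * dB) :: complex mat"
  have J: "psd (dA * dB) ?J" by (rule cp_choiU[OF N])
  have "hermitian_op (dA * dB) ?Z" by (simp add: hermitian_op_iff)
  then have her: "hermitian_op (dA * dB) (?Z - ?J)" using hermitian_diff psd_hermitian[OF J] by blast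
  have pm: "Re (pairing dA dB C (?Z - ?J)) = - fid dA dB N C" if "channel dB dA C" for C
  proof -
    note lin = channel_linear[OF that]
    have "?Z = ?J - ?J" by (intro eq_matI) auto
    then have "pairing dA dB C ?Z = 0" using pairing_diff[OF lin choiU_carrier choiU_carrier, of N N] by simp
    then show ?thesis using pairing_diff[OF lin zero_carrier_mat choiU_carrier, of N] by (simp add: fid_def)
  qed
  obtain C where C: "channel dB dA C" and Y: "\<And>\<delta>. 0 < \<delta> \<Longrightarrow> \<exists>Y. hermitian_op dB Y \<and> psd (dA * dB) (?Z - ?J - amp dA Y) \<and>
      - fid dA dB N C - \<delta> \<le> Re (mtrace Y)"
    using channel_strong_duality[OF her dA] pm by fastforce
  have S: "\<exists>S. psd dB S \<and> psd (dA * dB) (amp dA S - ?J) \<and> Re (mtrace S) \<le> fid dA dB N C + \<delta>" if \<delta>: "0 < \<delta>" for \<delta>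
  proof -
    obtain Y where Y: "hermitian_op dB Y" "psd (dA * dB) (?Z - ?J - amp dA Y)"
      "- fid dA dB N C - \<delta> \<le> Re (mtrace Y)" using Y[OF \<delta>] by blast
    note Yc = hermitian_carrier[OF Y(1)]
    have kY: "amp dA (- Y) = - amp dA Y"
      using Yc by (intro eq_matI) (auto simp: kron_def mod_less_idx)
    have eq: "?Z - ?J - amp dA Y = amp dA (- Y) - ?J"
      unfolding kY using kron_carrier[OF one_carrier_mat[of dA] Yc] by (intro eq_matI) auto
    have 1: "psd (dA * dB) (amp dA (- Y) - ?J)" using Y(2) unfolding eq .
    \<comment> \<open>1 (x) S dominates the positive operator J, so it is positive, and so is its
      first diagonal block S. Positivity is what allows S to be normalised to a state and to be
      multiplied with other dual operators.\<close>
    have "amp dA (- Y) = (amp dA (- Y) - ?J) + ?J"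
      using kron_carrier[OF one_carrier_mat[of dA] uminus_carrier_mat[OF Yc]] by (intro eq_matI) auto
    then have "psd (dA * dB) (amp dA (- Y))" using psd_add[OF 1 J] by simp
    from psd_reindex[OF this, of dB "\<lambda>b. 0 * dB + b"]
    have "psd dB (mat dB dB (\<lambda>(b, b'). amp dA (- Y) $$ (0 * dB + b, 0 * dB + b')))"
      using dA idx_less[of 0 dA _ dB] by simp
    also have "mat dB dB (\<lambda>(b, b'). amp dA (- Y) $$ (0 * dB + b, 0 * dB + b')) = - Y"
    proof (rule eq_matI)
      fix b b' assume "b < dim_row (- Y)" "b' < dim_col (- Y)"
      then have bb: "b < dB" "b' < dB" using Yc by auto
      show "mat dB dB (\<lambda>(b, b'). amp dA (- Y) $$ (0 * dB + b, 0 * dB + b')) $$ (b, b') = (- Y) $$ (b, b')"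
        unfolding index_mat(1)[OF bb] split_conv
          kron_index[OF one_carrier_mat uminus_carrier_mat[OF Yc] dA dA bb] using dA by simp
    qed (use Yc in auto)
    finally have "psd dB (- Y)" .
    moreover have "Re (mtrace (- Y)) = - Re (mtrace Y)" using Yc by (simp add: mtrace_def sum_negf)
    ultimately show ?thesis using 1 Y(3) by (intro exI[of _ "- Y"]) auto
  qed
  have le: "fid dA dB N C' \<le> fid dA dB N C" if C': "channel dB dA C'" for C'
  proof (rule field_le_epsilon)
    fix \<delta> :: real assume "0 < \<delta>"
    then obtain S where "psd dB S" "psd (dA * dB) (amp dA S - ?J)"
      "Re (mtrace S) \<le> fid dA dB N C + \<delta>" using S by blast
    moreover from this have "fid dA dB N C' \<le> Re (mtrace (C' S))"
      unfolding fid_def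
      by (intro psd_kron_one_diff_pairing(2)[OF channel_cp[OF C'] choiU_carrier]) (auto simp: psd_carrier)
    ultimately show "fid dA dB N C' \<le> fid dA dB N C + \<delta>"
      using channel_mtrace[OF C'] by (simp add: psd_carrier)
  qed
  have eq: "fid_max dA dB N = fid dA dB N C"
    unfolding fid_max_def using C le by (intro cSup_eq_maximum) auto
  show "\<exists>C. channel dB dA C \<and> fid dA dB N C = fid_max dA dB N" using C eq by auto
  show "\<And>C. channel dB dA C \<Longrightarrow> fid dA dB N C \<le> fid_max dA dB N" using le eq by simp
  show "\<And>\<delta>. 0 < \<delta> \<Longrightarrow> \<exists>S. psd dB S \<and> psd (dA * dB) (amp dA S - ?J) \<and>
      Re (mtrace S) \<le> fid_max dA dB N + \<delta>" using S eq by simp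
qed

lemma fid_min_nonneg:
  assumes "cp_map dA dB N" "0 < dA"
  shows "0 \<le> fid_min dA dB N"
proof -
  obtain C where C: "channel dB dA C" "fid dA dB N C = fid_min dA dB N"
    using fid_min_duality(1)[OF assms] by blast
  show ?thesis using fid_nonneg[OF assms(1) channel_cp[OF C(1)]] C(2) by simp
qed

text \<open>The completely depolarising channel attains tr J / d_A, and a positive Choi operator J
  of trace zero would vanish together with \<open>N\<close>.\<close>

lemma fid_max_pos:
  assumes N: "cp_map dA dB N" and dA: "0 < dA" and nz: "\<exists>X\<in>ops dA. N X \<noteq> 0\<^sub>m dB dB"
  shows "0 < fid_max dA dB N"
proof -
  let ?n = "dA * dB" and ?J = "choiU dA dB N"
  define W where "W = mat ?n ?n (\<lambda>(p, q). if p = q then of_real (1 / real dA) else 0 :: complex)"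
  have W: "psd ?n W" unfolding W_def by (rule psd_scaled_one) simp
  have ch: "channel dB dA (omap dA dB W)"
  proof (rule channel_omap[OF W])
    fix b b' assume "b < dB" "b' < dB"
    then show "(\<Sum>i<dA. W $$ (i * dB + b, i * dB + b')) = (if b = b' then 1 else 0)"
      using dA by (simp add: W_def idx_less)
  qed
  have "pairing dA dB (omap dA dB W) ?J = (\<Sum>p<?n. \<Sum>q<?n. if q = p then ?J $$ (p, p) / of_nat dA else 0)"
    unfolding pairing_omap by (intro sum.cong refl) (auto simp: W_def)
  also have "... = (\<Sum>p<?n. ?J $$ (p, p) / of_nat dA)" by (intro sum.cong refl) auto
  also have "... = mtrace ?J / of_nat dA"
    using carrier_matD[OF choiU_carrier[of dA dB N]] by (simp add: mtrace_def sum_divide_distrib)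
  finally have f: "fid dA dB N (omap dA dB W) = Re (mtrace ?J) / real dA"
    by (simp add: fid_def Re_divide_of_nat)
  have "0 < Re (mtrace ?J)"
  proof (rule ccontr)
    assume "\<not> 0 < Re (mtrace ?J)"
    then have z: "?J $$ (p, q) = 0" if "p < ?n" "q < ?n" for p q
      using psd_entry_le_trace[OF cp_choiU[OF N] that] norm_ge_zero[of "?J $$ (p, q)"]
      by (metis dual_order.trans linorder_not_le norm_le_zero_iff)
    obtain X where X: "X \<in> ops dA" "N X \<noteq> 0\<^sub>m dB dB" using nz by blast
    have "N X = 0\<^sub>m dB dB"
    proof (rule eq_matI)
      fix i j assume ij: "i < dim_row (0\<^sub>m dB dB :: complex mat)" "j < dim_col (0\<^sub>m dB dB :: complex mat)"
      have "N (ketbra dA a a') $$ (i, j) = 0" if "a < dA" "a' < dA" for a a'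
        using z[of "a * dB + i" "a' * dB + j"] that ij by (simp add: idx_less choiU_index)
      then show "N X $$ (i, j) = 0\<^sub>m dB dB $$ (i, j)"
        using ij by (simp add: linear_expand[OF cp_linear[OF N] X(1)])
    qed (use carrier_matD[OF linear_carrier[OF cp_linear[OF N] X(1)]] in auto)
    then show False using X by simp
  qed
  then have "0 < fid dA dB N (omap dA dB W)" using dA by (simp add: f)
  then show ?thesis using fid_max_duality(2)[OF N dA ch] by linarith
qed

section \<open>Converse and achievability for a fixed map\<close>

lemma mtrace_ketbra_mult:
  assumes "G \<in> ops d" "m < d"
  shows "mtrace (ketbra d m m * G) = G $$ (m, m)"
proof -
  have "mtrace (ketbra d m m * G) = (\<Sum>i<d. \<Sum>k<d. ketbra d m m $$ (i, k) * G $$ (k, i))"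
    using assms carrier_matD[OF ketbra_carrier[of d m m]]
    by (simp add: mtrace_def times_mat_def scalar_prod_def lessThan_atLeast0)
  also have "... = (\<Sum>i<d. \<Sum>k<d. if k = m then if i = m then G $$ (m, m) else 0 else 0)"
    by (intro sum.cong refl) auto
  finally show ?thesis using assms by simp
qed

text \<open>The factor 1/d_A^2 of the loop cancels in the quotient, and the trace of the output is
  the total weight of all outcomes.\<close>

lemma p_error_eq:
  assumes N: "linear_op_map dA dB N" and st: "strategy dA dB dM dL Enc Dec" and "0 < dA"
  shows "p_error dA dB N dM dL Enc Dec = 1 - (MIN m\<in>{..<dM}.
    fid dA dB N (branch dM dL Enc Dec m m) / (\<Sum>x<dM. fid dA dB N (branch dM dL Enc Dec m x)))"
proof -
  have E: "linear_op_map (dM * dL) dA Enc" and D: "linear_op_map dB (dM * dL) Dec"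
    using st by (auto simp: strategy_def channel_linear)
  have "Re (mtrace (ketbra dM m m * G)) / Re (mtrace G)
      = fid dA dB N (branch dM dL Enc Dec m m) / (\<Sum>x<dM. fid dA dB N (branch dM dL Enc Dec m x))"
    if m: "m < dM" and G: "G = retro_map dA dB N dM dL Enc Dec (ketbra dM m m)" for m G
  proof -
    have Gc: "G \<in> ops dM" by (simp add: G retro_map_def loop_map_def ptrace2_def)
    have Gx: "Re (G $$ (x, x)) = fid dA dB N (branch dM dL Enc Dec m x) / real (dA * dA)" if "x < dM" for x
      unfolding G retro_map_index[OF N E D m that] fid_def by (simp only: Re_divide_of_nat)
    have "Re (mtrace G) = (\<Sum>x<dM. fid dA dB N (branch dM dL Enc Dec m x)) / real (dA * dA)"
      using Gc Gx by (simp add: mtrace_def sum_divide_distrib)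
    then show ?thesis
      unfolding mtrace_ketbra_mult[OF Gc m] Gx[OF m] using \<open>0 < dA\<close> by simp
  qed
  then show ?thesis unfolding p_error_def Let_def
    by (intro arg_cong2[of _ _ _ _ "(-)"] arg_cong[of _ _ Min] image_cong) auto
qed

text \<open>Both converses compare, for each message, the weights of the correct and of the wrong outcomes
  with the traces of the blocks of the decoded dual operators; these traces do not depend on the
  message, so summing over the messages removes the dependence on the decoder.\<close>

lemma p_error_converse:
  assumes N: "cp_map dA dB N" and dA: "0 < dA" and st: "strategy dA dB dM dL Enc Dec" and dM: "0 < dM"
  defines "err \<equiv> p_error dA dB N dM dL Enc Dec"
  shows "0 \<le> err" and "err \<le> 1"
    and "0 < fid_min dA dB N \<Longrightarrow> (1 - err) * fid_min dA dB N * real dM \<le> fid_max dA dB N"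
    and "0 < fid_min dA dB N \<Longrightarrow> (1 - err) * fid_min dA dB N * (real dM - 1) \<le> err * fid_max dA dB N"
proof -
  let ?J = "choiU dA dB N"
  define q where "q m x = fid dA dB N (branch dM dL Enc Dec m x)" for m x
  define Q where "Q m = (\<Sum>x<dM. q m x)" for m
  define r where "r = 1 - err"
  have chE: "channel (dM * dL) dA Enc" and chD: "channel dB (dM * dL) Dec" using st by (auto simp: strategy_def)
  have cpb: "cp_map dB dA (branch dM dL Enc Dec m x)" if "x < dM" for m x
    using cp_branch[OF channel_cp[OF chE] channel_cp[OF chD] that] .
  have q0: "0 \<le> q m x" if "x < dM" for m x
    unfolding q_def using fid_nonneg[OF N cpb[OF that]] .
  have r: "r = (MIN m\<in>{..<dM}. q m m / Q m)"
    unfolding r_def err_def p_error_eq[OF cp_linear[OF N] st dA] by (simp add: q_def Q_def)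
  have qQ: "q m m \<le> Q m" if "m < dM" for m
    unfolding Q_def using that q0 by (intro member_le_sum) auto
  have Q0: "0 \<le> Q m" for m unfolding Q_def using q0 by (intro sum_nonneg) auto
  have ratio: "0 \<le> q m m / Q m" "q m m / Q m \<le> 1" if "m < dM" for m
    using q0[OF that, of m] qQ[OF that] Q0[of m] by (auto simp: divide_le_eq_1)
  have rle: "r \<le> q m m / Q m" if "m < dM" for m
    unfolding r using that by (intro Min_le) auto
  have ne: "{..<dM} \<noteq> {}" using dM by auto
  have r0: "0 \<le> r" unfolding r using ratio(1) ne by (subst Min_ge_iff) auto
  have r1: "r \<le> 1" using rle[OF dM] ratio(2)[OF dM] by linarith
  show "0 \<le> err" "err \<le> 1" using r0 r1 by (auto simp: r_def)
  have main: "r * (fid_min dA dB N - \<delta>) * real dM \<le> fid_max dA dB N + \<delta>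
      \<and> r * (fid_min dA dB N - \<delta>) * (real dM - 1) \<le> (1 - r) * (fid_max dA dB N + \<delta>)"
    if \<delta>: "0 < \<delta>" "\<delta> < fid_min dA dB N" for \<delta>
  proof -
    obtain Y where Y: "hermitian_op dB Y" "psd (dA * dB) (?J - amp dA Y)"
      and Yt: "fid_min dA dB N - \<delta> \<le> Re (mtrace Y)" using fid_min_duality(3)[OF N dA \<delta>(1)] by blast
    obtain S where S: "psd dB S" "psd (dA * dB) (amp dA S - ?J)"
      and St: "Re (mtrace S) \<le> fid_max dA dB N + \<delta>" using fid_max_duality(3)[OF N dA \<delta>(1)] by blast
    define t where "t = Re (mtrace Y)"
    define s where "s = Re (mtrace S)"
    define y where "y x = Re (mtrace (blk dL x x (Dec Y)))" for x
    define z where "z x = Re (mtrace (blk dL x x (Dec S)))" for x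
    note Yc = hermitian_carrier[OF Y(1)] and Sc = psd_carrier[OF S(1)]
    \<comment> \<open>Hence each total weight \<open>Q m\<close> is positive and the quotients are
      genuine.\<close>
    have t: "0 < t" using Yt \<delta> by (simp add: t_def)
    have sy: "(\<Sum>x<dM. y x) = t"
      using sum_mtrace_blk[OF linear_carrier[OF channel_linear[OF chD] Yc]] channel_mtrace[OF chD Yc]
      unfolding y_def t_def Re_sum[symmetric] by simp
    have sz: "(\<Sum>x<dM. z x) = s"
      using sum_mtrace_blk[OF linear_carrier[OF channel_linear[OF chD] Sc]] channel_mtrace[OF chD Sc]
      unfolding z_def s_def Re_sum[symmetric] by simp
    have yq: "y x \<le> q m x" if "m < dM" "x < dM" for m x
      using psd_kron_one_diff_pairing(1)[OF cpb[OF that(2)] choiU_carrier Yc Y(2), of m]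
      unfolding mtrace_branch[OF chE that(1)] y_def q_def fid_def .
    have qz: "q m x \<le> z x" if "m < dM" "x < dM" for m x
      using psd_kron_one_diff_pairing(2)[OF cpb[OF that(2)] choiU_carrier Sc S(2), of m]
      unfolding mtrace_branch[OF chE that(1)] z_def q_def fid_def .
    have Qt: "t \<le> Q m" if "m < dM" for m
      unfolding Q_def sy[symmetric] using yq[OF that] by (intro sum_mono) auto
    have rQ: "r * Q m \<le> q m m" if "m < dM" for m
      using rle[OF that] Qt[OF that] t by (simp add: pos_le_divide_eq)
    \<comment> \<open>The correct outcome alone: its weight is at least r times \<open>Q m\<close>
      and at most \<open>z m\<close>. Summing over the messages gives the bound with factor
      M.\<close>
    have 1: "r * t \<le> z m" if "m < dM" for m
    proof -
      have "r * t \<le> r * Q m" using r0 Qt[OF that] by (rule mult_left_mono[rotated])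
      then show ?thesis using rQ[OF that] qz[OF that that] by linarith
    qed
    \<comment> \<open>The wrong outcomes: r times their weight is at most 1 - r times the correct
      weight. The terms t - y m add up to (M - 1) t over all messages, because the
      \<open>y m\<close> add up to \<open>t\<close>.\<close>
    have 2: "r * (t - y m) \<le> (1 - r) * z m" if "m < dM" for m
    proof -
      have "Q m - q m m = (\<Sum>x\<in>{..<dM} - {m}. q m x)" using that by (simp add: Q_def sum_diff1)
      moreover have "t - y m = (\<Sum>x\<in>{..<dM} - {m}. y x)" using that by (simp add: sy[symmetric] sum_diff1)
      moreover have "(\<Sum>x\<in>{..<dM} - {m}. y x) \<le> (\<Sum>x\<in>{..<dM} - {m}. q m x)"
        using yq[OF that] by (intro sum_mono) auto
      ultimately have "r * (t - y m) \<le> r * (Q m - q m m)" using r0 by (intro mult_left_mono) auto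
      also have "... \<le> (1 - r) * q m m" using rQ[OF that] by (simp add: algebra_simps)
      also have "... \<le> (1 - r) * z m" using r1 qz[OF that that] by (intro mult_left_mono) auto
      finally show ?thesis .
    qed
    have "(\<Sum>m<dM. r * t) \<le> (\<Sum>m<dM. z m)" using 1 by (intro sum_mono) auto
    then have 3: "r * t * real dM \<le> s" by (simp add: sz mult_ac)
    have "(\<Sum>m<dM. r * (t - y m)) \<le> (\<Sum>m<dM. (1 - r) * z m)" using 2 by (intro sum_mono) auto
    then have 4: "r * t * (real dM - 1) \<le> (1 - r) * s"
      by (simp add: sum_distrib_left[symmetric] sum_subtractf sy sz algebra_simps)
    have m: "r * (fid_min dA dB N - \<delta>) \<le> r * t" using r0 Yt by (intro mult_left_mono) (auto simp: t_def)
    have "r * (fid_min dA dB N - \<delta>) * real dM \<le> r * t * real dM" using m by (rule mult_right_mono) simp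
    moreover have "r * (fid_min dA dB N - \<delta>) * (real dM - 1) \<le> r * t * (real dM - 1)"
      using m by (rule mult_right_mono) (use dM in simp)
    moreover have "(1 - r) * s \<le> (1 - r) * (fid_max dA dB N + \<delta>)"
      using r1 St by (intro mult_left_mono) (auto simp: s_def)
    ultimately show ?thesis using 3 4 St by (auto simp: s_def)
  qed
  \<comment> \<open>Removes the slack of the dual operators: \<delta> is chosen with \<delta> (r k +
    c) \<le> e, and the additional 1 keeps the divisor positive.\<close>
  have lim: "r * a * k \<le> c * b" if "0 < a" "0 \<le> c" "0 \<le> k" "\<And>\<delta>. 0 < \<delta> \<Longrightarrow> \<delta> < a \<Longrightarrow> r * (a - \<delta>) * k \<le> c * (b + \<delta>)" for a b c k
  proof (rule field_le_epsilon)
    fix e :: real assume "0 < e"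
    define \<delta> where "\<delta> = min (a / 2) (e / (r * k + c + 1))"
    have pos: "0 < r * k + c + 1" using r0 that by (simp add: add_nonneg_pos)
    have "\<delta> * (r * k + c + 1) \<le> e" using pos by (simp add: \<delta>_def pos_le_divide_eq[symmetric])
    moreover have d: "0 < \<delta>" "\<delta> < a" using that(1) \<open>0 < e\<close> pos by (auto simp: \<delta>_def)
    ultimately show "r * a * k \<le> c * b + e" using that(4)[OF d] by (simp add: algebra_simps)
  qed
  show "(1 - err) * fid_min dA dB N * real dM \<le> fid_max dA dB N" if "0 < fid_min dA dB N"
    using lim[OF that, of 1 "real dM" "fid_max dA dB N"] main by (simp add: r_def)
  show "(1 - err) * fid_min dA dB N * (real dM - 1) \<le> err * fid_max dA dB N" if "0 < fid_min dA dB N"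
    using lim[OF that, of "1 - r" "real dM - 1" "fid_max dA dB N"] main r1 dM by (simp add: r_def)
qed

text \<open>The Kraus operator is <p| (x) 1.\<close>

lemma cp_blk:
  assumes "p < k"
  shows "cp_map (k * d) d (blk d p p)"
proof -
  let ?V = "\<lambda>r s. if s = p * d + r then 1 else 0 :: complex"
  have "blk d p p = conj_map (k * d) d ?V"
  proof (rule ext, rule eq_matI)
    fix X i j assume "i < dim_row (conj_map (k * d) d ?V X)"
      "j < dim_col (conj_map (k * d) d ?V X)"
    then have ij: "i < d" "j < d" by (simp_all add: conj_map_def)
    have "conj_map (k * d) d ?V X $$ (i, j)
      = (\<Sum>a<k * d. \<Sum>a'<k * d. if a' = p * d + j then if a = p * d + i then X $$ (p * d + i, p * d + j) else 0 else 0)"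
      unfolding conj_map_def index_mat(1)[OF ij] split_conv by (intro sum.cong refl) auto
    then show "blk d p p X $$ (i, j) = conj_map (k * d) d ?V X $$ (i, j)"
      using ij assms by (simp add: idx_less)
  qed (simp_all add: conj_map_def)
  then show ?thesis by (simp add: cp_conj_map)
qed

lemma mtrace_sum:
  assumes "\<And>k. k \<in> I \<Longrightarrow> M k \<in> ops d"
  shows "mtrace (mat d d (\<lambda>ij. \<Sum>k\<in>I. M k $$ ij)) = (\<Sum>k\<in>I. mtrace (M k))"
proof -
  have "(\<Sum>k\<in>I. mtrace (M k)) = (\<Sum>k\<in>I. \<Sum>i<d. M k $$ (i, i))"
    using carrier_matD(1)[OF assms] by (intro sum.cong refl) (simp add: mtrace_def)
  also have "... = (\<Sum>i<d. \<Sum>k\<in>I. M k $$ (i, i))" by (rule sum.swap)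
  finally show ?thesis by (simp add: mtrace_def)
qed

text \<open>The decoder guesses the message uniformly at random and stores the guess
  together with its input; the encoder closes the loop with the most likely channel if the guess is
  correct, and with the least likely one otherwise.\<close>

lemma strategy_exists:
  assumes C0: "channel dB dA C0" and C1: "channel dB dA C1" and N: "linear_op_map dA dB N" and dM: "0 < dM"
  shows "\<exists>dL Enc Dec. strategy dA dB dM dL Enc Dec \<and> (\<forall>m<dM. \<forall>x<dM.
    fid dA dB N (branch dM dL Enc Dec m x) = fid dA dB N (if m = x then C1 else C0) / real dM)"
proof -
  \<comment> \<open>The memory L holds a second copy of the guess and the system B.\<close>
  define dL where "dL = dM * dB"
  define D where "D = dM * dL"
  \<comment> \<open>\<open>p\<close> encodes the pair of the true message and the guess stored in
    L.\<close>
  define C where "C p = (if p div dM = p mod dM then C1 else C0)" for p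
  define Enc where "Enc X = mat dA dA (\<lambda>ij. \<Sum>p<dM * dM. C p (blk dB p p X) $$ ij)" for X
  \<comment> \<open>The isometry from |b> to |x>|x>|b>, which announces the guess \<open>x\<close>
    and stores a copy of it.\<close>
  define V where "V x r b = (if r = x * dL + (x * dB + b) then 1 else 0 :: complex)" for x r b
  define Dec where "Dec Y = of_real (1 / real dM) \<cdot>\<^sub>m mat D D (\<lambda>ij. \<Sum>x<dM. conj_map dB D (V x) Y $$ ij)" for Y
  have chC: "channel dB dA (C p)" for p using C0 C1 by (simp add: C_def)
  note linC = channel_linear[OF chC]
  have cpE: "cp_map (dM * dM * dB) dA Enc"
    unfolding Enc_def by (intro cp_sum cp_comp[OF cp_blk channel_cp[OF chC]]) auto
  have E: "channel D dA Enc"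
    unfolding channel_def
  proof (intro conjI ballI)
    show "cp_map D dA Enc" using cpE by (simp add: D_def dL_def mult.assoc)
    fix X :: "complex mat" assume "X \<in> ops D"
    then have X: "X \<in> ops (dM * dM * dB)" by (simp add: D_def dL_def mult.assoc)
    have "mtrace (Enc X) = (\<Sum>p<dM * dM. mtrace (C p (blk dB p p X)))"
      unfolding Enc_def by (rule mtrace_sum) (rule linear_carrier[OF linC blk_carrier])
    also have "... = (\<Sum>p<dM * dM. mtrace (blk dB p p X))"
      by (simp add: channel_mtrace[OF chC])
    also have "... = mtrace X" by (rule sum_mtrace_blk[OF X])
    finally show "mtrace (Enc X) = mtrace X" .
  qed
  have V_idx: "V x (y * dL + (z * dB + b)) c = (if y = x \<and> z = x \<and> b = c then 1 else 0)"
    if "x < dM" "z < dM" "b < dB" "c < dB" for x y z b c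
    using that by (auto simp: V_def dL_def idx_eq_iff idx_less)
  have conj_idx: "conj_map dB D (V x) Y $$ (y * dL + (z * dB + b), y' * dL + (z' * dB + b'))
      = (if y = x \<and> z = x \<and> y' = x \<and> z' = x then Y $$ (b, b') else 0)"
    if *: "x < dM" "y < dM" "z < dM" "y' < dM" "z' < dM" "b < dB" "b' < dB" for x y z y' z' b b' Y
  proof -
    have i: "y * dL + (z * dB + b) < D" "y' * dL + (z' * dB + b') < D"
      using * by (simp_all add: D_def dL_def idx_less)
    have "conj_map dB D (V x) Y $$ (y * dL + (z * dB + b), y' * dL + (z' * dB + b'))
      = (\<Sum>c<dB. \<Sum>c'<dB. if c' = b' then if c = b then
          if y = x \<and> z = x \<and> y' = x \<and> z' = x then Y $$ (b, b') else 0 else 0 else 0)"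
      unfolding conj_map_def index_mat(1)[OF i] split_conv using *
      by (intro sum.cong refl) (auto simp: V_idx)
    then show ?thesis using * by simp
  qed
  have Dec_idx: "Dec Y $$ (y * dL + (z * dB + b), y' * dL + (z' * dB + b'))
      = (if z = y \<and> y' = y \<and> z' = y then Y $$ (b, b') / of_nat dM else 0)"
    if *: "y < dM" "z < dM" "y' < dM" "z' < dM" "b < dB" "b' < dB" for y z y' z' b b' Y
  proof -
    have i: "y * dL + (z * dB + b) < D" "y' * dL + (z' * dB + b') < D"
      using * by (simp_all add: D_def dL_def idx_less)
    have "Dec Y $$ (y * dL + (z * dB + b), y' * dL + (z' * dB + b'))
      = 1 / of_nat dM * (\<Sum>x<dM. conj_map dB D (V x) Y $$ (y * dL + (z * dB + b), y' * dL + (z' * dB + b')))"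
      using i by (simp add: Dec_def)
    also have "(\<Sum>x<dM. conj_map dB D (V x) Y $$ (y * dL + (z * dB + b), y' * dL + (z' * dB + b')))
      = (\<Sum>x<dM. if x = y then if z = y \<and> y' = y \<and> z' = y then Y $$ (b, b') else 0 else 0)"
      using * by (intro sum.cong refl) (auto simp: conj_idx)
    finally show ?thesis using * by simp
  qed
  have Dec_carrier: "Dec Y \<in> ops D" for Y by (simp add: Dec_def)
  have Dch: "channel dB D Dec"
    unfolding channel_def
  proof (intro conjI ballI)
    show "cp_map dB D Dec"
      unfolding Dec_def by (intro cp_smult cp_sum cp_conj_map) auto
    fix Y :: "complex mat" assume Y: "Y \<in> ops dB"
    have "mtrace (Dec Y) = (\<Sum>y<dM. \<Sum>z<dM. \<Sum>b<dB. Dec Y $$ (y * dL + (z * dB + b), y * dL + (z * dB + b)))"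
      using carrier_matD[OF Dec_carrier[of Y]] by (simp add: mtrace_def D_def dL_def sum_idx)
    also have "... = (\<Sum>y<dM. \<Sum>z<dM. if z = y then (\<Sum>b<dB. Y $$ (b, b)) / of_nat dM else 0)"
      by (intro sum.cong refl) (auto simp: Dec_idx sum_divide_distrib)
    also have "... = (\<Sum>b<dB. Y $$ (b, b))" using dM by simp
    finally show "mtrace (Dec Y) = mtrace Y" using Y by (simp add: mtrace_def)
  qed
  have "strategy dA dB dM dL Enc Dec" using E Dch by (simp add: strategy_def D_def)
  moreover have "fid dA dB N (branch dM dL Enc Dec m x) = fid dA dB N (if m = x then C1 else C0) / real dM"
    if mx: "m < dM" "x < dM" for m x
  proof -
    have br: "branch dM dL Enc Dec m x Y $$ (i, j) = (if m = x then C1 else C0) Y $$ (i, j) / of_nat dM"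
      if Y: "Y \<in> ops dB" and ij: "i < dA" "j < dA" for Y i j
    proof -
      let ?X = "kron (ketbra dM m m) (blk dL x x (Dec Y))"
      have b: "C p (blk dB p p ?X) $$ (i, j) = (if p = m * dM + x then C p Y $$ (i, j) / of_nat dM else 0)"
        if p: "p < dM * dM" for p
      proof -
        define m' y where "m' = p div dM" and "y = p mod dM"
        have my: "m' < dM" "y < dM" and pe: "p = m' * dM + y"
          using p by (auto simp: m'_def y_def div_less_idx mod_less_idx)
        have "blk dB p p ?X = (if p = m * dM + x then 1 / of_nat dM else 0) \<cdot>\<^sub>m Y"
        proof (rule eq_matI)
          fix c d assume "c < dim_row ((if p = m * dM + x then 1 / of_nat dM else 0) \<cdot>\<^sub>m Y)"
            "d < dim_col ((if p = m * dM + x then 1 / of_nat dM else 0) \<cdot>\<^sub>m Y)"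
          then have cd: "c < dB" "d < dB" using Y by auto
          have e: "p * dB + c' = m' * dL + (y * dB + c')" for c' by (simp add: pe dL_def algebra_simps)
          have "blk dB p p ?X $$ (c, d) = ?X $$ (m' * dL + (y * dB + c), m' * dL + (y * dB + d))"
            using cd by (simp add: e)
          also have "... = ketbra dM m m $$ (m', m') * blk dL x x (Dec Y) $$ (y * dB + c, y * dB + d)"
            using my cd by (intro kron_index[OF ketbra_carrier blk_carrier]) (auto simp: dL_def idx_less)
          also have "blk dL x x (Dec Y) $$ (y * dB + c, y * dB + d) = (if y = x then Y $$ (c, d) / of_nat dM else 0)"
            using my cd mx by (simp add: dL_def idx_less) (simp add: dL_def[symmetric] Dec_idx)
          finally show "blk dB p p ?X $$ (c, d) = ((if p = m * dM + x then 1 / of_nat dM else 0) \<cdot>\<^sub>m Y) $$ (c, d)"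
            using Y cd my mx by (simp add: pe idx_eq_iff)
        qed (use Y in auto)
        moreover have "C p ((if p = m * dM + x then 1 / of_nat dM else 0) \<cdot>\<^sub>m Y)
          = (if p = m * dM + x then 1 / of_nat dM else 0) \<cdot>\<^sub>m C p Y"
          using linC[of p] Y by (simp add: linear_op_map_def)
        ultimately show ?thesis using ij carrier_matD[OF linear_carrier[OF linC[of p] Y]] by simp
      qed
      have "branch dM dL Enc Dec m x Y $$ (i, j) = (\<Sum>p<dM * dM. C p (blk dB p p ?X) $$ (i, j))"
        using ij by (simp add: branch_def Enc_def)
      also have "... = (\<Sum>p<dM * dM. if p = m * dM + x then C p Y $$ (i, j) / of_nat dM else 0)"
        by (intro sum.cong refl b) simp
      also have "... = C (m * dM + x) Y $$ (i, j) / of_nat dM" using mx by (simp add: idx_less)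
      finally show ?thesis using mx by (simp add: C_def)
    qed
    have "pairing dA dB (branch dM dL Enc Dec m x) (choiU dA dB N)
      = pairing dA dB (if m = x then C1 else C0) (choiU dA dB N) / of_nat dM"
      unfolding pairing_def by (simp add: br sum_divide_distrib)
    then show ?thesis by (simp only: fid_def Re_divide_of_nat)
  qed
  ultimately show ?thesis by blast
qed

text \<open>With a and b the two extreme values, every message has weight b / M on the correct
  outcome and a / M on each of the M - 1 wrong ones.\<close>

lemma p_error_achievable:
  assumes N: "cp_map dA dB N" and dA: "0 < dA" and dM: "0 < dM" and pos: "0 < fid_max dA dB N"
  shows "\<exists>dL Enc Dec. strategy dA dB dM dL Enc Dec \<and> p_error dA dB N dM dL Enc Dec
    = (real dM - 1) * fid_min dA dB N / (fid_max dA dB N + (real dM - 1) * fid_min dA dB N)"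
proof -
  let ?a = "fid_min dA dB N" and ?b = "fid_max dA dB N"
  obtain C0 where C0: "channel dB dA C0" "fid dA dB N C0 = ?a" using fid_min_duality(1)[OF N dA] by blast
  obtain C1 where C1: "channel dB dA C1" "fid dA dB N C1 = ?b" using fid_max_duality(1)[OF N dA] by blast
  obtain dL Enc Dec where st: "strategy dA dB dM dL Enc Dec"
    and f0: "\<forall>m<dM. \<forall>x<dM. fid dA dB N (branch dM dL Enc Dec m x) = fid dA dB N (if m = x then C1 else C0) / real dM"
    using strategy_exists[OF C0(1) C1(1) cp_linear[OF N] dM] by blast
  have f: "fid dA dB N (branch dM dL Enc Dec m x) = (if m = x then ?b else ?a) / real dM" if "m < dM" "x < dM" for m x
    using f0 that C0(2) C1(2) by auto
  let ?q = "\<lambda>m x. fid dA dB N (branch dM dL Enc Dec m x)"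
  have a0: "0 \<le> ?a" by (rule fid_min_nonneg[OF N dA])
  have den: "0 < ?b + (real dM - 1) * ?a" using pos a0 dM by (intro add_pos_nonneg mult_nonneg_nonneg) auto
  have "(\<Sum>x<dM. ?q m x) = (?b + (real dM - 1) * ?a) / real dM" if m: "m < dM" for m
  proof -
    have "(\<Sum>x<dM. ?q m x) = (\<Sum>x<dM. ?a / real dM + (if x = m then (?b - ?a) / real dM else 0))"
      using m by (intro sum.cong refl) (auto simp: f diff_divide_distrib)
    also have "... = real dM * (?a / real dM) + (?b - ?a) / real dM"
      using m by (simp add: sum.distrib)
    also have "... = (?b + (real dM - 1) * ?a) / real dM"
      using dM by (simp add: field_simps)
    finally show ?thesis .
  qed
  then have "?q m m / (\<Sum>x<dM. ?q m x)
      = ?b / (?b + (real dM - 1) * ?a)" if "m < dM" for m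
    using that dM f by simp
  then have "(\<lambda>m. ?q m m / (\<Sum>x<dM. ?q m x)) ` {..<dM}
      = {?b / (?b + (real dM - 1) * ?a)}"
    using dM by (auto simp: image_iff)
  then have "p_error dA dB N dM dL Enc Dec = 1 - ?b / (?b + (real dM - 1) * ?a)"
    by (simp add: p_error_eq[OF cp_linear[OF N] st dA])
  also have "... = (real dM - 1) * ?a / (?b + (real dM - 1) * ?a)"
    using den by (simp add: field_simps)
  finally show ?thesis using st by blast
qed

section \<open>Tensor powers and information quantities\<close>

lemma sum2_product:
  fixes f g :: "nat \<Rightarrow> nat \<Rightarrow> complex"
  shows "(\<Sum>a\<in>A. \<Sum>a'\<in>B. \<Sum>c\<in>C. \<Sum>c'\<in>D. f a a' * g c c') = (\<Sum>a\<in>A. \<Sum>a'\<in>B. f a a') * (\<Sum>c\<in>C. \<Sum>c'\<in>D. g c c')"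
proof -
  have "f a a' * (\<Sum>c\<in>C. \<Sum>c'\<in>D. g c c') = (\<Sum>c\<in>C. \<Sum>c'\<in>D. f a a' * g c c')" for a a'
    by (simp only: sum_distrib_left)
  then show ?thesis by (simp only: sum_distrib_right)
qed

lemma tensor_map_kron:
  assumes C: "linear_op_map dA dB C" and D: "linear_op_map dC dD D"
    and X: "X \<in> ops dA" and Y: "Y \<in> ops dC"
  shows "tensor_map dA dB C dC dD D (kron X Y) = kron (C X) (D Y)"
proof (rule eq_mat_idx)
  note CX = linear_carrier[OF C X] and DY = linear_carrier[OF D Y]
  show "kron (C X) (D Y) \<in> ops (dB * dD)" by (rule kron_carrier[OF CX DY])
  fix i j k l assume *: "i < dB" "j < dB" "k < dD" "l < dD"
  have "tensor_map dA dB C dC dD D (kron X Y) $$ (i * dD + k, j * dD + l)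
    = (\<Sum>a<dA. \<Sum>a'<dA. \<Sum>c<dC. \<Sum>c'<dC. (X $$ (a, a') * C (ketbra dA a a') $$ (i, j)) * (Y $$ (c, c') * D (ketbra dC c c') $$ (k, l)))"
    unfolding tensor_map_index[OF C D *]
    by (intro sum.cong refl) (simp add: kron_index[OF X Y])
  also have "... = (\<Sum>a<dA. \<Sum>a'<dA. X $$ (a, a') * C (ketbra dA a a') $$ (i, j)) *
      (\<Sum>c<dC. \<Sum>c'<dC. Y $$ (c, c') * D (ketbra dC c c') $$ (k, l))"
    by (rule sum2_product)
  also have "... = kron (C X) (D Y) $$ (i * dD + k, j * dD + l)"
    unfolding kron_index[OF CX DY *] linear_expand[OF C X *(1,2)] linear_expand[OF D Y *(3,4)] ..
  finally show "tensor_map dA dB C dC dD D (kron X Y) $$ (i * dD + k, j * dD + l)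
    = kron (C X) (D Y) $$ (i * dD + k, j * dD + l)" .
qed simp

lemma fid_tensor:
  assumes N: "cp_map dA dB N" and P: "cp_map dC dD P" and C: "cp_map dB dA C" and D: "cp_map dD dC D"
  shows "fid (dA * dC) (dB * dD) (tensor_map dA dB N dC dD P) (tensor_map dB dA C dD dC D)
    = fid dA dB N C * fid dC dD P D"
proof -
  note lN = cp_linear[OF N] and lP = cp_linear[OF P] and lC = cp_linear[OF C] and lD = cp_linear[OF D]
  let ?NP = "tensor_map dA dB N dC dD P" and ?CD = "tensor_map dB dA C dD dC D"
  let ?f = "\<lambda>a a'. C (N (ketbra dA a a')) $$ (a, a')" and ?g = "\<lambda>c c'. D (P (ketbra dC c c')) $$ (c, c')"
  have *: "?CD (?NP (ketbra (dA * dC) (a * dC + c) (a' * dC + c'))) $$ (a * dC + c, a' * dC + c') = ?f a a' * ?g c c'"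
    if "a < dA" "a' < dA" "c < dC" "c' < dC" for a a' c c'
    unfolding tensor_map_ketbra[OF lN lP that]
      tensor_map_kron[OF lC lD linear_carrier[OF lN ketbra_carrier] linear_carrier[OF lP ketbra_carrier]]
      kron_index[OF linear_carrier[OF lC linear_carrier[OF lN ketbra_carrier]]
        linear_carrier[OF lD linear_carrier[OF lP ketbra_carrier]] that] ..
  have "pairing (dA * dC) (dB * dD) ?CD (choiU (dA * dC) (dB * dD) ?NP)
    = (\<Sum>i<dA * dC. \<Sum>j<dA * dC. ?CD (?NP (ketbra (dA * dC) i j)) $$ (i, j))"
    by (simp add: pairing_def blk_choiU[OF linear_tensor])
  also have "... = (\<Sum>a<dA. \<Sum>c<dC. \<Sum>a'<dA. \<Sum>c'<dC. ?f a a' * ?g c c')"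
    unfolding sum_idx by (intro sum.cong refl *) auto
  also have "... = (\<Sum>a<dA. \<Sum>a'<dA. \<Sum>c<dC. \<Sum>c'<dC. ?f a a' * ?g c c')"
    by (intro sum.cong refl sum.swap)
  also have "... = (\<Sum>a<dA. \<Sum>a'<dA. ?f a a') * (\<Sum>c<dC. \<Sum>c'<dC. ?g c c')"
    by (rule sum2_product)
  also have "... = pairing dA dB C (choiU dA dB N) * pairing dC dD D (choiU dC dD P)"
    by (simp add: pairing_def blk_choiU[OF lN] blk_choiU[OF lP])
  \<comment> \<open>Real parts multiply because the first pairing is real, by
    \<open>pairing_nonneg\<close>.\<close>
  finally show ?thesis
    using pairing_nonneg[OF C cp_choiU[OF N]] by (simp add: fid_def complex_nonneg_iff)
qed

text \<open>The product of two optimal channels competes in the minimum over joint channels, which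
  may do better.\<close>

lemma fid_min_tensor_le:
  assumes N: "cp_map dA dB N" and P: "cp_map dC dD P" and d: "0 < dA" "0 < dC"
  shows "fid_min (dA * dC) (dB * dD) (tensor_map dA dB N dC dD P) \<le> fid_min dA dB N * fid_min dC dD P"
proof -
  obtain C where C: "channel dB dA C" "fid dA dB N C = fid_min dA dB N" using fid_min_duality(1)[OF N d(1)] by blast
  obtain D where D: "channel dD dC D" "fid dC dD P D = fid_min dC dD P" using fid_min_duality(1)[OF P d(2)] by blast
  show ?thesis
    using fid_min_duality(2)[OF cp_tensor[OF N P] _ channel_tensor[OF C(1) D(1)]] d
    by (simp add: fid_tensor[OF N P channel_cp[OF C(1)] channel_cp[OF D(1)]] C(2) D(2))
qed

text \<open>Telescoping through the mixed product of X' and Y. Both summands are positive as soon as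
  X - X', Y, X' and Y - Y' are.\<close>

lemma kron_exch_add:
  assumes "X \<in> ops (dA * dB)" "X' \<in> ops (dA * dB)"
    "Y \<in> ops (dC * dD)" "Y' \<in> ops (dC * dD)"
  shows "kron_exch dA dB dC dD X Y - kron_exch dA dB dC dD X' Y'
    = kron_exch dA dB dC dD (X - X') Y + kron_exch dA dB dC dD X' (Y - Y')" (is "?L = ?R")
proof (rule eq_mat_idx4[where dA = dA and dB = dB and dC = dC and dD = dD])
  fix a a' c c' b b' d d' assume *: "a < dA" "a' < dA" "c < dC" "c' < dC" "b < dB" "b' < dB" "d < dD" "d' < dD"
  note k = kron_exch_carrier[THEN carrier_matD(1)] kron_exch_carrier[THEN carrier_matD(2)]
  have i: "idx4 dB dC dD a c b d < dA * dC * (dB * dD)"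
    "idx4 dB dC dD a' c' b' d' < dA * dC * (dB * dD)"
    using * by (simp_all add: idx_less)
  have i': "a * dB + b < dA * dB" "a' * dB + b' < dA * dB" "c * dD + d < dC * dD" "c' * dD + d' < dC * dD"
    using * by (simp_all add: idx_less)
  show "?L $$ (idx4 dB dC dD a c b d, idx4 dB dC dD a' c' b' d')
    = ?R $$ (idx4 dB dC dD a c b d, idx4 dB dC dD a' c' b' d')"
    using i i' assms minus_carrier_mat[OF assms(2), of X] minus_carrier_mat[OF assms(4), of Y] *
    by (simp add: k kron_exch_index left_diff_distrib right_diff_distrib)
qed (auto intro!: minus_carrier_mat add_carrier_mat)

lemma kron_exch_one:
  assumes "X \<in> ops dB" "Y \<in> ops dD"
  shows "kron_exch dA dB dC dD (amp dA X) (amp dC Y) = amp (dA * dC) (kron X Y)"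
proof (rule eq_mat_idx4[where dA = dA and dB = dB and dC = dC and dD = dD])
  show "amp (dA * dC) (kron X Y) \<in> ops (dA * dC * (dB * dD))"
    by (rule kron_carrier[OF one_carrier_mat kron_carrier[OF assms]])
  fix a a' c c' b b' d d' assume *: "a < dA" "a' < dA" "c < dC" "c' < dC" "b < dB" "b' < dB" "d < dD" "d' < dD"
  have i: "a * dC + c < dA * dC" "a' * dC + c' < dA * dC" "b * dD + d < dB * dD" "b' * dD + d' < dB * dD"
    using * by (simp_all add: idx_less)
  show "kron_exch dA dB dC dD (amp dA X) (amp dC Y)
      $$ (idx4 dB dC dD a c b d, idx4 dB dC dD a' c' b' d')
    = amp (dA * dC) (kron X Y) $$ (idx4 dB dC dD a c b d, idx4 dB dC dD a' c' b' d')"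
    unfolding kron_index[OF one_carrier_mat kron_carrier[OF assms] i]
      kron_exch_index[OF kron_carrier[OF one_carrier_mat assms(1)] kron_carrier[OF one_carrier_mat assms(2)] *]
      kron_index[OF one_carrier_mat assms(1) *(1,2,5,6)] kron_index[OF one_carrier_mat assms(2) *(3,4,7,8)]
      kron_index[OF assms *(5-8)]
    using i * by (simp add: idx_eq_iff)
qed simp

text \<open>Product channels give one inequality, the product of two dual operators is feasible and
  gives the other.\<close>

lemma fid_max_tensor:
  assumes N: "cp_map dA dB N" and P: "cp_map dC dD P" and d: "0 < dA" "0 < dC"
  shows "fid_max (dA * dC) (dB * dD) (tensor_map dA dB N dC dD P) = fid_max dA dB N * fid_max dC dD P"
proof (rule antisym)
  let ?NP = "tensor_map dA dB N dC dD P"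
  note NP = cp_tensor[OF N P]
  have dd: "0 < dA * dC" using d by simp
  obtain C where C: "channel dB dA C" "fid dA dB N C = fid_max dA dB N" using fid_max_duality(1)[OF N d(1)] by blast
  obtain D where D: "channel dD dC D" "fid dC dD P D = fid_max dC dD P" using fid_max_duality(1)[OF P d(2)] by blast
  show "fid_max dA dB N * fid_max dC dD P \<le> fid_max (dA * dC) (dB * dD) ?NP"
    using fid_max_duality(2)[OF NP dd channel_tensor[OF C(1) D(1)]]
    by (simp add: fid_tensor[OF N P channel_cp[OF C(1)] channel_cp[OF D(1)]] C(2) D(2))
  obtain F where F: "channel (dB * dD) (dA * dC) F" "fid (dA * dC) (dB * dD) ?NP F = fid_max (dA * dC) (dB * dD) ?NP"
    using fid_max_duality(1)[OF NP dd] by blast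
  let ?x = "fid_max dA dB N" and ?y = "fid_max dC dD P"
  have x0: "0 \<le> ?x" using fid_nonneg[OF N channel_cp[OF C(1)]] C(2) by simp
  have y0: "0 \<le> ?y" using fid_nonneg[OF P channel_cp[OF D(1)]] D(2) by simp
  have bound: "fid_max (dA * dC) (dB * dD) ?NP \<le> (?x + \<delta>) * (?y + \<delta>)" if \<delta>: "0 < \<delta>" for \<delta>
  proof -
    obtain S where S: "psd dB S" "psd (dA * dB) (amp dA S - choiU dA dB N)" "Re (mtrace S) \<le> ?x + \<delta>"
      using fid_max_duality(3)[OF N d(1) \<delta>] by blast
    obtain T where T: "psd dD T" "psd (dC * dD) (amp dC T - choiU dC dD P)" "Re (mtrace T) \<le> ?y + \<delta>"
      using fid_max_duality(3)[OF P d(2) \<delta>] by blast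
    note Sc = psd_carrier[OF S(1)] and Tc = psd_carrier[OF T(1)]
    have "psd dC (1\<^sub>m dC)"
    proof -
      have "1\<^sub>m dC = mat dC dC (\<lambda>(p, q). if p = q then of_real 1 else 0 :: complex)" by (intro eq_matI) auto
      then show ?thesis using psd_scaled_one[of 1 dC] by simp
    qed
    then have T1: "psd (dC * dD) (amp dC T)" using T(1) by (rule psd_kron)
    have "amp (dA * dC) (kron S T) - choiU (dA * dC) (dB * dD) ?NP
      = kron_exch dA dB dC dD (amp dA S - choiU dA dB N) (amp dC T)
        + kron_exch dA dB dC dD (choiU dA dB N) (amp dC T - choiU dC dD P)"
      unfolding choiU_tensor_eq[OF cp_linear[OF N] cp_linear[OF P]] kron_exch_one[OF Sc Tc, symmetric]
      by (rule kron_exch_add[OF kron_carrier[OF one_carrier_mat Sc] choiU_carrier kron_carrier[OF one_carrier_mat Tc] choiU_carrier])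
    then have "psd (dA * dC * (dB * dD)) (amp (dA * dC) (kron S T) - choiU (dA * dC) (dB * dD) ?NP)"
      using psd_add[OF psd_kron_exch[OF S(2) T1] psd_kron_exch[OF cp_choiU[OF N] T(2)]] by simp
    from psd_kron_one_diff_pairing(2)[OF channel_cp[OF F(1)] choiU_carrier kron_carrier[OF Sc Tc] this]
    have "fid_max (dA * dC) (dB * dD) ?NP \<le> Re (mtrace S * mtrace T)"
      unfolding channel_mtrace[OF F(1) kron_carrier[OF Sc Tc]] mtrace_kron[OF Sc Tc] by (simp add: F(2)[symmetric] fid_def)
    also have "... = Re (mtrace S) * Re (mtrace T)"
    proof -
      have "Im (mtrace S) = 0"
        using psd_diag(1)[OF S(1)] Sc by (simp add: mtrace_def)
      then show ?thesis by simp
    qed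
    also have "... \<le> (?x + \<delta>) * (?y + \<delta>)"
    proof (rule mult_mono[OF S(3) T(3)])
      show "0 \<le> Re (mtrace T)" using psd_diag(2)[OF T(1)] Tc by (auto simp: mtrace_def intro!: sum_nonneg)
    qed (use x0 \<delta> in simp)
    finally show ?thesis .
  qed
  show "fid_max (dA * dC) (dB * dD) ?NP \<le> ?x * ?y"
  proof (rule field_le_epsilon)
    fix e :: real assume "0 < e"
    \<comment> \<open>The bound by 1 makes the quadratic term at most \<delta>, so that the total
      excess is at most \<delta> times the divisor.\<close>
    define \<delta> where "\<delta> = min 1 (e / (?x + ?y + 1))"
    have pos: "0 < ?x + ?y + 1" using x0 y0 by simp
    have d: "0 < \<delta>" "\<delta> \<le> 1" using \<open>0 < e\<close> pos by (auto simp: \<delta>_def)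
    have "\<delta> * (?x + ?y + 1) \<le> e" using pos by (simp add: \<delta>_def pos_le_divide_eq[symmetric])
    moreover have "\<delta> * \<delta> \<le> \<delta>" using d by (simp add: mult_left_le)
    ultimately have "(?x + \<delta>) * (?y + \<delta>) \<le> ?x * ?y + e" by (simp add: algebra_simps)
    then show "fid_max (dA * dC) (dB * dD) ?NP \<le> ?x * ?y + e" using bound[OF d(1)] by linarith
  qed
qed

lemma fid_max_tensor_power:
  assumes N: "cp_map dA dB N" and dA: "0 < dA"
  shows "fid_max (dA ^ n) (dB ^ n) (tensor_power dA dB N n) = fid_max dA dB N ^ n"
proof (induction n)
  case 0
  have id: "cp_map 1 1 id" using cp_tensor_power[OF N, of 0] by (simp only: power_0 tensor_power.simps)
  obtain C where C: "channel 1 1 C" "fid 1 1 id C = fid_max 1 1 id"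
    using fid_max_duality(1)[OF id] by auto
  \<comment> \<open>In dimension one, trace preservation fixes the pairing at 1.\<close>
  have "pairing 1 1 C (choiU 1 1 id) = C (ketbra 1 0 0) $$ (0, 0)"
    by (simp add: pairing_def blk_choiU[OF linear_id, of 0 1 0, simplified])
  also have "... = mtrace (C (ketbra 1 0 0))"
    using linear_carrier[OF channel_linear[OF C(1)] ketbra_carrier[of 1 0 0]] by (simp add: mtrace_def)
  also have "... = 1" using channel_mtrace[OF C(1) ketbra_carrier] mtrace_ketbra[of 0 1 0] by simp
  finally have "fid_max 1 1 id = 1" using C(2) by (simp add: fid_def)
  then show ?case by (simp only: power_0 tensor_power.simps)
next
  case (Suc n)
  then show ?case using fid_max_tensor[OF N cp_tensor_power[OF N, of n] dA] dA by simp
qed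

section \<open>Splitting tensor powers\<close>

lemma kron_assoc:
  assumes "X \<in> ops k" "Y \<in> ops m" "Z \<in> ops n"
  shows "kron (kron X Y) Z = kron X (kron Y Z)"
proof (rule eq_matI)
  have d: "dim_row X = k" "dim_col X = k" "dim_row Y = m" "dim_col Y = m" "dim_row Z = n" "dim_col Z = n"
    using assms by auto
  fix i j assume "i < dim_row (kron X (kron Y Z))" "j < dim_col (kron X (kron Y Z))"
  then have ij: "i < k * m * n" "j < k * m * n" by (auto simp: kron_def d mult.assoc)
  have e: "x div (m * n) = x div n div m" "x mod (m * n) div n = x div n mod m" "x mod (m * n) mod n = x mod n"
    if "x < k * m * n" for x
  proof -
    have n: "0 < n" using that by (cases n) auto
    show "x div (m * n) = x div n div m" by (simp add: mult.commute[of m n] div_mult2_eq)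
    have "x mod (m * n) = n * (x div n mod m) + x mod n" by (simp add: mult.commute[of m n] mod_mult2_eq)
    then show "x mod (m * n) div n = x div n mod m" "x mod (m * n) mod n = x mod n" using n by simp_all
  qed
  have b: "x div n < k * m" "x mod (m * n) < m * n" "x < k * (m * n)" if "x < k * m * n" for x
    using that div_less_idx[of x "k * m" n] mod_less_idx[of x k "m * n"] by (simp_all add: mult.assoc)
  show "kron (kron X Y) Z $$ (i, j) = kron X (kron Y Z) $$ (i, j)"
    using ij b[OF ij(1)] b[OF ij(2)] by (simp add: kron_def d e mult.assoc)
qed (simp_all add: kron_def mult.assoc)

text \<open>\<open>tensor_power\<close> peels off one factor at the left, so splitting a power into
  two is an induction on \<open>m\<close> that reassociates Kronecker products; each step splits the
  leading digit off the index of the matrix unit.\<close>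

lemma tensor_power_add_ketbra:
  assumes N: "linear_op_map dA dB N" and NP: "\<And>n. linear_op_map (dA ^ n) (dB ^ n) (tensor_power dA dB N n)"
    and "a < dA ^ m" "a' < dA ^ m" "b < dA ^ n" "b' < dA ^ n"
  shows "tensor_power dA dB N (m + n) (ketbra (dA ^ (m + n)) (a * dA ^ n + b) (a' * dA ^ n + b'))
    = kron (tensor_power dA dB N m (ketbra (dA ^ m) a a')) (tensor_power dA dB N n (ketbra (dA ^ n) b b'))"
  using assms(3,4)
proof (induction m arbitrary: a a')
  case 0
  let ?t = "tensor_power dA dB N"
  let ?Z = "?t n (ketbra (dA ^ n) b b')"
  have Z: "?Z \<in> ops (dB ^ n)" by (rule linear_carrier[OF NP ketbra_carrier])
  have "kron (ketbra 1 0 0) ?Z = ?Z"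
    using carrier_matD[OF Z] by (intro eq_matI) (auto simp: kron_def ketbra_def)
  then show ?case using 0 by simp
next
  case (Suc m)
  let ?t = "tensor_power dA dB N"
  define x c where "x = a div dA ^ m" and "c = a mod dA ^ m"
  define x' c' where "x' = a' div dA ^ m" and "c' = a' mod dA ^ m"
  have a: "a = x * dA ^ m + c" "a' = x' * dA ^ m + c'" by (simp_all only: x_def c_def x'_def c'_def div_mult_mod_eq)
  have l: "x < dA" "x' < dA" "c < dA ^ m" "c' < dA ^ m"
    unfolding x_def c_def x'_def c'_def
    using Suc.prems div_less_idx[of a dA "dA ^ m"] mod_less_idx[of a dA "dA ^ m"]
      div_less_idx[of a' dA "dA ^ m"] mod_less_idx[of a' dA "dA ^ m"] by simp_all
  have i: "c * dA ^ n + b < dA ^ (m + n)" "c' * dA ^ n + b' < dA ^ (m + n)"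
    using idx_less[OF l(3) assms(5)] idx_less[OF l(4) assms(6)] by (simp_all add: power_add)
  have e: "a * dA ^ n + b = x * dA ^ (m + n) + (c * dA ^ n + b)" "a' * dA ^ n + b' = x' * dA ^ (m + n) + (c' * dA ^ n + b')"
    by (simp_all add: a power_add algebra_simps)
  have "?t (Suc m + n) (ketbra (dA ^ (Suc m + n)) (a * dA ^ n + b) (a' * dA ^ n + b'))
    = tensor_map dA dB N (dA ^ (m + n)) (dB ^ (m + n)) (?t (m + n))
        (ketbra (dA * dA ^ (m + n)) (x * dA ^ (m + n) + (c * dA ^ n + b)) (x' * dA ^ (m + n) + (c' * dA ^ n + b')))"
    by (simp add: e)
  also have "... = kron (N (ketbra dA x x')) (?t (m + n) (ketbra (dA ^ (m + n)) (c * dA ^ n + b) (c' * dA ^ n + b')))"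
    by (rule tensor_map_ketbra[OF N NP l(1,2) i])
  also have "... = kron (N (ketbra dA x x')) (kron (?t m (ketbra (dA ^ m) c c'))
      (?t n (ketbra (dA ^ n) b b')))"
    by (simp only: Suc.IH[OF l(3,4)])
  also have "... = kron (kron (N (ketbra dA x x')) (?t m (ketbra (dA ^ m) c c')))
      (?t n (ketbra (dA ^ n) b b'))"
    by (rule kron_assoc[OF linear_carrier[OF N ketbra_carrier] linear_carrier[OF NP ketbra_carrier]
          linear_carrier[OF NP ketbra_carrier], symmetric])
  also have "kron (N (ketbra dA x x')) (?t m (ketbra (dA ^ m) c c'))
      = ?t (Suc m) (ketbra (dA ^ Suc m) a a')"
    using tensor_map_ketbra[OF N NP[of m] l] by (simp add: a)
  finally show ?case .
qed

text \<open>\<open>fid_min\<close> sees a map only through its Choi operator, so it suffices that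
  the full power and the product of two powers agree on matrix units.\<close>

lemma fid_min_tensor_power_add:
  assumes N: "cp_map dA dB N" and dA: "0 < dA"
  shows "fid_min (dA ^ (m + n)) (dB ^ (m + n)) (tensor_power dA dB N (m + n))
    \<le> fid_min (dA ^ m) (dB ^ m) (tensor_power dA dB N m) * fid_min (dA ^ n) (dB ^ n) (tensor_power dA dB N n)"
proof -
  let ?t = "tensor_power dA dB N"
  let ?T = "tensor_map (dA ^ m) (dB ^ m) (?t m) (dA ^ n) (dB ^ n) (?t n)"
  note lin = cp_linear[OF cp_tensor_power[OF N]]
  have "?t (m + n) (ketbra (dA ^ (m + n)) p q) = ?T (ketbra (dA ^ (m + n)) p q)"
    if "p < dA ^ (m + n)" "q < dA ^ (m + n)" for p q
  proof -
    have b: "p div dA ^ n < dA ^ m" "q div dA ^ n < dA ^ m" "p mod dA ^ n < dA ^ n" "q mod dA ^ n < dA ^ n"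
      using that div_less_idx[of _ "dA ^ m" "dA ^ n"] mod_less_idx[of _ "dA ^ m" "dA ^ n"] by (simp_all add: power_add)
    show ?thesis
      using tensor_power_add_ketbra[OF cp_linear[OF N] lin b] tensor_map_ketbra[OF lin lin b] by (simp add: power_add div_mult_mod_eq)
  qed
  then have "choiU (dA ^ (m + n)) (dB ^ (m + n)) (?t (m + n)) = choiU (dA ^ (m + n)) (dB ^ (m + n)) ?T"
    unfolding choiU_def by (intro cong_mat refl) (auto simp: div_less_idx)
  then have "fid_min (dA ^ (m + n)) (dB ^ (m + n)) (?t (m + n)) = fid_min (dA ^ (m + n)) (dB ^ (m + n)) ?T"
    by (simp add: fid_min_def fid_def)
  also have "... \<le> fid_min (dA ^ m) (dB ^ m) (?t m) * fid_min (dA ^ n) (dB ^ n) (?t n)"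
    using fid_min_tensor_le[OF cp_tensor_power[OF N, of m] cp_tensor_power[OF N, of n]] dA by (simp add: power_add)
  finally show ?thesis .
qed

section \<open>Max-information and Doeblin information as optimal values\<close>

lemma psd_smult_iff:
  assumes "0 < (c::real)" "X \<in> ops d"
  shows "psd d (of_real c \<cdot>\<^sub>m X) \<longleftrightarrow> psd d X"
proof
  assume "psd d (of_real c \<cdot>\<^sub>m X)"
  then have "psd d (of_real (1 / c) \<cdot>\<^sub>m (of_real c \<cdot>\<^sub>m X))" by (rule psd_smult) (use assms in simp)
  moreover have "of_real (1 / c) \<cdot>\<^sub>m (of_real c \<cdot>\<^sub>m X) = X" using assms by (intro eq_matI) auto
  ultimately show "psd d X" by simp
qed (use assms in \<open>simp add: psd_smult\<close>)

lemma kron_max_mixed: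
  "kron (max_mixed d) Y = of_real (1 / real d) \<cdot>\<^sub>m amp d Y"
proof (rule eq_matI)
  fix i j assume "i < dim_row (of_real (1 / real d) \<cdot>\<^sub>m amp d Y)" "j < dim_col (of_real (1 / real d) \<cdot>\<^sub>m amp d Y)"
  then have "i < d * dim_row Y" "j < d * dim_col Y" by (auto simp: kron_def)
  then show "kron (max_mixed d) Y $$ (i, j) = (of_real (1 / real d) \<cdot>\<^sub>m amp d Y) $$ (i, j)"
    by (simp add: kron_def max_mixed_def div_less_idx)
qed (simp_all add: kron_def max_mixed_def)

lemma kron_smult_right: "kron X (c \<cdot>\<^sub>m Y) = c \<cdot>\<^sub>m kron X Y"
proof (rule eq_matI)
  fix i j assume "i < dim_row (c \<cdot>\<^sub>m kron X Y)" "j < dim_col (c \<cdot>\<^sub>m kron X Y)"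
  then have "i < dim_row X * dim_row Y" "j < dim_col X * dim_col Y" by (auto simp: kron_def)
  then show "kron X (c \<cdot>\<^sub>m Y) $$ (i, j) = (c \<cdot>\<^sub>m kron X Y) $$ (i, j)"
    by (simp add: kron_def mod_less_idx)
qed (simp_all add: kron_def)

lemma mtrace_smult: "X \<in> ops d \<Longrightarrow> mtrace (c \<cdot>\<^sub>m X) = c * mtrace X"
  by (simp add: mtrace_def sum_distrib_left)

text \<open>The factor 1/d_A occurs both in the Choi operator and in the maximally mixed state and
  cancels; l s is the dual operator.\<close>

lemma I_max_cond_iff:
  assumes N: "linear_op_map dA dB N" and dA: "0 < dA" and s: "s \<in> ops dB"
  shows "loewner_le (dA * dB) (choi dA dB N) (of_real l \<cdot>\<^sub>m kron (max_mixed dA) s)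
    \<longleftrightarrow> psd (dA * dB) (amp dA (of_real l \<cdot>\<^sub>m s) - choiU dA dB N)"
proof -
  note k = kron_carrier[OF one_carrier_mat[of dA] s]
  have "of_real l \<cdot>\<^sub>m kron (max_mixed dA) s - choi dA dB N
    = of_real (1 / real dA) \<cdot>\<^sub>m (amp dA (of_real l \<cdot>\<^sub>m s) - choiU dA dB N)"
    unfolding choi_eq[OF N] kron_max_mixed kron_smult_right
    using k by (intro eq_matI) (auto simp: algebra_simps)
  then show ?thesis unfolding loewner_le_def using dA k
    by (simp only:) (intro psd_smult_iff, auto intro!: minus_carrier_mat)
qed

text \<open>The same cancellation; for l > 0 the dual operator is y / l.\<close>

lemma I_doe_cond_iff:
  assumes N: "linear_op_map dA dB N" and dA: "0 < dA" and y: "y \<in> ops dB"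
  shows "loewner_le (dA * dB) (kron (max_mixed dA) y) (of_real l \<cdot>\<^sub>m choi dA dB N)
    \<longleftrightarrow> psd (dA * dB) (of_real l \<cdot>\<^sub>m choiU dA dB N - amp dA y)"
proof -
  note k = kron_carrier[OF one_carrier_mat[of dA] y]
  have "of_real l \<cdot>\<^sub>m choi dA dB N - kron (max_mixed dA) y
    = of_real (1 / real dA) \<cdot>\<^sub>m (of_real l \<cdot>\<^sub>m choiU dA dB N - amp dA y)"
    unfolding choi_eq[OF N] kron_max_mixed
    using k by (intro eq_matI) (auto simp: algebra_simps)
  then show ?thesis unfolding loewner_le_def using dA k
    by (simp only:) (intro psd_smult_iff, auto intro!: minus_carrier_mat)
qed

text \<open>A dual operator S splits into the number l = tr S and the state S / l.\<close>

lemma I_max_eq: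
  assumes N: "cp_map dA dB N" and dA: "0 < dA" and pos: "0 < fid_max dA dB N"
  shows "I_max dA dB N = ereal (log 2 (fid_max dA dB N))"
proof (rule antisym)
  let ?b = "fid_max dA dB N"
  obtain C where C: "channel dB dA C" "fid dA dB N C = ?b" using fid_max_duality(1)[OF N dA] by blast
  have trace_ge: "?b \<le> Re (mtrace S)" if S: "S \<in> ops dB" "psd (dA * dB) (amp dA S - choiU dA dB N)" for S
    using psd_kron_one_diff_pairing(2)[OF channel_cp[OF C(1)] choiU_carrier S] C(2)
    by (simp add: fid_def channel_mtrace[OF C(1) S(1)])
  show "ereal (log 2 ?b) \<le> I_max dA dB N"
    unfolding I_max_def
  proof (intro Inf_greatest, clarify)
    fix l s assume s: "state dB s" and le: "loewner_le (dA * dB) (choi dA dB N) (of_real l \<cdot>\<^sub>m kron (max_mixed dA) s)"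
    have sc: "s \<in> ops dB" using s by (simp add: state_def psd_carrier)
    have "?b \<le> Re (mtrace (of_real l \<cdot>\<^sub>m s))"
      using le I_max_cond_iff[OF cp_linear[OF N] dA sc] sc by (intro trace_ge) auto
    then have "?b \<le> l" using s by (simp add: mtrace_smult[OF sc] state_def)
    then show "ereal (log 2 ?b) \<le> elog2 l" using pos by (simp add: elog2_def)
  qed
  show "I_max dA dB N \<le> ereal (log 2 ?b)"
  proof (rule ereal_le_epsilon2)
    fix e :: real assume e: "0 < e"
    \<comment> \<open>The slack is chosen so that tr S is at most b 2^e, which costs at most e after
      taking the logarithm.\<close>
    have "1 < (2::real) powr e" using e by simp
    then have "0 < ?b * (2 powr e - 1)" using pos by simp
    then obtain S where S: "psd dB S" "psd (dA * dB) (amp dA S - choiU dA dB N)"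
      and St: "Re (mtrace S) \<le> ?b + ?b * (2 powr e - 1)" using fid_max_duality(3)[OF N dA] by blast
    define t where "t = Re (mtrace S)"
    note Sc = psd_carrier[OF S(1)]
    have t: "0 < t" "t \<le> ?b * 2 powr e" using trace_ge[OF Sc S(2)] pos St by (auto simp: t_def algebra_simps)
    have trS: "mtrace S = of_real t"
      using psd_diag(1)[OF S(1)] Sc by (simp add: t_def complex_eq_iff) (simp add: mtrace_def)
    define s where "s = of_real (1 / t) \<cdot>\<^sub>m S"
    have s: "state dB s" unfolding state_def s_def
      using t S(1) by (auto simp: mtrace_smult[OF Sc] trS intro!: psd_smult simp flip: of_real_mult of_real_divide)
    have sc: "s \<in> ops dB" using Sc by (simp add: s_def)
    have "of_real t \<cdot>\<^sub>m s = S" using t Sc by (intro eq_matI) (auto simp: s_def)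
    then have "loewner_le (dA * dB) (choi dA dB N) (of_real t \<cdot>\<^sub>m kron (max_mixed dA) s)"
      using I_max_cond_iff[OF cp_linear[OF N] dA sc] S(2) by simp
    then have "I_max dA dB N \<le> elog2 t" unfolding I_max_def using s by (intro Inf_lower) blast
    also have "... \<le> ereal (log 2 (?b * 2 powr e))" using t pos by (simp add: elog2_def)
    also have "... = ereal (log 2 ?b) + ereal e" using pos by (simp add: log_mult)
    finally show "I_max dA dB N \<le> ereal (log 2 ?b) + ereal e" .
  qed
qed

lemma pairing_smult:
  assumes "linear_op_map dB dA C" "K \<in> ops (dA * dB)"
  shows "pairing dA dB C (c \<cdot>\<^sub>m K) = c * pairing dA dB C K"
proof -
  have "C (blk dB i j (c \<cdot>\<^sub>m K)) $$ (i, j) = c * C (blk dB i j K) $$ (i, j)" if "i < dA" "j < dA" for i j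
  proof -
    have "blk dB i j (c \<cdot>\<^sub>m K) = c \<cdot>\<^sub>m blk dB i j K"
      using assms that by (intro eq_matI) (auto simp: idx_less)
    moreover have "C (c \<cdot>\<^sub>m blk dB i j K) = c \<cdot>\<^sub>m C (blk dB i j K)"
      using assms by (simp add: linear_op_map_def)
    ultimately show ?thesis using that carrier_matD[OF linear_carrier[OF assms(1) blk_carrier[of dB i j K]]] by simp
  qed
  then show ?thesis by (simp add: pairing_def sum_distrib_left)
qed

text \<open>A dual operator Y of positive trace gives l = 1 / tr Y and y = l Y, so a small l means a
  large tr Y. If the minimum is 0, no pair is feasible and the infimum of the empty set is
  \<infinity>.\<close>

lemma I_doe_eq:
  assumes N: "cp_map dA dB N" and dA: "0 < dA"
  shows "I_doe dA dB N = (if fid_min dA dB N = 0 then \<infinity> else ereal (- log 2 (fid_min dA dB N)))"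
proof -
  let ?a = "fid_min dA dB N"
  have a0: "0 \<le> ?a" by (rule fid_min_nonneg[OF N dA])
  obtain C where C: "channel dB dA C" "fid dA dB N C = ?a" using fid_min_duality(1)[OF N dA] by blast
  \<comment> \<open>The operator inequality is tested on an optimal channel, and tr y = 1.\<close>
  have ge: "1 \<le> l * ?a" if y: "aff_state dB y"
    and le: "loewner_le (dA * dB) (kron (max_mixed dA) y) (of_real l \<cdot>\<^sub>m choi dA dB N)" for l y
  proof -
    have yc: "y \<in> ops dB" using y by (simp add: aff_state_def hermitian_carrier)
    have "psd (dA * dB) (of_real l \<cdot>\<^sub>m choiU dA dB N - amp dA y)"
      using le I_doe_cond_iff[OF cp_linear[OF N] dA yc] by blast
    from psd_kron_one_diff_pairing(1)[OF channel_cp[OF C(1)] smult_carrier_mat[OF choiU_carrier] yc this]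
    show ?thesis
      using y C(2) by (simp add: channel_mtrace[OF C(1) yc] aff_state_def pairing_smult[OF channel_linear[OF C(1)] choiU_carrier] fid_def)
  qed
  show ?thesis
  proof (cases "?a = 0")
    case True
    then have no: "\<not> (aff_state dB y \<and>
      loewner_le (dA * dB) (kron (max_mixed dA) y) (of_real l \<cdot>\<^sub>m choi dA dB N))" for l y
      using ge[of y l] by auto
    have "I_doe dA dB N = Inf {}"
      unfolding I_doe_def by (rule arg_cong[of _ _ Inf]) (use no in blast)
    then show ?thesis using True by (simp add: top_ereal_def)
  next
    case False
    then have a: "0 < ?a" using a0 by simp
    have "I_doe dA dB N = ereal (- log 2 ?a)"
    proof (rule antisym)
      show "ereal (- log 2 ?a) \<le> I_doe dA dB N"
        unfolding I_doe_def
      proof (intro Inf_greatest, clarify)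
        fix l y assume "aff_state dB y" "loewner_le (dA * dB) (kron (max_mixed dA) y) (of_real l \<cdot>\<^sub>m choi dA dB N)"
        from ge[OF this] have *: "1 \<le> l * ?a" .
        then have l: "0 < l" using a by (smt (verit) mult_nonpos_nonneg)
        have "0 \<le> log 2 (l * ?a)" using * by simp
        then have "- log 2 ?a \<le> log 2 l" using l a by (simp add: log_mult)
        then show "ereal (- log 2 ?a) \<le> elog2 l" using l by (simp add: elog2_def)
      qed
      show "I_doe dA dB N \<le> ereal (- log 2 ?a)"
      proof (rule ereal_le_epsilon2)
        fix e :: real assume e: "0 < e"
        \<comment> \<open>The slack is chosen so that tr Y is at least a 2^(-e).\<close>
        have "(2::real) powr (- e) < 2 powr 0" using e by (intro powr_less_mono) auto
        then have "0 < ?a * (1 - 2 powr (- e))" using a by simp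
        then obtain Y where Y: "hermitian_op dB Y" "psd (dA * dB) (choiU dA dB N - amp dA Y)"
          and Yt: "?a - ?a * (1 - 2 powr (- e)) \<le> Re (mtrace Y)" using fid_min_duality(3)[OF N dA] by blast
        define t where "t = Re (mtrace Y)"
        note Yc = hermitian_carrier[OF Y(1)]
        have t1: "?a * 2 powr (- e) \<le> t" using Yt by (simp add: t_def algebra_simps)
        then have t: "0 < t" using a by (smt (verit) mult_pos_pos powr_gt_zero)
        have diag: "Im (Y $$ (i, i)) = 0" if "i < dB" for i
        proof -
          have "Y $$ (i, i) = cnj (Y $$ (i, i))" using Y(1) that unfolding hermitian_op_iff by blast
          then show ?thesis by (simp add: complex_eq_iff)
        qed
        have trY: "mtrace Y = of_real t"
          using diag Yc by (simp add: t_def complex_eq_iff) (simp add: mtrace_def)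
        define y where "y = of_real (1 / t) \<cdot>\<^sub>m Y"
        have yc: "y \<in> ops dB" using Yc by (simp add: y_def)
        have "hermitian_op dB y"
          unfolding hermitian_op_iff
        proof (intro conjI allI impI yc)
          fix i j assume ij: "i < dB" "j < dB"
          then have "Y $$ (j, i) = cnj (Y $$ (i, j))" using Y(1) unfolding hermitian_op_iff by blast
          then show "y $$ (j, i) = cnj (y $$ (i, j))" using ij Yc by (simp add: y_def)
        qed
        then have y: "aff_state dB y" unfolding aff_state_def
          using t by (simp add: y_def mtrace_smult[OF Yc] trY flip: of_real_mult of_real_divide)
        have "of_real (1 / t) \<cdot>\<^sub>m choiU dA dB N - amp dA y = of_real (1 / t) \<cdot>\<^sub>m (choiU dA dB N - amp dA Y)"
          unfolding y_def kron_smult_right using kron_carrier[OF one_carrier_mat[of dA] Yc]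
          by (intro eq_matI) (auto simp: algebra_simps)
        then have "loewner_le (dA * dB) (kron (max_mixed dA) y) (of_real (1 / t) \<cdot>\<^sub>m choi dA dB N)"
          using I_doe_cond_iff[OF cp_linear[OF N] dA yc, of "1 / t"] psd_smult[OF Y(2), of "1 / t"] t by simp
        then have "I_doe dA dB N \<le> elog2 (1 / t)" unfolding I_doe_def using y by (intro Inf_lower) blast
        also have "... = ereal (- log 2 t)" using t by (simp add: elog2_def log_divide)
        also have "... \<le> ereal (- log 2 (?a * 2 powr (- e)))" using t t1 a by simp
        also have "... = ereal (- log 2 ?a) + ereal e" using a by (simp add: log_mult)
        finally show "I_doe dA dB N \<le> ereal (- log 2 ?a) + ereal e" .
      qed
    qed
    then show ?thesis using False by simp
  qed
qed

section \<open>Exponents\<close>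

text \<open>Divide with remainder, n = k q + s. The term |x k| absorbs the incomplete block s / k,
  and the sum over s < k bounds the remainder x s uniformly in n.\<close>

lemma fekete_real:
  fixes x :: "nat \<Rightarrow> real"
  assumes sup: "\<And>m n. x m + x n \<le> x (m + n)" and k: "0 < k" and n: "0 < n"
  shows "x k / real k - (\<bar>x k\<bar> + (\<Sum>s<k. \<bar>x s\<bar>)) / real n \<le> x n / real n"
proof -
  have mult: "real q * x k + x s \<le> x (k * q + s)" for q s
  proof (induction q)
    case (Suc q)
    then show ?case using sup[of k "k * q + s"] by (simp add: algebra_simps)
  qed simp
  define q s where "q = n div k" and "s = n mod k"
  have ns: "n = k * q + s" "s < k" using k by (simp_all add: q_def s_def)
  have "real n * (x k / real k) = real q * x k + (real s / real k) * x k"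
    using k by (simp add: ns(1) field_simps)
  also have "(real s / real k) * x k \<le> 1 * \<bar>x k\<bar>"
  proof -
    have "(real s / real k) * x k \<le> (real s / real k) * \<bar>x k\<bar>" by (rule mult_left_mono) auto
    also have "... \<le> 1 * \<bar>x k\<bar>" using ns(2) by (intro mult_right_mono) auto
    finally show ?thesis .
  qed
  finally have "real n * (x k / real k) - \<bar>x k\<bar> \<le> real q * x k" by simp
  moreover have "\<bar>x s\<bar> \<le> (\<Sum>s<k. \<bar>x s\<bar>)" using ns(2) by (intro member_le_sum) auto
  ultimately have "real n * (x k / real k) - (\<bar>x k\<bar> + (\<Sum>s<k. \<bar>x s\<bar>)) \<le> x n"
    using mult[of q s] ns(1) by simp
  then have "(real n * (x k / real k) - (\<bar>x k\<bar> + (\<Sum>s<k. \<bar>x s\<bar>))) / real n \<le> x n / real n"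
    by (intro divide_right_mono) auto
  then show ?thesis using n by (simp add: diff_divide_distrib)
qed

text \<open>An infinite value propagates to all later indices because no value is -\<infinity>;
  otherwise the limit, possibly infinite, is the supremum of x k / k over k \<ge> 1.\<close>

lemma fekete_ereal:
  fixes y :: "nat \<Rightarrow> ereal"
  assumes sup: "\<And>m n. y m + y n \<le> y (m + n)" and fin: "\<And>n. y n \<noteq> - \<infinity>"
  shows "\<exists>L. (\<lambda>n. ereal (1 / real n) * y n) \<longlonglongrightarrow> L"
proof (cases "\<exists>k. y k = \<infinity>")
  case True
  then obtain k where k: "y k = \<infinity>" by blast
  have inf: "y n = \<infinity>" if "k \<le> n" for n
    using sup[of k "n - k"] that k fin[of "n - k"] by simp
  have "eventually (\<lambda>n. ereal (1 / real n) * y n = \<infinity>) sequentially"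
    by (rule eventually_mono[OF eventually_ge_at_top[of "max k 1"]]) (simp add: inf)
  then show ?thesis by (intro exI[of _ \<infinity>] tendsto_eventually)
next
  case False
  have "\<exists>z. y n = ereal z" for n using False fin[of n] by (cases "y n") auto
  then obtain x where x: "\<And>n. y n = ereal (x n)" by metis
  have supx: "x m + x n \<le> x (m + n)" for m n using sup[of m n] by (simp add: x)
  let ?L = "SUP k\<in>{1..}. ereal (x k / real k)"
  have "(\<lambda>n. ereal (1 / real n) * y n) \<longlonglongrightarrow> ?L"
  proof (rule order_tendstoI)
    fix l assume "l < ?L"
    then obtain k where k: "1 \<le> k" "l < ereal (x k / real k)" by (auto simp: less_SUP_iff)
    define c where "c = \<bar>x k\<bar> + (\<Sum>s<k. \<bar>x s\<bar>)"
    have "(\<lambda>n. ereal (x k / real k - c / real n)) \<longlonglongrightarrow> ereal (x k / real k - 0)"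
      by (intro tendsto_intros lim_const_over_n)
    then have "eventually (\<lambda>n. l < ereal (x k / real k - c / real n)) sequentially"
      using k(2) by (intro order_tendstoD) auto
    then show "eventually (\<lambda>n. l < ereal (1 / real n) * y n) sequentially"
      using eventually_gt_at_top[of 0]
    proof eventually_elim
      case (elim n)
      have "x k / real k - c / real n \<le> x n / real n"
        unfolding c_def using fekete_real[OF supx] k(1) elim(2) by simp
      then show ?case using elim(1) by (simp add: x) (metis ereal_less_eq(3) less_le_trans)
    qed
  next
    fix u assume u: "?L < u"
    show "eventually (\<lambda>n. ereal (1 / real n) * y n < u) sequentially"
      using eventually_ge_at_top[of 1]
    proof eventually_elim
      case (elim n)
      have "ereal (1 / real n) * y n = ereal (x n / real n)" by (simp add: x)
      also have "... \<le> ?L" using elim by (intro SUP_upper) simp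
      finally show ?case using u by (rule le_less_trans)
    qed
  qed
  then show ?thesis by blast
qed

text \<open>Minus the logarithm of submultiplicativity. A zero minimum at m + n makes the right side
  infinite, a positive one forces both factors to be positive.\<close>

lemma I_doe_superadditive:
  assumes N: "cp_map dA dB N" and dA: "0 < dA"
  defines "y \<equiv> \<lambda>n. I_doe (dA ^ n) (dB ^ n) (tensor_power dA dB N n)"
  shows "y m + y n \<le> y (m + n)" and "y n \<noteq> - \<infinity>"
proof -
  define a where "a n = fid_min (dA ^ n) (dB ^ n) (tensor_power dA dB N n)" for n
  have y: "y n = (if a n = 0 then \<infinity> else ereal (- log 2 (a n)))" for n
    unfolding y_def a_def using dA by (intro I_doe_eq cp_tensor_power[OF N]) simp
  have a0: "0 \<le> a n" for n unfolding a_def using dA by (intro fid_min_nonneg cp_tensor_power[OF N]) simp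
  have sub: "a (m + n) \<le> a m * a n" unfolding a_def by (rule fid_min_tensor_power_add[OF N dA])
  show "y n \<noteq> - \<infinity>" by (simp add: y)
  show "y m + y n \<le> y (m + n)"
  proof (cases "a (m + n) = 0")
    case False
    then have p: "0 < a (m + n)" using a0[of "m + n"] by simp
    then have "0 < a m * a n" using sub by linarith
    then have q: "0 < a m" "0 < a n" using a0[of m] a0[of n] by (auto simp: zero_less_mult_iff)
    have "log 2 (a (m + n)) \<le> log 2 (a m * a n)" using sub p q by simp
    then have "log 2 (a (m + n)) \<le> log 2 (a m) + log 2 (a n)" using q by (simp add: log_mult)
    then show ?thesis using p q by (simp add: y)
  qed (simp add: y)
qed

section \<open>Bounds on both exponents at a fixed block length\<close>

lemma neg_scaled_elog2: "0 < n \<Longrightarrow> 0 < x \<Longrightarrow> - (ereal (1 / real n) * elog2 x) = ereal (- log 2 x / real n)"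
  by (simp add: elog2_def)

lemma neg_scaled_elog2_zero: "0 < n \<Longrightarrow> - (ereal (1 / real n) * elog2 0) = \<infinity>"
  by (simp add: elog2_def)

text \<open>Here \<open>N\<close> stands for a whole block, and \<open>n\<close> enters only through
  the rate and the normalisation. The gap log 2 3 / n is the same for all blocks of that length and
  vanishes in the limit.\<close>

lemma error_exponent_bounds:
  assumes N: "cp_map dA dB N" and dA: "0 < dA" and pos: "0 < fid_max dA dB N" and n: "0 < n" and r: "0 \<le> r"
  defines "a \<equiv> fid_min dA dB N" and "b \<equiv> fid_max dA dB N"
  defines "X \<equiv> {- (ereal (1 / real n) * elog2 (p_error dA dB N dM dL Enc Dec)) | dM dL Enc Dec.
      2 \<le> dM \<and> 2 powr (real n * r) \<le> real dM \<and> strategy dA dB dM dL Enc Dec}"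
  shows "a = 0 \<Longrightarrow> Sup X = \<infinity>"
    and "0 < a \<Longrightarrow> e = (log 2 b - log 2 a) / real n - r \<Longrightarrow>
      ereal (max 0 e) \<le> Sup X \<and> Sup X \<le> ereal (max 0 e + log 2 3 / real n)"
proof -
  define P where "P = 2 powr (real n * r)"
  have P1: "1 \<le> P" unfolding P_def using r by (intro ge_one_powr_ge_zero) auto
  \<comment> \<open>The smallest alphabet allowed. For d = 2 the bound d - 1 \<le> P comes from P
    \<ge> 1.\<close>
  define d where "d = max 2 (nat \<lceil>P\<rceil>)"
  have d: "2 \<le> d" "P \<le> real d" "real d - 1 \<le> P" using P1 by (auto simp: d_def) linarith+
  obtain dL Enc Dec where st: "strategy dA dB d dL Enc Dec"
    and perr: "p_error dA dB N d dL Enc Dec = (real d - 1) * a / (b + (real d - 1) * a)"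
    using p_error_achievable[OF N dA _ pos, of d] d(1) unfolding a_def b_def by auto
  let ?err = "p_error dA dB N d dL Enc Dec"
  have mem: "- (ereal (1 / real n) * elog2 ?err) \<in> X" unfolding X_def using st d by (auto simp: P_def)
  have b: "0 < b" using pos by (simp add: b_def)
  show "Sup X = \<infinity>" if "a = 0"
  proof -
    have "\<infinity> \<in> X" using mem that neg_scaled_elog2_zero[OF n] by (simp add: perr)
    then show ?thesis using Sup_upper[of \<infinity> X] by simp
  qed
  show "ereal (max 0 e) \<le> Sup X \<and> Sup X \<le> ereal (max 0 e + log 2 3 / real n)"
    if a: "0 < a" and e: "e = (log 2 b - log 2 a) / real n - r"
  proof
    have ne: "real n * e = log 2 b - log 2 a - log 2 P" using n by (simp add: e P_def field_simps)
    have ratio: "2 powr (real n * e) = b / (a * P)"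
      unfolding ne using a b P1 by (simp add: powr_diff)
    have da: "0 < (real d - 1) * a" using a d(1) by simp
    have e0: "0 < ?err" unfolding perr using da b by (intro divide_pos_pos) auto
    have e1: "?err \<le> 1" unfolding perr using da b by (simp add: divide_le_eq_1)
    \<comment> \<open>Dropping the second term of the denominator bounds the error by P a / b =
      2^(-n e); with the trivial bound 1 this gives both parts of the maximum.\<close>
    have "?err \<le> (real d - 1) * a / b" unfolding perr using da b by (intro divide_left_mono) auto
    also have "... \<le> P * a / b" using d(3) a b by (intro divide_right_mono mult_right_mono) auto
    also have "... = 2 powr (- (real n * e))" unfolding powr_minus ratio using a b by simp
    finally have "log 2 ?err \<le> log 2 (2 powr (- (real n * e)))" using e0 by (intro log_mono) auto
    then have "real n * e \<le> - log 2 ?err" by simp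
    moreover have "log 2 ?err \<le> 0" using e0 e1 by simp
    ultimately have "max 0 e \<le> - log 2 ?err / real n" using n by (auto simp: field_simps)
    then have "ereal (max 0 e) \<le> - (ereal (1 / real n) * elog2 ?err)"
      unfolding neg_scaled_elog2[OF n e0] by (simp only: ereal_less_eq)
    then show "ereal (max 0 e) \<le> Sup X" using Sup_upper[OF mem] by (rule order_trans)
    show "Sup X \<le> ereal (max 0 e + log 2 3 / real n)"
    proof (rule Sup_least)
      fix z assume "z \<in> X"
      then obtain dM dL Enc Dec where dM: "2 \<le> dM" "P \<le> real dM" and st: "strategy dA dB dM dL Enc Dec"
        and z: "z = - (ereal (1 / real n) * elog2 (p_error dA dB N dM dL Enc Dec))"
        unfolding X_def P_def by blast
      define err where "err = p_error dA dB N dM dL Enc Dec"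
      \<comment> \<open>Covers both regimes at once: 2^w is the larger of 1 and b / (a P).\<close>
      define w where "w = real n * max 0 e"
      define x where "x = a * (real dM - 1)"
      have x: "0 < x" using a dM(1) by (simp add: x_def)
      have err0: "0 \<le> err" unfolding err_def using p_error_converse(1)[OF N dA st] dM(1) by simp
      have "(1 - err) * x \<le> err * b"
        using p_error_converse(4)[OF N dA st] dM(1) a by (simp add: err_def x_def a_def b_def mult.assoc)
      then have 1: "x \<le> err * (b + x)" by (simp add: algebra_simps)
      have w1: "1 \<le> 2 powr w" unfolding w_def by (intro ge_one_powr_ge_zero) auto
      have "2 powr (real n * e) \<le> 2 powr w" unfolding w_def by (intro powr_mono mult_left_mono) auto
      then have "b \<le> a * P * 2 powr w" unfolding ratio using a P1 by (simp add: field_simps)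
      \<comment> \<open>An alphabet of at least two letters has dM \<le> 2 (dM - 1), hence a factor
        2 here; the summand \<open>x\<close> below raises it to the constant 3.\<close>
      also have "... \<le> a * (2 * (real dM - 1)) * 2 powr w"
        using a dM by (intro mult_right_mono mult_left_mono) auto
      finally have "b \<le> 2 * x * 2 powr w" by (simp add: x_def mult_ac)
      moreover have "x \<le> x * 2 powr w" using x w1 by simp
      ultimately have "b + x \<le> 3 * x * 2 powr w" by simp
      then have "err * (b + x) \<le> err * (3 * x * 2 powr w)" using err0 by (rule mult_left_mono)
      with 1 have "x * 1 \<le> x * (3 * err * 2 powr w)" by (simp add: mult_ac)
      then have 2: "1 \<le> 3 * err * 2 powr w" using x by (simp only: mult_le_cancel_left_pos)
      then have ep: "0 < err" using err0 by (cases "err = 0") auto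
      have "0 \<le> log 2 (3 * err * 2 powr w)" using 2 by simp
      also have "log 2 (3 * err * 2 powr w) = log 2 3 + log 2 err + w" using ep by (simp add: log_mult)
      finally have "- log 2 err / real n \<le> (log 2 3 + w) / real n" by (intro divide_right_mono) auto
      also have "... = max 0 e + log 2 3 / real n" using n by (simp add: w_def field_simps)
      finally show "z \<le> ereal (max 0 e + log 2 3 / real n)"
        unfolding z err_def[symmetric] neg_scaled_elog2[OF n ep] by simp
    qed
  qed
qed

lemma strong_converse_exponent_bounds:
  assumes N: "cp_map dA dB N" and dA: "0 < dA" and pos: "0 < fid_max dA dB N" and n: "0 < n" and r: "0 \<le> r"
  defines "a \<equiv> fid_min dA dB N" and "b \<equiv> fid_max dA dB N"
  defines "X \<equiv> {- (ereal (1 / real n) * elog2 (1 - p_error dA dB N dM dL Enc Dec)) | dM dL Enc Dec.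
      2 powr (real n * r) \<le> real dM \<and> strategy dA dB dM dL Enc Dec}"
  shows "a = 0 \<Longrightarrow> Inf X = 0"
    and "0 < a \<Longrightarrow> e = r - (log 2 b - log 2 a) / real n \<Longrightarrow>
      ereal (max 0 e) \<le> Inf X \<and> Inf X \<le> ereal (max 0 e + 1 / real n)"
proof -
  define P where "P = 2 powr (real n * r)"
  have P1: "1 \<le> P" unfolding P_def using r by (intro ge_one_powr_ge_zero) auto
  define d where "d = nat \<lceil>P\<rceil>"
  have d: "1 \<le> d" "P \<le> real d" "real d - 1 \<le> P" using P1 by (auto simp: d_def) linarith+
  obtain dL Enc Dec where st: "strategy dA dB d dL Enc Dec"
    and perr: "p_error dA dB N d dL Enc Dec = (real d - 1) * a / (b + (real d - 1) * a)"
    using p_error_achievable[OF N dA _ pos, of d] d(1) unfolding a_def b_def by auto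
  let ?s = "1 - p_error dA dB N d dL Enc Dec"
  have mem: "- (ereal (1 / real n) * elog2 ?s) \<in> X" unfolding X_def using st d by (auto simp: P_def)
  have b: "0 < b" using pos by (simp add: b_def)
  have nonneg: "0 \<le> z" if "z \<in> X" for z
  proof -
    from that obtain dM dL Enc Dec where dM: "P \<le> real dM" and st: "strategy dA dB dM dL Enc Dec"
      and z: "z = - (ereal (1 / real n) * elog2 (1 - p_error dA dB N dM dL Enc Dec))"
      unfolding X_def P_def by blast
    have "0 < dM" using dM P1 by (cases dM) auto
    then have "0 \<le> 1 - p_error dA dB N dM dL Enc Dec" "1 - p_error dA dB N dM dL Enc Dec \<le> 1"
      using p_error_converse(1,2)[OF N dA st] by auto
    then consider "1 - p_error dA dB N dM dL Enc Dec = 0" | "0 < 1 - p_error dA dB N dM dL Enc Dec"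
      "1 - p_error dA dB N dM dL Enc Dec \<le> 1" by linarith
    then show ?thesis
    proof cases
      case 1
      then show ?thesis unfolding z by (simp only: neg_scaled_elog2_zero[OF n]) simp
    next
      case 2
      have "log 2 (1 - p_error dA dB N dM dL Enc Dec) \<le> 0" using 2 by simp
      then show ?thesis unfolding z neg_scaled_elog2[OF n 2(1)] using n by (simp add: divide_nonpos_pos)
    qed
  qed
  show "Inf X = 0" if "a = 0"
  proof (rule antisym)
    have "- (ereal (1 / real n) * elog2 ?s) = 0" unfolding perr using that by (simp add: elog2_def)
    then show "Inf X \<le> 0" using Inf_lower[OF mem] by (simp only:)
    show "0 \<le> Inf X" by (rule Inf_greatest) (rule nonneg)
  qed
  show "ereal (max 0 e) \<le> Inf X \<and> Inf X \<le> ereal (max 0 e + 1 / real n)"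
    if a: "0 < a" and e: "e = r - (log 2 b - log 2 a) / real n"
  proof
    have ne: "real n * e = log 2 P + log 2 a - log 2 b" using n by (simp add: e P_def field_simps)
    have ratio: "2 powr (real n * e) = a * P / b"
      unfolding ne using a b P1 by (simp add: powr_diff powr_add)
    show "ereal (max 0 e) \<le> Inf X"
    proof (rule Inf_greatest)
      fix z assume zX: "z \<in> X"
      then obtain dM dL Enc Dec where dM: "P \<le> real dM" and st: "strategy dA dB dM dL Enc Dec"
        and z: "z = - (ereal (1 / real n) * elog2 (1 - p_error dA dB N dM dL Enc Dec))"
        unfolding X_def P_def by blast
      define s where "s = 1 - p_error dA dB N dM dL Enc Dec"
      have dM0: "0 < dM" using dM P1 by (cases dM) auto
      have s0: "0 \<le> s" using p_error_converse(2)[OF N dA st dM0] by (simp add: s_def)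
      have "s * a * real dM \<le> b"
        using p_error_converse(3)[OF N dA st dM0] a by (simp add: s_def a_def b_def)
      moreover have "s * a * P \<le> s * a * real dM" using s0 a dM by (intro mult_left_mono) auto
      ultimately have le: "s * (a * P) \<le> b" by (simp add: mult.assoc)
      have "ereal e \<le> z"
      proof (cases "s = 0")
        case True
        then show ?thesis unfolding z s_def[symmetric] by (simp only: neg_scaled_elog2_zero[OF n]) simp
      next
        case False
        then have sp: "0 < s" using s0 by simp
        have "log 2 (s * 2 powr (real n * e)) \<le> log 2 1"
          using le sp a b P1 unfolding ratio by (intro log_mono) (auto simp: field_simps)
        then have "log 2 s + real n * e \<le> 0" using sp by (simp add: log_mult)
        then have "e \<le> - log 2 s / real n" using n by (simp add: field_simps)
        then show ?thesis unfolding z s_def[symmetric] neg_scaled_elog2[OF n sp] by simp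
      qed
      then show "ereal (max 0 e) \<le> z" using nonneg[OF zX] by (auto simp: max_def zero_ereal_def)
    qed
    define w where "w = real n * max 0 e"
    have w1: "1 \<le> 2 powr w" unfolding w_def by (intro ge_one_powr_ge_zero) auto
    have "2 powr (real n * e) \<le> 2 powr w" unfolding w_def by (intro powr_mono mult_left_mono) auto
    then have aP: "a * P \<le> b * 2 powr w" unfolding ratio using b by (simp add: field_simps)
    have da: "0 \<le> (real d - 1) * a" using a d(1) by simp
    have s: "?s = b / (b + (real d - 1) * a)" unfolding perr using b da by (simp add: field_simps)
    have sp: "0 < ?s" unfolding s using b da by (intro divide_pos_pos) auto
    have "(real d - 1) * a \<le> a * P" using d(3) a by (simp add: mult.commute)
    moreover have "b \<le> b * 2 powr w" using b w1 by simp
    \<comment> \<open>Two terms, each at most b 2^w; this factor 2 is the source of the gap 1 /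
      n.\<close>
    ultimately have "b + (real d - 1) * a \<le> b * (2 * 2 powr w)" using aP by simp
    then have "b / (b * (2 * 2 powr w)) \<le> ?s" unfolding s using b da by (intro divide_left_mono mult_pos_pos) auto
    then have "log 2 (b / (b * (2 * 2 powr w))) \<le> log 2 ?s" using b by (intro log_mono) auto
    also have "log 2 (b / (b * (2 * 2 powr w))) = - 1 - w"
      using b by (simp add: log_divide log_mult)
    finally have "- log 2 ?s / real n \<le> (1 + w) / real n" by (intro divide_right_mono) auto
    also have "... = max 0 e + 1 / real n" using n by (simp add: w_def field_simps)
    finally have "- (ereal (1 / real n) * elog2 ?s) \<le> ereal (max 0 e + 1 / real n)"
      unfolding neg_scaled_elog2[OF n sp] by simp
    then show "Inf X \<le> ereal (max 0 e + 1 / real n)" using Inf_lower[OF mem] by (rule order_trans[rotated])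
  qed
qed

text \<open>Truncation at 0 makes the limits of both summands of the upper bound nonnegative, so
  their addition is continuous there even if \<open>L\<close> is infinite.\<close>

lemma tendsto_max_zero_sandwich:
  fixes f g :: "nat \<Rightarrow> ereal" and c :: real
  assumes g: "g \<longlonglongrightarrow> L"
    and "eventually (\<lambda>n. max 0 (g n) \<le> f n \<and> f n \<le> max 0 (g n) + ereal (c / real n)) sequentially"
  shows "f \<longlonglongrightarrow> max 0 L"
proof (rule tendsto_sandwich)
  have m: "(\<lambda>n. max 0 (g n)) \<longlonglongrightarrow> max 0 L" by (intro tendsto_max tendsto_const g)
  then show "(\<lambda>n. max 0 (g n)) \<longlonglongrightarrow> max 0 L" .
  have "(\<lambda>n. ereal (c / real n)) \<longlonglongrightarrow> ereal 0" by (intro tendsto_intros lim_const_over_n)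
  then have "(\<lambda>n. max 0 (g n) + ereal (c / real n)) \<longlonglongrightarrow> max 0 L + ereal 0"
    using m by (intro tendsto_add_ereal_nonneg) (auto simp: max_def)
  then show "(\<lambda>n. max 0 (g n) + ereal (c / real n)) \<longlonglongrightarrow> max 0 L" by (simp add: zero_ereal_def[symmetric])
  show "eventually (\<lambda>n. max 0 (g n) \<le> f n) sequentially" "eventually (\<lambda>n. f n \<le> max 0 (g n) + ereal (c / real n)) sequentially"
    using assms(2) by (auto elim: eventually_mono)
qed

theorem theorem6:
  fixes dA dB :: nat and N :: "complex mat \<Rightarrow> complex mat" and r :: real
  assumes "cp_map dA dB N"
    and "\<exists>X\<in>carrier_mat dA dA. N X \<noteq> 0\<^sub>m dB dB"
    and "0 \<le> r"
  shows "E_retro dA dB N r = max 0 (I_max dA dB N + I_doe_reg dA dB N - ereal r)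
    \<and> S_retro dA dB N r = max 0 (ereal r - I_max dA dB N - I_doe_reg dA dB N)"
proof -
  note N = assms(1)
  \<comment> \<open>In dimension zero the expansion of N X is an empty sum, so \<open>N\<close>
    would vanish.\<close>
  have dA: "0 < dA"
  proof (rule ccontr)
    assume "\<not> 0 < dA"
    obtain X where X: "X \<in> ops dA" "N X \<noteq> 0\<^sub>m dB dB" using assms(2) by blast
    have "N X = 0\<^sub>m dB dB"
      using carrier_matD[OF linear_carrier[OF cp_linear[OF N] X(1)]] \<open>\<not> 0 < dA\<close>
      by (intro eq_matI) (auto simp: linear_expand[OF cp_linear[OF N] X(1)])
    then show False using X(2) by simp
  qed
  define a where "a n = fid_min (dA ^ n) (dB ^ n) (tensor_power dA dB N n)" for n
  define b where "b = fid_max dA dB N"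
  define D where "D n = ereal (1 / real n) * I_doe (dA ^ n) (dB ^ n) (tensor_power dA dB N n)" for n
  have b: "0 < b" unfolding b_def by (rule fid_max_pos[OF N dA assms(2)])
  have dn: "0 < dA ^ n" for n using dA by simp
  have a0: "0 \<le> a n" for n unfolding a_def by (rule fid_min_nonneg[OF cp_tensor_power[OF N] dn])
  \<comment> \<open>Multiplicativity makes the contribution of the maxima constant after division by
    n, namely log b.\<close>
  have bn: "fid_max (dA ^ n) (dB ^ n) (tensor_power dA dB N n) = b ^ n" for n
    unfolding b_def by (rule fid_max_tensor_power[OF N dA])
  have posn: "0 < fid_max (dA ^ n) (dB ^ n) (tensor_power dA dB N n)" for n
    unfolding bn using b by simp
  have Imax: "I_max dA dB N = ereal (log 2 b)"
    unfolding b_def using I_max_eq[OF N dA] b by (simp add: b_def)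
  obtain L where L: "D \<longlonglongrightarrow> L"
    unfolding D_def using fekete_ereal[OF I_doe_superadditive[OF N dA]] by blast
  have reg: "I_doe_reg dA dB N = L" unfolding I_doe_reg_def using limI[OF L] unfolding D_def[abs_def] .
  have Dn: "D n = (if a n = 0 then \<infinity> else ereal (- log 2 (a n) / real n))" if "0 < n" for n
    unfolding D_def I_doe_eq[OF cp_tensor_power[OF N] dn] a_def[symmetric] using that by simp
  have lb: "log 2 (b ^ n) / real n = log 2 b" if "0 < n" for n
    using that b by (simp add: log_nat_power)
  have e1: "(log 2 (b ^ n) - log 2 (a n)) / real n - r = log 2 b - log 2 (a n) / real n - r"
    and e2: "r - (log 2 (b ^ n) - log 2 (a n)) / real n = r - log 2 b + log 2 (a n) / real n" if "0 < n" for n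
    using lb[OF that] by (simp_all add: diff_divide_distrib)
  have gE: "(\<lambda>n. ereal (log 2 b) + D n - ereal r) \<longlonglongrightarrow> ereal (log 2 b) + L - ereal r"
  proof -
    \<comment> \<open>The finite constants are gathered into one summand, since adding a finite
      number is continuous even where \<open>L\<close> is infinite.\<close>
    have "(\<lambda>n. D n + ereal (log 2 b - r)) \<longlonglongrightarrow> L + ereal (log 2 b - r)"
      by (rule tendsto_add_left_ereal[OF _ L]) simp
    moreover have "x + ereal (log 2 b - r) = ereal (log 2 b) + x - ereal r" for x by (cases x) auto
    ultimately show ?thesis by simp
  qed
  have gS: "(\<lambda>n. ereal r - ereal (log 2 b) - D n) \<longlonglongrightarrow> ereal r - ereal (log 2 b) - L"
  proof -
    have "(\<lambda>n. - D n + ereal (r - log 2 b)) \<longlonglongrightarrow> - L + ereal (r - log 2 b)"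
      by (rule tendsto_add_left_ereal[OF _ tendsto_uminus_ereal[OF L]]) simp
    moreover have "- x + ereal (r - log 2 b) = ereal r - ereal (log 2 b) - x" for x by (cases x) auto
    ultimately show ?thesis by simp
  qed
  let ?E = "\<lambda>n. Sup {- (ereal (1 / real n) *
         elog2 (p_error (dA ^ n) (dB ^ n) (tensor_power dA dB N n) dM dL Enc Dec)) | dM dL Enc Dec.
      2 \<le> dM \<and> 2 powr (real n * r) \<le> real dM \<and> strategy (dA ^ n) (dB ^ n) dM dL Enc Dec}"
  let ?S = "\<lambda>n. Inf {- (ereal (1 / real n) *
         elog2 (1 - p_error (dA ^ n) (dB ^ n) (tensor_power dA dB N n) dM dL Enc Dec)) | dM dL Enc Dec.
      2 powr (real n * r) \<le> real dM \<and> strategy (dA ^ n) (dB ^ n) dM dL Enc Dec}"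
  have "max 0 (ereal (log 2 b) + D n - ereal r) \<le> ?E n \<and>
      ?E n \<le> max 0 (ereal (log 2 b) + D n - ereal r) + ereal (log 2 3 / real n)" if n: "0 < n" for n
  proof (cases "a n = 0")
    case True
    \<comment> \<open>D n = \<infinity> and an errorless strategy exists, so all three quantities
      are infinite.\<close>
    then show ?thesis
      using error_exponent_bounds(1)[OF cp_tensor_power[OF N] dn posn n assms(3)] by (simp add: Dn[OF n] a_def)
  next
    case False
    then have an: "0 < a n" using a0[of n] by simp
    have "ereal (log 2 b) + D n - ereal r = ereal (log 2 b - log 2 (a n) / real n - r)"
      using False by (simp add: Dn[OF n])
    then have m: "max 0 (ereal (log 2 b) + D n - ereal r) = ereal (max 0 (log 2 b - log 2 (a n) / real n - r))"
      by (simp add: zero_ereal_def max_def)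
    show ?thesis unfolding m plus_ereal.simps
      using error_exponent_bounds(2)[OF cp_tensor_power[OF N] dn posn n assms(3), of n, OF an[unfolded a_def] refl]
      unfolding bn a_def[symmetric] e1[OF n] .
  qed
  then have "?E \<longlonglongrightarrow> max 0 (ereal (log 2 b) + L - ereal r)"
    by (intro tendsto_max_zero_sandwich[OF gE]) (auto intro: eventually_mono[OF eventually_gt_at_top[of 0]])
  then have E: "E_retro dA dB N r = max 0 (ereal (log 2 b) + L - ereal r)"
    unfolding E_retro_def by (intro lim_imp_Liminf) auto
  have "max 0 (ereal r - ereal (log 2 b) - D n) \<le> ?S n \<and>
      ?S n \<le> max 0 (ereal r - ereal (log 2 b) - D n) + ereal (1 / real n)" if n: "0 < n" for n
  proof (cases "a n = 0")
    case True
    \<comment> \<open>An errorless strategy makes the exponent 0, and r - log b - \<infinity> is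
      truncated to 0.\<close>
    have "?S n = 0"
      using strong_converse_exponent_bounds(1)[OF cp_tensor_power[OF N] dn posn n assms(3)] True by (simp add: a_def)
    then show ?thesis using True by (simp only:) (simp add: Dn[OF n])
  next
    case False
    then have an: "0 < a n" using a0[of n] by simp
    have "ereal r - ereal (log 2 b) - D n = ereal (r - log 2 b + log 2 (a n) / real n)"
      using False by (simp add: Dn[OF n])
    then have m: "max 0 (ereal r - ereal (log 2 b) - D n) = ereal (max 0 (r - log 2 b + log 2 (a n) / real n))"
      by (simp add: zero_ereal_def max_def)
    show ?thesis unfolding m plus_ereal.simps
      using strong_converse_exponent_bounds(2)[OF cp_tensor_power[OF N] dn posn n assms(3), of n, OF an[unfolded a_def] refl]
      unfolding bn a_def[symmetric] e2[OF n] .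
  qed
  then have "?S \<longlonglongrightarrow> max 0 (ereal r - ereal (log 2 b) - L)"
    by (intro tendsto_max_zero_sandwich[OF gS]) (auto intro: eventually_mono[OF eventually_gt_at_top[of 0]])
  then have S: "S_retro dA dB N r = max 0 (ereal r - ereal (log 2 b) - L)"
    unfolding S_retro_def by (intro lim_imp_Limsup) auto
  show ?thesis unfolding E S Imax reg by simp
qed

end
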